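(* Let $p$ be a prime, $n\geq 1$ an integer, and $k$ a field of characteristic $p$. If $G=\mathrm{SL}_2(p^n)$, then every simple $kG$-module is algebraic.
   Context: A $kG$-module $M$ (finite-dimensional, $G$ finite) is algebraic if only finitely many isomorphism classes of indecomposable modules occur as direct summands of the tensor powers $M^{\otimes n}$, $n\geq 1$. *)

theory Defs
  imports "Jordan_Normal_Form.Determinant"
begin

text \<open>Finite-dimensional kG-modules are represented as matrix representations
  rho : G -> GL_d(k) of a group given by a carrier set G, a multiplication mul
  and an identity e. Module isomorphism = equivalence of representations.\<close>

definition is_rep :: "'g set \<Rightarrow> ('g \<Rightarrow> 'g \<Rightarrow> 'g) \<Rightarrow> 'g \<Rightarrow> nat \<Rightarrow> ('g \<Rightarrow> 'k::field mat) \<Rightarrow> bool" where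
  "is_rep G mul e d \<rho> \<longleftrightarrow>
     (\<forall>g\<in>G. \<rho> g \<in> carrier_mat d d) \<and>
     (\<forall>g\<in>G. \<forall>h\<in>G. \<rho> (mul g h) = \<rho> g * \<rho> h) \<and>
     \<rho> e = 1\<^sub>m d"

definition rep_iso :: "'g set \<Rightarrow> nat \<Rightarrow> ('g \<Rightarrow> 'k::field mat) \<Rightarrow> nat \<Rightarrow> ('g \<Rightarrow> 'k mat) \<Rightarrow> bool" where
  "rep_iso G d \<rho> d' \<sigma> \<longleftrightarrow> d = d' \<and>
     (\<exists>P \<in> carrier_mat d d. invertible_mat P \<and> (\<forall>g\<in>G. P * \<rho> g = \<sigma> g * P))"

definition rep_sum :: "nat \<Rightarrow> ('g \<Rightarrow> 'k::field mat) \<Rightarrow> nat \<Rightarrow> ('g \<Rightarrow> 'k mat) \<Rightarrow> ('g \<Rightarrow> 'k mat)" where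
  "rep_sum d \<sigma> d' \<tau> = (\<lambda>g. four_block_mat (\<sigma> g) (0\<^sub>m d d') (0\<^sub>m d' d) (\<tau> g))"

definition direct_summand :: "'g set \<Rightarrow> ('g \<Rightarrow> 'g \<Rightarrow> 'g) \<Rightarrow> 'g \<Rightarrow> nat \<Rightarrow> ('g \<Rightarrow> 'k::field mat) \<Rightarrow> nat \<Rightarrow> ('g \<Rightarrow> 'k mat) \<Rightarrow> bool" where
  "direct_summand G mul e d' \<sigma> d \<rho> \<longleftrightarrow>
     (\<exists>d'' \<tau>. is_rep G mul e d'' \<tau> \<and> rep_iso G d \<rho> (d' + d'') (rep_sum d' \<sigma> d'' \<tau>))"

definition indecomposable :: "'g set \<Rightarrow> ('g \<Rightarrow> 'g \<Rightarrow> 'g) \<Rightarrow> 'g \<Rightarrow> nat \<Rightarrow> ('g \<Rightarrow> 'k::field mat) \<Rightarrow> bool" where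
  "indecomposable G mul e d \<rho> \<longleftrightarrow> is_rep G mul e d \<rho> \<and> d > 0 \<and>
     \<not> (\<exists>d1 \<sigma> d2 \<tau>. d1 > 0 \<and> d2 > 0 \<and> is_rep G mul e d1 \<sigma> \<and> is_rep G mul e d2 \<tau> \<and>
          rep_iso G d \<rho> (d1 + d2) (rep_sum d1 \<sigma> d2 \<tau>))"

definition submodule :: "'g set \<Rightarrow> nat \<Rightarrow> ('g \<Rightarrow> 'k::field mat) \<Rightarrow> 'k vec set \<Rightarrow> bool" where
  "submodule G d \<rho> W \<longleftrightarrow> W \<subseteq> carrier_vec d \<and> 0\<^sub>v d \<in> W \<and>
     (\<forall>v\<in>W. \<forall>w\<in>W. v + w \<in> W) \<and> (\<forall>c. \<forall>v\<in>W. c \<cdot>\<^sub>v v \<in> W) \<and>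
     (\<forall>g\<in>G. \<forall>v\<in>W. \<rho> g *\<^sub>v v \<in> W)"

definition simple_module :: "'g set \<Rightarrow> ('g \<Rightarrow> 'g \<Rightarrow> 'g) \<Rightarrow> 'g \<Rightarrow> nat \<Rightarrow> ('g \<Rightarrow> 'k::field mat) \<Rightarrow> bool" where
  "simple_module G mul e d \<rho> \<longleftrightarrow> is_rep G mul e d \<rho> \<and> d > 0 \<and>
     (\<forall>W. submodule G d \<rho> W \<longrightarrow> W = {0\<^sub>v d} \<or> W = carrier_vec d)"

definition kron :: "'k::field mat \<Rightarrow> 'k mat \<Rightarrow> 'k mat" where
  "kron A B = mat (dim_row A * dim_row B) (dim_col A * dim_col B)
     (\<lambda>(i, j). A $$ (i div dim_row B, j div dim_col B) * B $$ (i mod dim_row B, j mod dim_col B))"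

text \<open>tensor_pow rho n = rho^{(tensor) n} (meaningful for n >= 1), of dimension d^n.\<close>
fun tensor_pow :: "('g \<Rightarrow> 'k::field mat) \<Rightarrow> nat \<Rightarrow> ('g \<Rightarrow> 'k mat)" where
  "tensor_pow \<rho> 0 = \<rho>"
| "tensor_pow \<rho> (Suc 0) = \<rho>"
| "tensor_pow \<rho> (Suc (Suc n)) = (\<lambda>g. kron (tensor_pow \<rho> (Suc n) g) (\<rho> g))"

definition algebraic :: "'g set \<Rightarrow> ('g \<Rightarrow> 'g \<Rightarrow> 'g) \<Rightarrow> 'g \<Rightarrow> nat \<Rightarrow> ('g \<Rightarrow> 'k::field mat) \<Rightarrow> bool" where
  "algebraic G mul e d \<rho> \<longleftrightarrow>
     (\<exists>S :: (nat \<times> ('g \<Rightarrow> 'k mat)) set. finite S \<and>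
        (\<forall>n \<ge> 1. \<forall>d' \<sigma>. indecomposable G mul e d' \<sigma> \<and> direct_summand G mul e d' \<sigma> (d ^ n) (tensor_pow \<rho> n)
           \<longrightarrow> (\<exists>(d'', \<sigma>') \<in> S. rep_iso G d' \<sigma> d'' \<sigma>')))"

definition SL2 :: "'q::{finite,field} mat set" where
  "SL2 = {A \<in> carrier_mat 2 2. det A = 1}"

end

(* The tensor powers of a simple module M are controlled after extending scalars to the algebraic
   closure. A vector and a functional fixed by the upper unitriangular group give a matrix
   coefficient that, after passing to the big cell if necessary, depends only on the lower left
   entry; expanding it in powers of that entry, and the exponents in base p, writes the identity of
   M as a sum of maps through tensor products of Frobenius twists of the natural module V.
   By the pigeonhole principle a long product of this kind contains 2p - 1 equal twists, and
   the identity of the (2p - 1)-st tensor power of V factors through shorter products: through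
   copies of V tensored fewer times and through the Frobenius twist of V. Hence finitely many
   products suffice for all tensor powers, and the Krull-Schmidt property (in the form of
   factorisations of the identity through connected objects) descends the finiteness to the
   small field. *)
theory Submission
  imports Defs "Jordan_Normal_Form.Char_Poly" "HOL-Library.Function_Algebras" "HOL-Algebra.Algebraic_Closure_Type"
begin

hide_const (open) Divisibility.prime Polynomials.degree Polynomials.lead_coeff up_ring.monom up_ring.coeff

text \<open>The number 2p - 1 comes from the operator \<open>casimir\<close> on m tensor factors,
  the sum of 1 - s over all transpositions s. Besides 0, its eigenvalues on the m-th tensor power of
  V are among the k(m + 1 - k) with 1 \<le> k \<le> m/2, and m = 2p - 1 is the least m \<ge> p for
  which none of these vanishes modulo p. For this m the identity is a combination of an operator Q
  with symmetric values and of maps through m - 2 factors. Since m \<ge> p, the values of Q can be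
  compared with the Frobenius twist: the binomial coefficients of p between the two outer ones
  vanish modulo p. In the analysis of a simple module the obstacle is that sums over the nonzero
  elements of a field with q elements see exponents only modulo q - 1, so that the exponents 0 and q
  - 1 cannot be told apart. The choice of the vector serves to make one of these two coefficients
  vanish. The given field k may fail to contain the field with q elements. This is why scalars are
  extended; functionals from the extension to k that are linear over k bring fixed vectors and
  factorisations back.\<close>

type_synonym ('g, 'i, 'k) irep = "'i set \<times> ('g \<Rightarrow> 'i \<Rightarrow> 'i \<Rightarrow> 'k)"

section \<open>Index-set representations, intertwiners and the additive closure of a class\<close>

definition mm :: "'j set \<Rightarrow> ('i \<Rightarrow> 'j \<Rightarrow> 'k) \<Rightarrow> ('j \<Rightarrow> 'l \<Rightarrow> 'k) \<Rightarrow> 'i \<Rightarrow> 'l \<Rightarrow> 'k::field" where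
  "mm J f h = (\<lambda>i l. \<Sum>j\<in>J. f i j * h j l)"

definition idm :: "'i set \<Rightarrow> 'i \<Rightarrow> 'i \<Rightarrow> 'k::field" where
  "idm I = (\<lambda>i j. if i \<in> I \<and> i = j then 1 else 0)"

text \<open>Homomorphisms are total functions on the index types. Demanding zero outside the
  carriers turns equality of homomorphisms into equality of functions and makes \<open>idm\<close> a
  genuine unit for them.\<close>

definition supported :: "'i set \<Rightarrow> 'j set \<Rightarrow> ('i \<Rightarrow> 'j \<Rightarrow> 'k::field) \<Rightarrow> bool" where
  "supported I J f \<longleftrightarrow> (\<forall>i j. f i j \<noteq> 0 \<longrightarrow> i \<in> I \<and> j \<in> J)"

text \<open>The intertwining equation is tested only at carrier indices, since an action may take
  arbitrary values elsewhere, as matrix entries out of range do.\<close>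

definition ihom :: "'g set \<Rightarrow> ('g, 'i, 'k::field) irep \<Rightarrow> ('g, 'j, 'k) irep \<Rightarrow> ('j \<Rightarrow> 'i \<Rightarrow> 'k) \<Rightarrow> bool" where
  "ihom G A B f \<longleftrightarrow> supported (fst B) (fst A) f \<and>
     (\<forall>g\<in>G. \<forall>j\<in>fst B. \<forall>i\<in>fst A. mm (fst A) f (snd A g) j i = mm (fst B) (snd B g) f j i)"

text \<open>A finite sum of composites A -> B -> A amounts to one map through a finite direct sum of
  members of \<B>. In this encoding no direct sum is ever formed, and \<open>inadd\<close> expresses
  that A is a direct summand of such a sum.\<close>

inductive fac :: "'g set \<Rightarrow> ('g, 'i, 'k::field) irep \<Rightarrow> ('g, 'j, 'k) irep set \<Rightarrow> ('i \<Rightarrow> 'i \<Rightarrow> 'k) \<Rightarrow> bool"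
  for G A \<B> where
  fac_zero: "fac G A \<B> (\<lambda>i j. 0)"
| fac_step: "B \<in> \<B> \<Longrightarrow> ihom G B A f \<Longrightarrow> ihom G A B h \<Longrightarrow> fac G A \<B> \<phi> \<Longrightarrow>
     fac G A \<B> (\<lambda>i j. \<phi> i j + mm (fst B) f h i j)"

definition inadd :: "'g set \<Rightarrow> ('g, 'i, 'k::field) irep \<Rightarrow> ('g, 'j, 'k) irep set \<Rightarrow> bool" where
  "inadd G A \<B> \<longleftrightarrow> fac G A \<B> (idm (fst A))"

lemma mm_assoc: "mm J (mm I f g) h = mm I f (mm J g h)"
proof (intro ext)
  fix i l
  have "(\<Sum>j\<in>J. (\<Sum>k\<in>I. f i k * g k j) * h j l) = (\<Sum>j\<in>J. \<Sum>k\<in>I. f i k * (g k j * h j l))"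
    by (simp add: sum_distrib_right mult.assoc)
  also have "\<dots> = (\<Sum>k\<in>I. \<Sum>j\<in>J. f i k * (g k j * h j l))" by (rule sum.swap)
  finally show "mm J (mm I f g) h i l = mm I f (mm J g h) i l"
    by (simp add: mm_def sum_distrib_left)
qed

lemma mm_cong: "(\<And>j. j \<in> J \<Longrightarrow> f i j = f' i j) \<Longrightarrow> (\<And>j. j \<in> J \<Longrightarrow> h j l = h' j l) \<Longrightarrow> mm J f h i l = mm J f' h' i l"
  by (simp add: mm_def)

lemma supported_mm: "supported I J f \<Longrightarrow> supported J L h \<Longrightarrow> supported I L (mm J f h)"
proof (unfold supported_def mm_def, intro allI impI)
  fix i l assume s: "\<forall>i j. f i j \<noteq> 0 \<longrightarrow> i \<in> I \<and> j \<in> J" "\<forall>j l. h j l \<noteq> 0 \<longrightarrow> j \<in> J \<and> l \<in> L"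
    and "(\<Sum>j\<in>J. f i j * h j l) \<noteq> 0"
  then obtain j where "f i j * h j l \<noteq> 0" by (meson sum.neutral)
  then show "i \<in> I \<and> l \<in> L" using s by auto
qed

lemma supported_idm [simp]: "supported I I (idm I)"
  by (auto simp: supported_def idm_def)

lemma supported_outside: "supported I J f \<Longrightarrow> i \<notin> I \<or> j \<notin> J \<Longrightarrow> f i j = 0"
  by (auto simp: supported_def)

lemma supported_eqI:
  assumes "supported I J f" "supported I J h" "\<And>i j. i \<in> I \<Longrightarrow> j \<in> J \<Longrightarrow> f i j = h i j"
  shows "f = h"
proof (intro ext)
  fix i j show "f i j = h i j"
  proof (cases "i \<in> I \<and> j \<in> J")
    case False
    then show ?thesis using supported_outside[OF assms(1)] supported_outside[OF assms(2)] by simp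
  qed (simp add: assms(3))
qed

lemma mm_idm_left: "finite I \<Longrightarrow> supported I J f \<Longrightarrow> mm I (idm I) f = f"
proof (intro ext)
  fix i j assume "finite I" "supported I J f"
  have "mm I (idm I) f i j = (\<Sum>k\<in>I. if k = i then f i j else 0)"
    unfolding mm_def idm_def by (intro sum.cong) auto
  then show "mm I (idm I) f i j = f i j"
    using \<open>finite I\<close> \<open>supported I J f\<close> by (auto simp: supported_def)
qed

lemma mm_idm_right: "finite J \<Longrightarrow> supported I J f \<Longrightarrow> mm J f (idm J) = f"
proof (intro ext)
  fix i j assume "finite J" "supported I J f"
  have "mm J f (idm J) i j = (\<Sum>k\<in>J. if k = j then f i j else 0)"
    unfolding mm_def idm_def by (intro sum.cong) auto
  then show "mm J f (idm J) i j = f i j"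
    using \<open>finite J\<close> \<open>supported I J f\<close> by (auto simp: supported_def)
qed

lemma mm_zero_left [simp]: "mm I (\<lambda>i j. 0) f = (\<lambda>i j. 0)"
  by (simp add: mm_def)

lemma mm_zero_right [simp]: "mm I f (\<lambda>i j. 0) = (\<lambda>i j. 0)"
  by (simp add: mm_def)

lemma mm_add_left: "mm I (\<lambda>i j. f i j + f' i j) h = (\<lambda>i j. mm I f h i j + mm I f' h i j)"
  by (simp add: mm_def algebra_simps sum.distrib)

lemma mm_add_right: "mm I h (\<lambda>i j. f i j + f' i j) = (\<lambda>i j. mm I h f i j + mm I h f' i j)"
  by (simp add: mm_def algebra_simps sum.distrib)

lemma mm_scale_left: "mm I (\<lambda>i j. c * f i j) h = (\<lambda>i j. c * mm I f h i j)"
  by (simp add: mm_def algebra_simps sum_distrib_left)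

lemma mm_scale_right: "mm I h (\<lambda>i j. c * f i j) = (\<lambda>i j. c * mm I h f i j)"
  by (simp add: mm_def algebra_simps sum_distrib_left)

lemma mm_sum_left: "mm I (\<lambda>i j. \<Sum>x\<in>W. F x i j) h = (\<lambda>i j. \<Sum>x\<in>W. mm I (F x) h i j)"
  unfolding mm_def sum_distrib_right by (subst sum.swap) simp

lemma mm_sum_right: "mm I h (\<lambda>i j. \<Sum>x\<in>W. F x i j) = (\<lambda>i j. \<Sum>x\<in>W. mm I h (F x) i j)"
  unfolding mm_def sum_distrib_left by (subst sum.swap) simp

lemma ihomD: "ihom G A B f \<Longrightarrow> g \<in> G \<Longrightarrow> j \<in> fst B \<Longrightarrow> i \<in> fst A \<Longrightarrow>
    mm (fst A) f (snd A g) j i = mm (fst B) (snd B g) f j i"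
  by (simp add: ihom_def)

lemma ihom_supported: "ihom G A B f \<Longrightarrow> supported (fst B) (fst A) f"
  by (simp add: ihom_def)

lemma ihom_comp:
  assumes "ihom G A B f" "ihom G B C h"
  shows "ihom G A C (mm (fst B) h f)"
  unfolding ihom_def
proof (intro conjI ballI)
  show "supported (fst C) (fst A) (mm (fst B) h f)"
    using assms by (auto intro: supported_mm ihom_supported)
  fix g j i assume g: "g \<in> G" and j: "j \<in> fst C" and i: "i \<in> fst A"
  have "mm (fst A) (mm (fst B) h f) (snd A g) j i = mm (fst B) h (mm (fst A) f (snd A g)) j i"
    by (simp add: mm_assoc)
  also have "\<dots> = mm (fst B) h (mm (fst B) (snd B g) f) j i"
    using ihomD[OF assms(1) g _ i] by (intro mm_cong) auto
  also have "\<dots> = mm (fst B) (mm (fst B) h (snd B g)) f j i" by (simp add: mm_assoc)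
  also have "\<dots> = mm (fst B) (mm (fst C) (snd C g) h) f j i"
    using ihomD[OF assms(2) g j] by (intro mm_cong) auto
  finally show "mm (fst A) (mm (fst B) h f) (snd A g) j i = mm (fst C) (snd C g) (mm (fst B) h f) j i"
    by (simp add: mm_assoc)
qed

lemma ihom_zero [simp]: "ihom G A B (\<lambda>i j. 0)"
  by (simp add: ihom_def supported_def)

lemma supported_add: "supported I J f \<Longrightarrow> supported I J h \<Longrightarrow> supported I J (\<lambda>i j. f i j + h i j)"
  by (auto simp: supported_def) (metis add_0)+

lemma ihom_add: "ihom G A B f \<Longrightarrow> ihom G A B h \<Longrightarrow> ihom G A B (\<lambda>i j. f i j + h i j)"
  by (simp add: ihom_def mm_add_left mm_add_right supported_add)

lemma ihom_scale: "ihom G A B f \<Longrightarrow> ihom G A B (\<lambda>i j. c * f i j)"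
  by (auto simp: ihom_def mm_scale_left mm_scale_right supported_def)

lemma ihom_sum: "(\<And>x. x \<in> W \<Longrightarrow> ihom G A B (F x)) \<Longrightarrow> ihom G A B (\<lambda>i j. \<Sum>x\<in>W. F x i j)"
  by (induction W rule: infinite_finite_induct) (auto intro: ihom_add)

lemma ihom_idm: 
  assumes "finite (fst A)" shows "ihom G A A (idm (fst A))"
  unfolding ihom_def
proof (intro conjI ballI)
  fix g j i assume "j \<in> fst A" "i \<in> fst A"
  have "mm (fst A) (idm (fst A)) (snd A g) j i = snd A g j i"
    using assms \<open>j \<in> fst A\<close> by (simp add: mm_def idm_def if_distrib[of "\<lambda>x. x * _"] cong: if_cong)
  moreover have "mm (fst A) (snd A g) (idm (fst A)) j i = (\<Sum>k\<in>fst A. if k = i then snd A g j k else 0)"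
    unfolding mm_def idm_def by (intro sum.cong) auto
  ultimately show "mm (fst A) (idm (fst A)) (snd A g) j i = mm (fst A) (snd A g) (idm (fst A)) j i"
    using assms \<open>i \<in> fst A\<close> by simp
qed simp

lemma fac_ihom: "fac G A \<B> \<phi> \<Longrightarrow> ihom G A A \<phi>"
  by (induction rule: fac.induct) (auto intro: ihom_add ihom_comp)

lemma fac_one: "B \<in> \<B> \<Longrightarrow> ihom G B A f \<Longrightarrow> ihom G A B h \<Longrightarrow> fac G A \<B> (mm (fst B) f h)"
  using fac_step[OF _ _ _ fac_zero, of B \<B> G A f h] by simp

lemma fac_add: "fac G A \<B> \<psi> \<Longrightarrow> fac G A \<B> \<phi> \<Longrightarrow> fac G A \<B> (\<lambda>i j. \<phi> i j + \<psi> i j)"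
proof (induction rule: fac.induct)
  case (fac_step B f h \<psi>)
  from fac.fac_step[OF fac_step(1-3) fac_step(5)[OF fac_step(6)]]
  show ?case by (simp add: add.assoc)
qed simp

lemma fac_sum: "(\<And>x. x \<in> W \<Longrightarrow> fac G A \<B> (F x)) \<Longrightarrow> fac G A \<B> (\<lambda>i j. \<Sum>x\<in>W. F x i j)"
  by (induction W rule: infinite_finite_induct) (auto intro: fac_zero fac_add)

text \<open>The maps through \<B> form an ideal that also absorbs maps to and from another object: f
  and h are merged into the outer factors of each composite.\<close>

lemma fac_sandwich:
  assumes "fac G A \<B> \<phi>" and f: "ihom G A A' f" and h: "ihom G A' A h"
  shows "fac G A' \<B> (mm (fst A) f (mm (fst A) \<phi> h))"
  using assms(1)
proof (induction rule: fac.induct)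
  case (fac_step B u v \<phi>)
  have "fac G A' \<B> (mm (fst B) (mm (fst A) f u) (mm (fst A) v h))"
    using fac_step f h by (intro fac_one ihom_comp)
  from fac_add[OF this fac_step(5)] show ?case
    by (simp add: mm_add_left mm_add_right mm_assoc)
qed (simp add: fac_zero)

lemma fac_mono: "fac G A \<B> \<phi> \<Longrightarrow> \<B> \<subseteq> \<C> \<Longrightarrow> fac G A \<C> \<phi>"
  by (induction rule: fac.induct) (auto intro: fac_zero fac_step)

lemma inadd_mono: "inadd G A \<B> \<Longrightarrow> \<B> \<subseteq> \<C> \<Longrightarrow> inadd G A \<C>"
  by (auto simp: inadd_def intro: fac_mono)

text \<open>Each composite through B passes through the identity of B, which in turn is a sum of
  composites through \<C>.\<close>

lemma fac_trans:
  assumes "fac G A \<B> \<phi>" "\<And>B. B \<in> \<B> \<Longrightarrow> inadd G B \<C> \<and> finite (fst B)"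
  shows "fac G A \<C> \<phi>"
  using assms(1)
proof (induction rule: fac.induct)
  case (fac_step B f h \<phi>)
  have "fac G A \<C> (mm (fst B) f (mm (fst B) (idm (fst B)) h))"
    using fac_step assms(2) by (intro fac_sandwich) (auto simp: inadd_def)
  moreover have "mm (fst B) (idm (fst B)) h = h"
    using fac_step assms(2) by (intro mm_idm_left) (auto dest: ihom_supported)
  ultimately show ?case using fac_step by (auto intro: fac_add)
qed (rule fac_zero)

lemma inadd_trans:
  "inadd G A \<B> \<Longrightarrow> (\<And>B. B \<in> \<B> \<Longrightarrow> inadd G B \<C> \<and> finite (fst B)) \<Longrightarrow> inadd G A \<C>"
  unfolding inadd_def by (rule fac_trans) (auto simp: inadd_def)

lemma inadd_retract:
  assumes "B \<in> \<B>" "ihom G B A f" "ihom G A B h" "mm (fst B) f h = idm (fst A)"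
  shows "inadd G A \<B>"
  using fac_one[OF assms(1-3)] assms(4) by (simp add: inadd_def)

lemma inadd_refl: "finite (fst A) \<Longrightarrow> A \<in> \<B> \<Longrightarrow> inadd G A \<B>"
  by (rule inadd_retract[where f = "idm (fst A)" and h = "idm (fst A)"])
     (auto intro: ihom_idm simp: mm_idm_left[OF _ supported_idm])

lemma inadd_empty: "fst A = {} \<Longrightarrow> inadd G A \<B>"
  using fac_zero[of G A \<B>] by (simp add: inadd_def idm_def)

text \<open>A bijection of bases that matches the matrix entries gives two permutation matrices, and
  their composite is the identity. Changes of index type, such as numbering a basis or merging
  tensor factors, go through this lemma.\<close>

lemma inadd_reindex:
  fixes A :: "('g, 'i, 'k::field) irep" and B :: "('g, 'j, 'k) irep"
  assumes bij: "bij_betw \<pi> (fst A) (fst B)" and fin: "finite (fst A)" and "B \<in> \<B>"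
    and eq: "\<And>g i i'. g \<in> G \<Longrightarrow> i \<in> fst A \<Longrightarrow> i' \<in> fst A \<Longrightarrow> snd A g i i' = snd B g (\<pi> i) (\<pi> i')"
  shows "inadd G A \<B>"
proof -
  let ?f = "\<lambda>i j. if i \<in> fst A \<and> j = \<pi> i then 1 else 0 :: 'k"
  let ?h = "\<lambda>j i. if i \<in> fst A \<and> j = \<pi> i then 1 else 0 :: 'k"
  have finB: "finite (fst B)" using bij fin bij_betw_finite by blast
  have inj: "inj_on \<pi> (fst A)" and im: "\<pi> ` fst A = fst B" using bij by (auto simp: bij_betw_def)
  have f1: "(\<Sum>j\<in>fst B. ?f i j * W j) = W (\<pi> i)" if "i \<in> fst A" for i W
  proof -
    have "(\<Sum>j\<in>fst B. ?f i j * W j) = (\<Sum>j\<in>fst B. if j = \<pi> i then W j else 0)"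
      using that by (intro sum.cong) auto
    then show ?thesis using that finB im by auto
  qed
  have f2: "(\<Sum>i\<in>fst A. W i * ?f i (\<pi> k)) = W k" if "k \<in> fst A" for k W
  proof -
    have "(\<Sum>i\<in>fst A. W i * ?f i (\<pi> k)) = (\<Sum>i\<in>fst A. if i = k then W i else 0)"
      using that inj by (intro sum.cong) (auto simp: inj_on_def)
    then show ?thesis using that fin by auto
  qed
  have h1: "(\<Sum>j\<in>fst B. W j * ?h j i) = W (\<pi> i)" if "i \<in> fst A" for i W
    using f1[OF that, of W] by (simp add: mult.commute)
  have h2: "(\<Sum>i\<in>fst A. ?h (\<pi> k) i * W i) = W k" if "k \<in> fst A" for k W
    using f2[OF that, of W] by (simp add: mult.commute)
  show ?thesis
  proof (rule inadd_retract[OF \<open>B \<in> \<B>\<close>])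
    show "ihom G B A ?f" unfolding ihom_def mm_def
    proof (intro conjI ballI)
      show "supported (fst A) (fst B) ?f" using im by (auto simp: supported_def)
      fix g i j assume g: "g \<in> G" and i: "i \<in> fst A" and "j \<in> fst B"
      then obtain k where k: "k \<in> fst A" "j = \<pi> k" using im by auto
      show "(\<Sum>ja\<in>fst B. ?f i ja * snd B g ja j) = (\<Sum>ja\<in>fst A. snd A g i ja * ?f ja j)"
        unfolding f1[OF i] k(2) f2[OF k(1)] using eq g i k by simp
    qed
    show "ihom G A B ?h" unfolding ihom_def mm_def
    proof (intro conjI ballI)
      show "supported (fst B) (fst A) ?h" using im by (auto simp: supported_def)
      fix g i j assume g: "g \<in> G" and i: "i \<in> fst A" and "j \<in> fst B"
      then obtain k where k: "k \<in> fst A" "j = \<pi> k" using im by auto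
      show "(\<Sum>ja\<in>fst A. ?h j ja * snd A g ja i) = (\<Sum>ja\<in>fst B. snd B g j ja * ?h ja i)"
        unfolding h1[OF i] k(2) h2[OF k(1)] using eq g i k by simp
    qed
    show "mm (fst B) ?f ?h = idm (fst A)"
    proof (intro ext)
      fix i k show "mm (fst B) ?f ?h i k = idm (fst A) i k"
      proof (cases "i \<in> fst A")
        case True
        then show ?thesis unfolding mm_def f1[OF True] idm_def using inj by (auto simp: inj_on_def)
      qed (simp add: mm_def idm_def)
    qed
  qed
qed

section \<open>Tensor products\<close>

definition tens :: "('g, 'i, 'k::field) irep \<Rightarrow> ('g, 'j, 'k) irep \<Rightarrow> ('g, 'i \<times> 'j, 'k) irep" where
  "tens A C = (fst A \<times> fst C, \<lambda>g x y. snd A g (fst x) (fst y) * snd C g (snd x) (snd y))"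

lemma fst_tens [simp]: "fst (tens A C) = fst A \<times> fst C" by (simp add: tens_def)

text \<open>The Kronecker product of f with the identity of C, that is, the functor - \<otimes> C on
  morphisms.\<close>

definition kid :: "'c set \<Rightarrow> ('i \<Rightarrow> 'j \<Rightarrow> 'k::field) \<Rightarrow> ('i \<times> 'c) \<Rightarrow> ('j \<times> 'c) \<Rightarrow> 'k" where
  "kid C f = (\<lambda>x y. f (fst x) (fst y) * idm C (snd x) (snd y))"

lemma mm_kid:
  assumes "finite C" shows "mm (J \<times> C) (kid C f) (kid C h) = kid C (mm J f h)"
proof (intro ext)
  fix x y
  have "mm (J \<times> C) (kid C f) (kid C h) x y
    = (\<Sum>j\<in>J. \<Sum>c\<in>C. f (fst x) j * h j (fst y) * (idm C (snd x) c * idm C c (snd y)))"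
    by (simp add: mm_def kid_def sum.cartesian_product case_prod_unfold mult_ac)
  also have "\<dots> = mm J f h (fst x) (fst y) * mm C (idm C) (idm C) (snd x) (snd y)"
    unfolding mm_def sum_product ..
  finally show "mm (J \<times> C) (kid C f) (kid C h) x y = kid C (mm J f h) x y"
    by (simp add: kid_def mm_idm_left[OF assms supported_idm])
qed

lemma ihom_kid:
  assumes fin: "finite (fst C)" and f: "ihom G A B f"
  shows "ihom G (tens A C) (tens B C) (kid (fst C) f)"
  unfolding ihom_def
proof (intro conjI ballI)
  show "supported (fst (tens B C)) (fst (tens A C)) (kid (fst C) f)"
    using ihom_supported[OF f] by (auto simp: supported_def kid_def idm_def)
  fix g x y assume g: "g \<in> G" and x: "x \<in> fst (tens B C)" and y: "y \<in> fst (tens A C)"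
  have "mm (fst (tens A C)) (kid (fst C) f) (snd (tens A C) g) x y
     = (\<Sum>i\<in>fst A. \<Sum>c\<in>fst C. f (fst x) i * snd A g i (fst y) * (idm (fst C) (snd x) c * snd C g c (snd y)))"
    by (simp add: mm_def kid_def tens_def sum.cartesian_product case_prod_unfold mult_ac)
  also have "\<dots> = mm (fst A) f (snd A g) (fst x) (fst y) * mm (fst C) (idm (fst C)) (snd C g) (snd x) (snd y)"
    unfolding mm_def sum_product ..
  also have "\<dots> = mm (fst B) (snd B g) f (fst x) (fst y) * mm (fst C) (snd C g) (idm (fst C)) (snd x) (snd y)"
    using ihomD[OF f g] ihomD[OF ihom_idm[OF fin] g] x y by auto
  also have "\<dots> = (\<Sum>i\<in>fst B. \<Sum>c\<in>fst C. snd B g (fst x) i * f i (fst y) * (snd C g (snd x) c * idm (fst C) c (snd y)))"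
    unfolding mm_def sum_product ..
  also have "\<dots> = mm (fst (tens B C)) (snd (tens B C) g) (kid (fst C) f) x y"
    by (simp add: mm_def kid_def tens_def sum.cartesian_product case_prod_unfold mult_ac)
  finally show "mm (fst (tens A C)) (kid (fst C) f) (snd (tens A C) g) x y
     = mm (fst (tens B C)) (snd (tens B C) g) (kid (fst C) f) x y" .
qed

lemma fac_tens:
  assumes "finite (fst C)" "fac G A \<B> \<phi>"
  shows "fac G (tens A C) ((\<lambda>B. tens B C) ` \<B>) (kid (fst C) \<phi>)"
  using assms(2)
proof (induction rule: fac.induct)
  case fac_zero
  show ?case using fac.fac_zero by (simp add: kid_def)
next
  case (fac_step B f h \<phi>)
  have "fac G (tens A C) ((\<lambda>B. tens B C) ` \<B>) (mm (fst (tens B C)) (kid (fst C) f) (kid (fst C) h))"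
    using fac_step by (intro fac_one ihom_kid assms) auto
  from fac_add[OF this fac_step(5)] show ?case
    using assms(1) by (simp add: mm_kid) (simp add: kid_def algebra_simps)
qed

lemma kid_idm: "kid C (idm A) = idm (A \<times> C)"
  by (auto simp: kid_def idm_def fun_eq_iff)

lemma inadd_tens_left:
  assumes "finite (fst C)" "inadd G A \<B>"
  shows "inadd G (tens A C) ((\<lambda>B. tens B C) ` \<B>)"
  using fac_tens[OF assms(1) assms(2)[unfolded inadd_def]] by (simp add: inadd_def kid_idm)

lemma inadd_tens_swap:
  assumes "finite (fst A)" "finite (fst C)"
  shows "inadd G (tens A C) {tens C A}"
  by (rule inadd_reindex[where \<pi> = prod.swap and B = "tens C A"])
     (use assms in \<open>auto simp: bij_betw_def tens_def inj_on_def\<close>)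

lemma inadd_tens_right:
  assumes "finite (fst C)" "finite (fst A)" "inadd G A \<B>" "\<And>B. B \<in> \<B> \<Longrightarrow> finite (fst B)"
  shows "inadd G (tens C A) ((\<lambda>B. tens C B) ` \<B>)"
proof (rule inadd_trans[OF inadd_tens_swap[OF assms(1,2)]])
  fix B assume "B \<in> {tens A C}"
  moreover have "inadd G (tens A C) ((\<lambda>B. tens C B) ` \<B>)"
  proof (rule inadd_trans[OF inadd_tens_left[OF assms(1,3)]])
    fix D assume "D \<in> (\<lambda>B. tens B C) ` \<B>"
    then obtain B where B: "B \<in> \<B>" "D = tens B C" by auto
    then show "inadd G D ((\<lambda>B. tens C B) ` \<B>) \<and> finite (fst D)"
      using assms(1,4) inadd_mono[OF inadd_tens_swap[of B C G]] by auto
  qed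
  ultimately show "inadd G B ((\<lambda>B. tens C B) ` \<B>) \<and> finite (fst B)" using assms by auto
qed

lemma inadd_tens:
  assumes "inadd G A \<B>" "inadd G C \<D>" "finite (fst A)" "finite (fst C)"
    "\<And>B. B \<in> \<B> \<Longrightarrow> finite (fst B)" "\<And>D. D \<in> \<D> \<Longrightarrow> finite (fst D)"
  shows "inadd G (tens A C) {tens B D | B D. B \<in> \<B> \<and> D \<in> \<D>}"
proof (rule inadd_trans[OF inadd_tens_left[OF assms(4,1)]])
  fix W assume "W \<in> (\<lambda>B. tens B C) ` \<B>"
  then obtain B where B: "B \<in> \<B>" "W = tens B C" by auto
  have "inadd G (tens B C) ((\<lambda>D. tens B D) ` \<D>)"
    using assms B by (intro inadd_tens_right) auto
  then have "inadd G (tens B C) {tens B D | B D. B \<in> \<B> \<and> D \<in> \<D>}"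
    by (rule inadd_mono) (use B in blast)
  then show "inadd G W {tens B D | B D. B \<in> \<B> \<and> D \<in> \<D>} \<and> finite (fst W)"
    unfolding B(2) using assms(4,5) B(1) by simp
qed

definition base_change :: "('k \<Rightarrow> 'l) \<Rightarrow> ('g, 'i, 'k::field) irep \<Rightarrow> ('g, 'i, 'l::field) irep" where
  "base_change \<iota> A = (fst A, \<lambda>g i j. \<iota> (snd A g i j))"

lemma fst_base_change [simp]: "fst (base_change \<iota> A) = fst A"
  by (simp add: base_change_def)

lemma snd_base_change [simp]: "snd (base_change \<iota> A) g i j = \<iota> (snd A g i j)"
  by (simp add: base_change_def)

section \<open>Linear dependence and ranks\<close>

interpretation fvs: Vector_Spaces.vector_space "\<lambda>(c::'k::field) (f::'i \<Rightarrow> 'k) i. c * f i"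
  by unfold_locales (auto simp: fun_eq_iff algebra_simps)

lemma fvs_sum_apply: "(sum F S :: 'i \<Rightarrow> 'k::field) i = (\<Sum>x\<in>S. F x i)"
  by (induction S rule: infinite_finite_induct) auto

lemma supported_in_span:
  fixes v :: "'j \<Rightarrow> 'k::field"
  assumes "finite J" "\<And>j. j \<notin> J \<Longrightarrow> v j = 0"
  shows "v \<in> fvs.span ((\<lambda>j i. if i = j then 1 else 0) ` J)"
proof -
  let ?u = "\<lambda>j i. if i = j then 1 else (0::'k)"
  have "v = (\<Sum>j\<in>J. (\<lambda>i. v j * ?u j i))"
  proof
    fix i
    have "(\<Sum>j\<in>J. v j * ?u j i) = (\<Sum>j\<in>J. if j = i then v i else 0)" by (intro sum.cong) auto
    then show "v i = (\<Sum>j\<in>J. (\<lambda>i. v j * ?u j i)) i"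
      using assms by (auto simp: fvs_sum_apply)
  qed
  also have "\<dots> \<in> fvs.span (?u ` J)"
    by (intro fvs.span_sum fvs.span_scale fvs.span_base) auto
  finally show ?thesis .
qed

text \<open>The span of the unit vectors at J bounds the size of independent sets. Dependence is a
  notion for sets of vectors, so a family with a repeated vector is treated apart: there the
  relation is the difference of two members.\<close>

lemma linear_dependence:
  fixes v :: "'i \<Rightarrow> 'j \<Rightarrow> 'k::field"
  assumes "finite I" "finite J" "card J < card I" "\<And>i j. i \<in> I \<Longrightarrow> j \<notin> J \<Longrightarrow> v i j = 0"
  shows "\<exists>c. (\<exists>i\<in>I. c i \<noteq> 0) \<and> (\<forall>j. (\<Sum>i\<in>I. c i * v i j) = 0)"
proof (cases "inj_on v I")
  case False
  then obtain a b where ab: "a \<in> I" "b \<in> I" "a \<noteq> b" "v a = v b" by (auto simp: inj_on_def)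
  let ?c = "\<lambda>i. if i = a then 1 else if i = b then -1 else (0::'k)"
  have "(\<Sum>i\<in>I. ?c i * v i j) = 0" for j
  proof -
    have "(\<Sum>i\<in>I. ?c i * v i j) = (\<Sum>i\<in>{a,b}. ?c i * v i j)"
      using ab assms(1) by (intro sum.mono_neutral_right) auto
    then show ?thesis using ab by simp
  qed
  then show ?thesis using ab(1) by (intro exI[of _ ?c]) auto
next
  case True
  let ?u = "\<lambda>j i. if i = j then 1 else (0::'k)"
  have "v ` I \<subseteq> fvs.span (?u ` J)" using assms by (auto intro!: supported_in_span)
  moreover have "card (v ` I) > card (?u ` J)"
    using card_image[OF True] card_image_le[OF assms(2), of ?u] assms(3) by simp
  ultimately have "fvs.dependent (v ` I)"
    using fvs.independent_span_bound[OF finite_imageI[OF assms(2)], of "v ` I" ?u] by (meson not_le)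
  then obtain t u where t: "finite t" "t \<subseteq> v ` I" "(\<Sum>w\<in>t. (\<lambda>i. u w * w i)) = 0" "\<exists>w\<in>t. u w \<noteq> 0"
    unfolding fvs.dependent_explicit by blast
  define c where "c = (\<lambda>i. if v i \<in> t then u (v i) else 0)"
  have "(\<Sum>i\<in>I. c i * v i j) = 0" for j
  proof -
    have "(\<Sum>i\<in>I. c i * v i j) = (\<Sum>w\<in>v ` I. (if w \<in> t then u w else 0) * w j)"
      unfolding c_def by (subst sum.reindex[OF True]) simp
    also have "\<dots> = (\<Sum>w\<in>t. u w * w j)"
      using t(2) assms(1) by (intro sum.mono_neutral_cong_right) auto
    also have "\<dots> = (\<Sum>w\<in>t. (\<lambda>i. u w * w i)) j" by (simp add: fvs_sum_apply)
    finally show ?thesis using t(3) by simp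
  qed
  moreover have "\<exists>i\<in>I. c i \<noteq> 0" using t(2,4) by (auto simp: c_def)
  ultimately show ?thesis by (intro exI[of _ c] conjI allI)
qed

text \<open>If |I| > |J|, the rows of f satisfy a nontrivial relation c f = 0, and then c = c (f h)
  = 0. This is the rank count that makes dimensions of isomorphic objects agree.\<close>

lemma card_le_of_left_inverse:
  fixes f :: "'i \<Rightarrow> 'j \<Rightarrow> 'k::field"
  assumes "finite I" "finite J" "supported I J f" "mm J f h = idm I"
  shows "card I \<le> card J"
proof (rule ccontr)
  assume "\<not> card I \<le> card J"
  then obtain c where c: "\<exists>i\<in>I. c i \<noteq> 0" "\<And>j. (\<Sum>i\<in>I. c i * f i j) = 0"
    using linear_dependence[OF assms(1,2), of f] supported_outside[OF assms(3)] by (metis not_le)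
  then obtain k where k: "k \<in> I" "c k \<noteq> 0" by auto
  have "(\<Sum>i\<in>I. c i * idm I i k) = (\<Sum>i\<in>I. if i = k then c k else 0)"
    by (intro sum.cong) (auto simp: idm_def)
  then have "c k = (\<Sum>i\<in>I. c i * mm J f h i k)"
    using k assms(1,4) by simp
  also have "\<dots> = (\<Sum>i\<in>I. \<Sum>j\<in>J. c i * f i j * h j k)"
    by (simp add: mm_def sum_distrib_left mult.assoc)
  also have "\<dots> = (\<Sum>j\<in>J. (\<Sum>i\<in>I. c i * f i j) * h j k)"
    by (subst sum.swap) (simp add: sum_distrib_right)
  finally show False using c(2) k(2) by simp
qed

section \<open>Fitting's lemma and the Krull-Schmidt property\<close>

fun mpow :: "'i set \<Rightarrow> ('i \<Rightarrow> 'i \<Rightarrow> 'k::field) \<Rightarrow> nat \<Rightarrow> 'i \<Rightarrow> 'i \<Rightarrow> 'k" where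
  "mpow I \<phi> 0 = idm I"
| "mpow I \<phi> (Suc n) = mm I \<phi> (mpow I \<phi> n)"

lemma supported_mpow [simp]: "supported I I \<phi> \<Longrightarrow> supported I I (mpow I \<phi> n)"
  by (induction n) (auto intro: supported_mm)

lemma mpow_add:
  assumes "finite I" "supported I I \<phi>"
  shows "mpow I \<phi> (m + n) = mm I (mpow I \<phi> m) (mpow I \<phi> n)"
  by (induction m) (use assms in \<open>auto simp: mm_assoc mm_idm_left[OF _ supported_mpow]\<close>)

lemma ihom_mpow:
  assumes "finite (fst A)" "ihom G A A \<phi>"
  shows "ihom G A A (mpow (fst A) \<phi> n)"
proof (induction n)
  case (Suc n)
  show ?case using ihom_comp[OF Suc assms(2)] by simp
qed (simp add: ihom_idm assms)

lemma mpow_commute: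
  assumes "finite I" "supported I I \<phi>" "mm I \<phi> \<psi> = mm I \<psi> \<phi>" "supported I I \<psi>"
  shows "mm I (mpow I \<phi> n) \<psi> = mm I \<psi> (mpow I \<phi> n)"
proof (induction n)
  case (Suc n)
  have "mm I (mm I \<phi> (mpow I \<phi> n)) \<psi> = mm I (mm I \<phi> \<psi>) (mpow I \<phi> n)"
    by (simp add: mm_assoc Suc)
  then show ?case by (simp add: assms(3)) (simp add: mm_assoc)
qed (use assms in \<open>simp add: mm_idm_left mm_idm_right\<close>)

text \<open>The powers of \<phi> lie in a space of dimension |I|^2, so they are dependent. Solving a
  relation for its lowest term writes \<phi>^r as \<phi>^(r+1) times a polynomial in \<phi>.\<close>

lemma power_relation:
  fixes \<phi> :: "'i \<Rightarrow> 'i \<Rightarrow> 'k::field"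
  assumes fin: "finite I" and sup: "supported I I \<phi>"
  shows "\<exists>r N c. mpow I \<phi> r = mm I (mpow I \<phi> (Suc r)) (\<lambda>i j. \<Sum>n\<le>N. c n * mpow I \<phi> n i j)"
proof -
  define N where "N = card (I \<times> I)"
  have "\<exists>c. (\<exists>i\<in>{..N}. c i \<noteq> 0) \<and> (\<forall>j. (\<Sum>i\<le>N. c i * mpow I \<phi> i (fst j) (snd j)) = 0)"
    by (rule linear_dependence[of _ "I \<times> I"])
       (use fin supported_mpow[OF sup] in \<open>auto simp: N_def supported_def\<close>)
  then obtain c where c: "\<exists>n\<le>N. c n \<noteq> 0" "\<And>i j. (\<Sum>n\<le>N. c n * mpow I \<phi> n i j) = 0" by auto
  define r where "r = (LEAST n. c n \<noteq> 0)"
  obtain m where m: "m \<le> N" "c m \<noteq> 0" using c(1) by blast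
  have r: "c r \<noteq> 0" unfolding r_def using m(2) by (rule LeastI)
  have rN: "r \<le> N" unfolding r_def using Least_le[of "\<lambda>n. c n \<noteq> 0", OF m(2)] m(1) by linarith
  have lt: "c n = 0" if "n < r" for n
    using not_less_Least[of n "\<lambda>n. c n \<noteq> 0"] that unfolding r_def by blast
  let ?c = "\<lambda>k. if Suc (r + k) \<le> N then - c (Suc (r + k)) / c r else 0"
  have "mpow I \<phi> r = mm I (mpow I \<phi> (Suc r)) (\<lambda>i j. \<Sum>k\<le>N. ?c k * mpow I \<phi> k i j)"
  proof (intro ext)
    fix i j
    have "mm I (mpow I \<phi> (Suc r)) (\<lambda>i j. \<Sum>k\<le>N. ?c k * mpow I \<phi> k i j) i j
       = (\<Sum>k\<le>N. ?c k * mpow I \<phi> (Suc (r + k)) i j)"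
      unfolding mm_sum_right mm_scale_right using mpow_add[OF fin sup, of "Suc r"] by simp
    also have "\<dots> = (\<Sum>k\<in>{k. k \<le> N \<and> Suc (r + k) \<le> N}. - c (Suc (r + k)) / c r * mpow I \<phi> (Suc (r + k)) i j)"
      by (intro sum.mono_neutral_cong_right) auto
    also have "\<dots> = (\<Sum>n\<in>{Suc r..N}. - c n / c r * mpow I \<phi> n i j)"
      by (rule sum.reindex_bij_witness[of _ "\<lambda>n. n - Suc r" "\<lambda>k. Suc (r + k)"]) auto
    also have "\<dots> = - (\<Sum>n\<in>{Suc r..N}. c n * mpow I \<phi> n i j) / c r"
      by (simp add: sum_divide_distrib sum_negf)
    also have "(\<Sum>n\<in>{Suc r..N}. c n * mpow I \<phi> n i j) = - (c r * mpow I \<phi> r i j)"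
    proof -
      have "(\<Sum>n\<le>N. c n * mpow I \<phi> n i j) = (\<Sum>n\<in>{r..N}. c n * mpow I \<phi> n i j)"
        using lt by (intro sum.mono_neutral_right) auto
      also have "\<dots> = c r * mpow I \<phi> r i j + (\<Sum>n\<in>{Suc r..N}. c n * mpow I \<phi> n i j)"
        using rN by (rule sum.atLeast_Suc_atMost)
      finally show ?thesis using c(2)[of i j] by (simp add: eq_neg_iff_add_eq_0 add.commute)
    qed
    finally show "mpow I \<phi> r i j = mm I (mpow I \<phi> (Suc r)) (\<lambda>i j. \<Sum>k\<le>N. ?c k * mpow I \<phi> k i j) i j"
      using r by simp
  qed
  then show ?thesis by (intro exI)
qed

text \<open>Indecomposability expressed by idempotents, which makes sense for every index type and
  fits the factorisations of \<open>fac\<close> better than block decompositions do.\<close>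

definition conn :: "'g set \<Rightarrow> ('g, 'i, 'k::field) irep \<Rightarrow> bool" where
  "conn G A \<longleftrightarrow> finite (fst A) \<and> fst A \<noteq> {} \<and>
     (\<forall>e. ihom G A A e \<and> mm (fst A) e e = e \<longrightarrow> e = (\<lambda>i j. 0) \<or> e = idm (fst A))"

lemma idm_nonzero: "I \<noteq> {} \<Longrightarrow> idm I \<noteq> (\<lambda>i j. 0)"
  by (auto simp: idm_def fun_eq_iff)

text \<open>Fitting's lemma. From \<phi>^r = \<phi>^(r+1) y with y a polynomial in \<phi>, the
  endomorphism e = \<phi>^r y^r is idempotent and \<phi>^r e = \<phi>^r. Hence e = 0 makes \<phi>
  nilpotent, and e = 1 gives \<phi> a right inverse.\<close>

lemma conn_local:
  assumes A: "conn G A" and \<phi>: "ihom G A A \<phi>"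
  shows "(\<exists>\<psi>. ihom G A A \<psi> \<and> mm (fst A) \<phi> \<psi> = idm (fst A)) \<or> (\<exists>r. mpow (fst A) \<phi> r = (\<lambda>i j. 0))"
proof -
  let ?I = "fst A"
  have fin: "finite ?I" using A by (simp add: conn_def)
  have s: "supported ?I ?I \<phi>" using \<phi> by (rule ihom_supported)
  obtain r N c where "mpow ?I \<phi> r = mm ?I (mpow ?I \<phi> (Suc r)) (\<lambda>i j. \<Sum>n\<le>N. c n * mpow ?I \<phi> n i j)"
    using power_relation[OF fin s] by blast
  define y where "y = (\<lambda>i j. \<Sum>n\<le>(N::nat). c n * mpow ?I \<phi> n i j)"
  have rel: "mpow ?I \<phi> r = mm ?I (mpow ?I \<phi> (Suc r)) y" unfolding y_def by fact
  have y: "ihom G A A y" unfolding y_def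
    by (intro ihom_sum ihom_scale ihom_mpow fin \<phi>)
  note sy = ihom_supported[OF y]
  have "mm ?I \<phi> y = mm ?I y \<phi>"
    unfolding y_def mm_sum_left mm_sum_right mm_scale_left mm_scale_right
    using mpow_commute[OF fin s refl s] by simp
  note comm1 = mpow_commute[OF fin s this sy]
  have comm: "mm ?I (mpow ?I \<phi> a) (mpow ?I y b) = mm ?I (mpow ?I y b) (mpow ?I \<phi> a)" for a b
    by (rule mpow_commute[OF fin sy _ supported_mpow[OF s], symmetric]) (rule comm1[symmetric])
  \<comment> \<open>Inserting the relation into itself k times trades every further factor \<phi>
    for a factor y.\<close>
  have red: "mpow ?I \<phi> r = mm ?I (mpow ?I \<phi> (r + k)) (mpow ?I y k)" for k
  proof (induction k)
    case 0 then show ?case using mm_idm_right[OF fin supported_mpow[OF s]] by simp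
  next
    case (Suc k)
    have "mm ?I (mpow ?I \<phi> (r + Suc k)) (mpow ?I y (Suc k))
        = mm ?I (mm ?I (mpow ?I \<phi> (k + Suc r)) y) (mpow ?I y k)"
      by (simp only: mpow.simps mm_assoc) (simp add: ac_simps)
    also have "mm ?I (mpow ?I \<phi> (k + Suc r)) y = mpow ?I \<phi> (r + k)"
      unfolding mpow_add[OF fin s] mm_assoc rel[symmetric] by (simp add: mpow_add[OF fin s, symmetric] add.commute)
    finally show ?case using Suc by simp
  qed
  define e where "e = mm ?I (mpow ?I \<phi> r) (mpow ?I y r)"
  have e: "ihom G A A e" unfolding e_def by (intro ihom_comp ihom_mpow fin \<phi> y)
  have "mm ?I e e = mm ?I (mm ?I (mpow ?I \<phi> r) (mm ?I (mpow ?I \<phi> r) (mpow ?I y r))) (mpow ?I y r)"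
  proof -
    have "mm ?I e e = mm ?I (mpow ?I \<phi> r) (mm ?I (mm ?I (mpow ?I y r) (mpow ?I \<phi> r)) (mpow ?I y r))"
      by (simp add: e_def mm_assoc)
    then show ?thesis by (simp add: comm[symmetric]) (simp add: mm_assoc)
  qed
  also have "mm ?I (mpow ?I \<phi> r) (mm ?I (mpow ?I \<phi> r) (mpow ?I y r)) = mpow ?I \<phi> r"
    using red[of r] by (simp add: mpow_add[OF fin s] mm_assoc)
  finally have idem: "mm ?I e e = e" by (simp add: e_def)
  consider "e = (\<lambda>i j. 0)" | "e = idm ?I" using A e idem by (auto simp: conn_def)
  then show ?thesis
  proof cases
    case 1
    have "mpow ?I \<phi> r = mm ?I (mpow ?I \<phi> r) e"
      using red[of r] by (simp add: e_def mpow_add[OF fin s] mm_assoc)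
    then show ?thesis using 1 by auto
  next
    case 2
    \<comment> \<open>For r = 0 the equation e = 1 carries no information; there the relation itself
      reads 1 = \<phi> y.\<close>
    show ?thesis
    proof (cases r)
      case 0
      then have "mm ?I \<phi> y = idm ?I" using rel by (simp add: mm_idm_right[OF fin s])
      then show ?thesis using y by auto
    next
      case (Suc k)
      have "mm ?I \<phi> (mm ?I (mpow ?I \<phi> k) (mpow ?I y r)) = idm ?I"
        using 2 Suc by (simp add: e_def mm_assoc)
      moreover have "ihom G A A (mm ?I (mpow ?I \<phi> k) (mpow ?I y r))"
        by (intro ihom_comp ihom_mpow fin \<phi> y)
      ultimately show ?thesis by blast
    qed
  qed
qed

text \<open>The endomorphism ring is local, so if a sum is right invertible, one of its summands is.
  The induction peels off the last composite f h: either the rest is still right invertible, or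
  after multiplication by \<psi> it is nilpotent and f h \<psi> is 1 minus a nilpotent.\<close>

lemma fac_conn_retract:
  assumes "fac G A \<B> \<phi>" and A: "conn G A" and "ihom G A A \<psi>" "mm (fst A) \<phi> \<psi> = idm (fst A)"
  shows "\<exists>B\<in>\<B>. \<exists>f h. ihom G B A f \<and> ihom G A B h \<and> mm (fst B) f h = idm (fst A)"
  using assms(1,3,4)
proof (induction arbitrary: \<psi> rule: fac.induct)
  case fac_zero
  then have "idm (fst A) = (\<lambda>i j. 0 :: 'c)" by simp
  then show ?case using A idm_nonzero[of "fst A"] by (metis conn_def)
next
  case (fac_step B f h \<phi>)
  let ?I = "fst A"
  have fin: "finite ?I" using A by (simp add: conn_def)
  define \<nu> where "\<nu> = mm ?I \<phi> \<psi>"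
  have n: "ihom G A A \<nu>" unfolding \<nu>_def
    by (intro ihom_comp fac_step fac_ihom[OF fac_step(4)])
  note sn = ihom_supported[OF n]
  have sum: "(\<lambda>i j. \<nu> i j + mm ?I (mm (fst B) f h) \<psi> i j) = idm ?I"
    using fac_step(7) by (simp add: mm_add_left \<nu>_def)
  from conn_local[OF A n] show ?case
  proof
    assume "\<exists>\<chi>. ihom G A A \<chi> \<and> mm ?I \<nu> \<chi> = idm ?I"
    then obtain \<chi> where "ihom G A A \<chi>" "mm ?I \<phi> (mm ?I \<psi> \<chi>) = idm ?I" by (auto simp: \<nu>_def mm_assoc)
    then show ?thesis using fac_step(5)[OF ihom_comp[OF _ fac_step(6)]] by blast
  next
    assume "\<exists>r. mpow ?I \<nu> r = (\<lambda>i j. 0)"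
    then obtain r where r: "mpow ?I \<nu> r = (\<lambda>i j. 0)" by blast
    \<comment> \<open>Geometric series: as \<nu>^r = 0, \<chi> is inverse to 1 - \<nu>, which is f h
      \<psi>.\<close>
    define \<chi> where "\<chi> = (\<lambda>i j. \<Sum>n<r. mpow ?I \<nu> n i j)"
    have \<chi>: "ihom G A A \<chi>" unfolding \<chi>_def by (intro ihom_sum ihom_mpow fin n)
    have m: "mm ?I (mm (fst B) f h) \<psi> = (\<lambda>i j. idm ?I i j + (-1) * \<nu> i j)"
      using fun_cong[OF fun_cong[OF sum]] by (auto simp: fun_eq_iff algebra_simps)
    have "mm ?I (mm ?I (mm (fst B) f h) \<psi>) \<chi> = idm ?I"
    proof (intro ext)
      fix i j
      have "mm ?I (mm ?I (mm (fst B) f h) \<psi>) \<chi> i j = \<chi> i j - (\<Sum>n<r. mpow ?I \<nu> (Suc n) i j)"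
        unfolding m mm_add_left mm_scale_left mm_idm_left[OF fin ihom_supported[OF \<chi>]]
        by (simp add: \<chi>_def mm_sum_right)
      also have "\<dots> = - (\<Sum>n<r. mpow ?I \<nu> (Suc n) i j - mpow ?I \<nu> n i j)"
        by (simp only: \<chi>_def sum_subtractf) simp
      also have "\<dots> = idm ?I i j"
        by (subst sum_lessThan_telescope) (simp add: r)
      finally show "mm ?I (mm ?I (mm (fst B) f h) \<psi>) \<chi> i j = idm ?I i j" .
    qed
    then have "mm (fst B) f (mm ?I h (mm ?I \<psi> \<chi>)) = idm ?I" by (simp add: mm_assoc)
    moreover have "ihom G A B (mm ?I h (mm ?I \<psi> \<chi>))"
      by (intro ihom_comp fac_step \<chi>)
    ultimately show ?thesis using fac_step(1,2) by blast
  qed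
qed

text \<open>A retraction f h = 1 makes h f an idempotent of B. It is not zero, as f (h f) h = 1, so
  connectedness of B makes it the identity.\<close>

lemma conn_inadd_iso:
  assumes A: "conn G A" and "inadd G A \<B>" and \<B>: "\<And>B. B \<in> \<B> \<Longrightarrow> conn G B"
  shows "\<exists>B\<in>\<B>. \<exists>f h. ihom G B A f \<and> ihom G A B h \<and> mm (fst B) f h = idm (fst A) \<and> mm (fst A) h f = idm (fst B)"
proof -
  have fin: "finite (fst A)" using A by (simp add: conn_def)
  obtain B f h where B: "B \<in> \<B>" "ihom G B A f" "ihom G A B h" "mm (fst B) f h = idm (fst A)"
    using fac_conn_retract[OF assms(2)[unfolded inadd_def] A ihom_idm[OF fin] mm_idm_left[OF fin supported_idm]]
    by blast
  let ?e = "mm (fst A) h f"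
  have c: "conn G B" using B \<B> by auto
  have hh: "mm (fst A) (idm (fst A)) f = f" by (rule mm_idm_left[OF fin ihom_supported[OF B(2)]])
  have "mm (fst B) ?e ?e = mm (fst A) h (mm (fst A) (mm (fst B) f h) f)" by (simp add: mm_assoc)
  then have "mm (fst B) ?e ?e = ?e" using hh by (simp add: B(4))
  moreover have "ihom G B B ?e" by (intro ihom_comp B)
  ultimately have "?e = (\<lambda>i j. 0) \<or> ?e = idm (fst B)" using c by (auto simp: conn_def)
  moreover have "?e \<noteq> (\<lambda>i j. 0)"
  proof
    assume "?e = (\<lambda>i j. 0)"
    then have "mm (fst B) f (mm (fst B) ?e h) = (\<lambda>i j. 0)" by simp
    moreover have "mm (fst B) f (mm (fst B) ?e h) = mm (fst A) (mm (fst B) f h) (mm (fst B) f h)"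
      by (simp add: mm_assoc)
    ultimately show False
      using A by (simp add: B(4) mm_idm_left[OF fin supported_idm] idm_nonzero conn_def)
  qed
  ultimately show ?thesis using B by blast
qed

section \<open>Splitting a representation along an idempotent\<close>

lemma split_idempotent:
  fixes e :: "'i \<Rightarrow> 'i \<Rightarrow> 'k::field"
  assumes fin: "finite I" and sup: "supported I I e" and idem: "mm I e e = e"
  obtains r P Q where "supported I {..<r} P" "supported {..<r} I Q" "mm {..<r} P Q = e" "mm I Q P = idm {..<r::nat}"
proof -
  let ?col = "\<lambda>j i. e i j"
  obtain B where B: "B \<subseteq> ?col ` I" "fvs.independent B" "?col ` I \<subseteq> fvs.span B"
    using fvs.maximal_independent_subset[of "?col ` I"] by auto
  have finB: "finite B" using B(1) fin finite_subset by auto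
  define r where "r = card B"
  obtain b where b: "bij_betw b {..<r} B"
    using ex_bij_betw_nat_finite[OF finB] by (auto simp: r_def atLeast0LessThan)
  \<comment> \<open>Rank factorisation: the columns of P form a basis of the column space of e, and
    Q holds the coordinates of the columns of e in this basis.\<close>
  define P where "P = (\<lambda>i n. if n < r then b n i else 0)"
  define Q where "Q = (\<lambda>n j. if n < r \<and> j \<in> I then fvs.representation B (?col j) (b n) else 0)"
  have bB: "b n \<in> B" if "n < r" for n using b that by (auto simp: bij_betw_def)
  have PQ: "mm {..<r} P Q = e"
  proof (intro ext)
    fix i j show "mm {..<r} P Q i j = e i j"
    proof (cases "j \<in> I")
      case True
      have "mm {..<r} P Q i j = (\<Sum>n<r. fvs.representation B (?col j) (b n) * b n i)"
        using True by (simp add: mm_def P_def Q_def mult.commute)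
      also have "\<dots> = (\<Sum>w\<in>B. fvs.representation B (?col j) w * w i)"
        using sum.reindex_bij_betw[OF b, of "\<lambda>w. fvs.representation B (?col j) w * w i"] by simp
      also have "\<dots> = (\<Sum>w\<in>B. (\<lambda>i. fvs.representation B (?col j) w * w i)) i" by (simp add: fvs_sum_apply)
      also have "(\<Sum>w\<in>B. (\<lambda>i. fvs.representation B (?col j) w * w i)) = ?col j"
        using B True by (intro fvs.sum_representation_eq finB) auto
      finally show ?thesis .
    qed (use supported_outside[OF sup] in \<open>simp add: mm_def Q_def\<close>)
  qed
  have sP: "supported I {..<r} P"
    unfolding supported_def
  proof (intro allI impI)
    fix i n assume "P i n \<noteq> 0"
    then have n: "n < r" "b n i \<noteq> 0" by (auto simp: P_def split: if_splits)
    then obtain j where "j \<in> I" "b n = ?col j" using bB[of n] B(1) by auto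
    then show "i \<in> I \<and> n \<in> {..<r}" using n supported_outside[OF sup, of i j] by auto
  qed
  have sQ: "supported {..<r} I Q" by (auto simp: supported_def Q_def split: if_splits)
  have eP: "mm I e P = P"
  proof (intro ext)
    fix i n show "mm I e P i n = P i n"
    proof (cases "n < r")
      case True
      then obtain j where "j \<in> I" "b n = ?col j" using bB[of n] B(1) by auto
      then have "mm I e P i n = mm I e e i j" using True by (simp add: mm_def P_def)
      then show ?thesis using idem True \<open>b n = ?col j\<close> by (simp add: P_def)
    qed (simp add: mm_def P_def)
  qed
  \<comment> \<open>From e P = P and e = P Q follows P (Q P - 1) = 0, and the columns of P are
    independent.\<close>
  have "mm I Q P = idm {..<r}"
  proof (intro ext)
    fix m n
    show "mm I Q P m n = idm {..<r} m n"
    proof (cases "m < r \<and> n < r")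
      case True
      define c where "c = (\<lambda>m. mm I Q P m n - idm {..<r} m n)"
      have "(\<Sum>m<r. c m * b m i) = 0" for i
      proof -
        have "mm {..<r} P (mm I Q P) i n = P i n"
          using eP PQ by (simp add: mm_assoc[symmetric])
        moreover have "mm {..<r} P (idm {..<r}) i n = P i n"
          using mm_idm_right[OF _ sP] by simp
        ultimately have "(\<Sum>m<r. P i m * mm I Q P m n) = (\<Sum>m<r. P i m * idm {..<r} m n)"
          by (simp add: mm_def)
        then have "(\<Sum>m<r. P i m * c m) = 0" by (simp add: c_def algebra_simps sum_subtractf)
        then show ?thesis by (simp add: P_def mult.commute)
      qed
      then have z: "(\<Sum>m<r. (\<lambda>i. c m * b m i)) = 0" by (auto simp: fun_eq_iff fvs_sum_apply)
      have "c m = 0"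
      proof -
        have inv: "inv_into {..<r} b (b m) = m" if "m < r" for m
          using b that by (simp add: bij_betw_def inv_into_f_f)
        have "(\<Sum>w\<in>B. (\<lambda>i. c (inv_into {..<r} b w) * w i)) = (\<Sum>m<r. (\<lambda>i. c (inv_into {..<r} b (b m)) * b m i))"
          using sum.reindex_bij_betw[OF b, of "\<lambda>w i. c (inv_into {..<r} b w) * w i"] by simp
        also have "\<dots> = 0" using z inv by simp
        finally have "c (inv_into {..<r} b (b m)) = 0"
          using fvs.independentD[OF B(2) finB subset_refl _ bB, of "\<lambda>w. c (inv_into {..<r} b w)" m] True by blast
        then show ?thesis using inv True by simp
      qed
      then show ?thesis by (simp add: c_def)
    next
      case False
      then show ?thesis using supported_outside[OF supported_mm[OF sQ sP]] by (auto simp: idm_def)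
    qed
  qed
  then show ?thesis using that sP sQ PQ by blast
qed

lemma sum_lessThan_add: "(\<Sum>j<a + b::nat. F j) = (\<Sum>j<a. F j) + (\<Sum>j<b. F (a + j))"
  by (induction b) (auto simp: add.assoc)

text \<open>Stacking the two factorisations \<open>e = P Q\<close>, \<open>1 - e = P' Q'\<close> gives mutually inverse matrices.\<close>

definition stack_cols :: "nat \<Rightarrow> ('i \<Rightarrow> nat \<Rightarrow> 'k) \<Rightarrow> ('i \<Rightarrow> nat \<Rightarrow> 'k) \<Rightarrow> 'i \<Rightarrow> nat \<Rightarrow> 'k" where
  "stack_cols r P P' = (\<lambda>i n. if n < r then P i n else P' i (n - r))"

definition stack_rows :: "nat \<Rightarrow> (nat \<Rightarrow> 'i \<Rightarrow> 'k) \<Rightarrow> (nat \<Rightarrow> 'i \<Rightarrow> 'k) \<Rightarrow> nat \<Rightarrow> 'i \<Rightarrow> 'k" where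
  "stack_rows r Q Q' = (\<lambda>n i. if n < r then Q n i else Q' (n - r) i)"

lemma supported_stack:
  assumes "supported I {..<r} P" "supported I {..<r'} P'" "supported {..<r} I Q" "supported {..<r'} I Q'"
  shows "supported I {..<r + r'} (stack_cols r P P')" "supported {..<r + r'} I (stack_rows r Q Q')"
  using assms by (auto simp: supported_def stack_cols_def stack_rows_def split: if_splits)
    (metis add.commute add_less_cancel_left le_add_diff_inverse not_less)+

text \<open>The two idempotents are orthogonal, which kills the off-diagonal blocks Q P' and Q' P.
  As the stacked matrices are inverse to each other, comparing their sizes yields the dimension
  formula.\<close>

lemma complementary_split:
  fixes e :: "'i \<Rightarrow> 'i \<Rightarrow> 'k::field"
  assumes fin: "finite I"
    and P: "supported I {..<r} P" "supported {..<r} I Q" "mm {..<r} P Q = e" "mm I Q P = idm {..<r::nat}"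
    and P': "supported I {..<r'} P'" "supported {..<r'} I Q'" "mm {..<r'} P' Q' = e'" "mm I Q' P' = idm {..<r'::nat}"
    and sum: "\<And>i j. e i j + e' i j = idm I i j"
  shows "mm {..<r + r'} (stack_cols r P P') (stack_rows r Q Q') = idm I"
    and "mm I (stack_rows r Q Q') (stack_cols r P P') = idm {..<r + r'}"
    and "r + r' = card I"
proof -
  show 1: "mm {..<r + r'} (stack_cols r P P') (stack_rows r Q Q') = idm I"
  proof (intro ext)
    fix i j
    have "mm {..<r + r'} (stack_cols r P P') (stack_rows r Q Q') i j = mm {..<r} P Q i j + mm {..<r'} P' Q' i j"
      by (simp add: mm_def sum_lessThan_add stack_cols_def stack_rows_def)
    then show "mm {..<r + r'} (stack_cols r P P') (stack_rows r Q Q') i j = idm I i j"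
      using P(3) P'(3) sum by simp
  qed
  have eP: "mm I e P = P" using P by (simp add: P(3)[symmetric] mm_assoc mm_idm_right)
  have Qe: "mm I Q e = Q" using P by (simp add: P(3)[symmetric] mm_assoc[symmetric] mm_idm_left)
  have e'P: "mm I e' P' = P'" using P' by (simp add: P'(3)[symmetric] mm_assoc mm_idm_right)
  have Q'e: "mm I Q' e' = Q'" using P' by (simp add: P'(3)[symmetric] mm_assoc[symmetric] mm_idm_left)
  have e': "e' = (\<lambda>i j. idm I i j + (-1) * e i j)"
    using sum by (auto simp: fun_eq_iff algebra_simps eq_diff_eq)
  have se: "supported I I e" unfolding P(3)[symmetric] by (intro supported_mm P)
  have "mm I e e = e" using eP by (simp add: P(3)[symmetric] mm_assoc[symmetric])
  then have ee': "mm I e e' = (\<lambda>i j. 0)" "mm I e' e = (\<lambda>i j. 0)"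
    unfolding e' mm_add_left mm_add_right mm_scale_left mm_scale_right
    by (simp_all add: mm_idm_left[OF fin se] mm_idm_right[OF fin se])
  have "mm I Q P' = mm I (mm I Q e) (mm I e' P')" "mm I Q' P = mm I (mm I Q' e') (mm I e P)"
    by (simp_all only: Qe e'P Q'e eP)
  moreover have "mm I (mm I Q e) (mm I e' P') = mm I Q (mm I (mm I e e') P')"
    "mm I (mm I Q' e') (mm I e P) = mm I Q' (mm I (mm I e' e) P)"
    by (simp_all only: mm_assoc)
  ultimately have QP': "mm I Q P' = (\<lambda>i j. 0)" and Q'P: "mm I Q' P = (\<lambda>i j. 0)"
    by (simp_all add: ee')
  show 2: "mm I (stack_rows r Q Q') (stack_cols r P P') = idm {..<r + r'}"
  proof (intro ext)
    fix m n
    have a: "mm I Q P a b = idm {..<r} a b" "mm I Q' P' a b = idm {..<r'} a b"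
      "mm I Q P' a b = 0" "mm I Q' P a b = 0" for a b
      using P(4) P'(4) QP' Q'P by simp_all
    have "mm I (stack_rows r Q Q') (stack_cols r P P') m n
      = (if m < r then if n < r then mm I Q P m n else mm I Q P' m (n - r)
         else if n < r then mm I Q' P (m - r) n else mm I Q' P' (m - r) (n - r))"
      by (simp add: mm_def stack_rows_def stack_cols_def)
    also have "\<dots> = idm {..<r + r'} m n" unfolding a by (auto simp: idm_def)
    finally show "mm I (stack_rows r Q Q') (stack_cols r P P') m n = idm {..<r + r'} m n" .
  qed
  show "r + r' = card I"
  proof (rule antisym)
    show "r + r' \<le> card I"
      using card_le_of_left_inverse[OF _ fin supported_stack(2)[OF P(1) P'(1) P(2) P'(2)] 2] by simp
    show "card I \<le> r + r'"
      using card_le_of_left_inverse[OF fin _ supported_stack(1)[OF P(1) P'(1) P(2) P'(2)] 1] by simp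
  qed
qed

text \<open>The image of the idempotent P Q, written in the basis given by the columns of P: there P
  becomes the inclusion and Q the projection.\<close>

definition subrep :: "nat \<Rightarrow> ('i \<Rightarrow> nat \<Rightarrow> 'k) \<Rightarrow> (nat \<Rightarrow> 'i \<Rightarrow> 'k) \<Rightarrow> ('g, 'i, 'k::field) irep \<Rightarrow> ('g, nat, 'k) irep" where
  "subrep r P Q A = ({..<r}, \<lambda>g. mm (fst A) Q (mm (fst A) (snd A g) P))"

lemma fst_subrep [simp]: "fst (subrep r P Q A) = {..<r}" by (simp add: subrep_def)

lemma subrep_homs:
  assumes fin: "finite (fst A)" and e: "ihom G A A e"
    and P: "supported (fst A) {..<r} P" "supported {..<r} (fst A) Q" "mm {..<r} P Q = e" "mm (fst A) Q P = idm {..<r}"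
  shows "ihom G (subrep r P Q A) A P" "ihom G A (subrep r P Q A) Q"
proof -
  let ?I = "fst A"
  have eP: "mm ?I e P = P" using P by (simp add: P(3)[symmetric] mm_assoc mm_idm_right)
  have Qe: "mm ?I Q e = Q" using P by (simp add: P(3)[symmetric] mm_assoc[symmetric] mm_idm_left)
  have c: "mm ?I e (snd A g) j i = mm ?I (snd A g) e j i" if "g \<in> G" "j \<in> ?I" "i \<in> ?I" for g i j
    using ihomD[OF e] that by simp
  show "ihom G (subrep r P Q A) A P" unfolding ihom_def
  proof (intro conjI ballI)
    fix g j n assume g: "g \<in> G" and j: "j \<in> ?I" and "n \<in> fst (subrep r P Q A)"
    have "mm {..<r} P (mm ?I Q (mm ?I (snd A g) P)) j n = mm ?I (mm ?I e (snd A g)) P j n"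
      by (simp add: mm_assoc[symmetric] P(3))
    also have "\<dots> = mm ?I (mm ?I (snd A g) e) P j n"
      by (rule mm_cong) (use c[OF g j] in auto)
    finally show "mm (fst (subrep r P Q A)) P (snd (subrep r P Q A) g) j n = mm ?I (snd A g) P j n"
      using eP by (simp add: subrep_def mm_assoc)
  qed (use P in simp)
  show "ihom G A (subrep r P Q A) Q" unfolding ihom_def
  proof (intro conjI ballI)
    fix g n i assume g: "g \<in> G" and i: "i \<in> ?I" and "n \<in> fst (subrep r P Q A)"
    have "mm {..<r} (mm ?I Q (mm ?I (snd A g) P)) Q n i = mm ?I Q (mm ?I (snd A g) e) n i"
      by (simp add: mm_assoc P(3))
    also have "\<dots> = mm ?I Q (mm ?I e (snd A g)) n i"
      by (rule mm_cong) (use c[OF g _ i] in auto)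
    also have "\<dots> = mm ?I Q (snd A g) n i" by (simp add: mm_assoc[symmetric] Qe)
    finally show "mm ?I Q (snd A g) n i = mm (fst (subrep r P Q A)) (snd (subrep r P Q A) g) Q n i"
      by (simp add: subrep_def)
  qed (use P in simp)
qed

lemma nonconn_split:
  assumes fin: "finite (fst A)" and ne: "fst A \<noteq> {}" and nc: "\<not> conn G A"
  obtains r r' P Q P' Q' where
    "r > 0" "r' > 0" "r + r' = card (fst A)"
    "ihom G (subrep r P Q A) A P" "ihom G A (subrep r P Q A) Q" "mm (fst A) Q P = idm {..<r}"
    "ihom G (subrep r' P' Q' A) A P'" "ihom G A (subrep r' P' Q' A) Q'" "mm (fst A) Q' P' = idm {..<r'}"
    "mm {..<r + r'} (stack_cols r P P') (stack_rows r Q Q') = idm (fst A)"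
    "mm (fst A) (stack_rows r Q Q') (stack_cols r P P') = idm {..<r + r'}"
    "\<forall>i j. mm {..<r} P Q i j + mm {..<r'} P' Q' i j = idm (fst A) i j"
proof -
  let ?I = "fst A"
  obtain e where e: "ihom G A A e" "mm ?I e e = e" "e \<noteq> (\<lambda>i j. 0)" "e \<noteq> idm ?I"
    using assms by (auto simp: conn_def)
  define e' where "e' = (\<lambda>i j. idm ?I i j + (-1) * e i j)"
  have e'h: "ihom G A A e'" unfolding e'_def by (intro ihom_add ihom_scale ihom_idm fin e)
  have se: "supported ?I ?I e" and se': "supported ?I ?I e'" by (rule ihom_supported[OF e(1)], rule ihom_supported[OF e'h])
  have "mm ?I e' e' = e'"
    unfolding e'_def mm_add_left mm_add_right mm_scale_left mm_scale_right
    by (simp add: mm_idm_left[OF fin se] mm_idm_right[OF fin se] mm_idm_left[OF fin supported_idm] e(2))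
  obtain r P Q where P: "supported ?I {..<r} P" "supported {..<r} ?I Q" "mm {..<r} P Q = e" "mm ?I Q P = idm {..<r::nat}"
    by (rule split_idempotent[OF fin se e(2)])
  obtain r' P' Q' where P': "supported ?I {..<r'} P'" "supported {..<r'} ?I Q'" "mm {..<r'} P' Q' = e'" "mm ?I Q' P' = idm {..<r'::nat}"
    by (rule split_idempotent[OF fin se' \<open>mm ?I e' e' = e'\<close>])
  have sum: "e i j + e' i j = idm ?I i j" for i j by (simp add: e'_def)
  note cs = complementary_split[OF fin P P' sum]
  have "r \<noteq> 0" using P(3) e(3) by (auto simp: mm_def)
  moreover have "r' \<noteq> 0"
  proof
    assume "r' = 0"
    then have "e' = (\<lambda>i j. 0)" using P'(3) by (auto simp: mm_def)
    then have "e = idm ?I" using sum by (auto simp: fun_eq_iff)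
    then show False using e(4) by simp
  qed
  ultimately show ?thesis
    using that[OF _ _ cs(3) subrep_homs[OF fin e(1) P] P(4) subrep_homs[OF fin e'h P'] P'(4) cs(1,2)] P(3) P'(3) sum
    by auto
qed

text \<open>Induction on the dimension, since a nonzero object that is not connected splits into two
  of smaller positive dimension. Every component is also recorded as a summand of A; later this
  shows that the components of a base change really occur in it.\<close>

lemma conn_decomposition:
  fixes A :: "('g, nat, 'k::field) irep"
  assumes "fst A = {..<d}"
  shows "\<exists>\<X>. finite \<X> \<and> inadd G A \<X> \<and> (\<forall>B\<in>\<X>. conn G B \<and> (\<exists>m. fst B = {..<m::nat}) \<and> inadd G B {A})"
  using assms
proof (induction d arbitrary: A rule: less_induct)
  case (less d)
  have fin: "finite (fst A)" using less by simp
  consider "d = 0" | "conn G A" | "d \<noteq> 0" "\<not> conn G A" by blast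
  then show ?case
  proof cases
    case 1
    then show ?thesis using less.prems inadd_empty[of A G "{}"] by (intro exI[of _ "{}"]) auto
  next
    case 2
    moreover have "inadd G A {A}" using fin by (rule inadd_refl) simp
    ultimately show ?thesis using less.prems by (intro exI[of _ "{A}"]) simp
  next
    case 3
    have ne: "fst A \<noteq> {}" using less.prems 3(1) by auto
    obtain r r' P Q P' Q' where s:
      "r > 0" "r' > 0" "r + r' = card (fst A)"
      "ihom G (subrep r P Q A) A P" "ihom G A (subrep r P Q A) Q" "mm (fst A) Q P = idm {..<r}"
      "ihom G (subrep r' P' Q' A) A P'" "ihom G A (subrep r' P' Q' A) Q'" "mm (fst A) Q' P' = idm {..<r'}"
      "mm {..<r + r'} (stack_cols r P P') (stack_rows r Q Q') = idm (fst A)"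
      "mm (fst A) (stack_rows r Q Q') (stack_cols r P P') = idm {..<r + r'}"
      "\<forall>i j. mm {..<r} P Q i j + mm {..<r'} P' Q' i j = idm (fst A) i j"
      using nonconn_split[OF fin ne 3(2)] .
    let ?B = "subrep r P Q A" and ?C = "subrep r' P' Q' A"
    have rd: "r < d" "r' < d" using s(1-3) less.prems by auto
    obtain \<X> where X: "finite \<X>" "inadd G ?B \<X>" "\<forall>B\<in>\<X>. conn G B \<and> (\<exists>m. fst B = {..<m::nat}) \<and> inadd G B {?B}"
      using less.IH[OF rd(1), of ?B] by auto
    obtain \<Y> where Y: "finite \<Y>" "inadd G ?C \<Y>" "\<forall>B\<in>\<Y>. conn G B \<and> (\<exists>m. fst B = {..<m::nat}) \<and> inadd G B {?C}"
      using less.IH[OF rd(2), of ?C] by auto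
    have B: "inadd G ?B {A}" by (rule inadd_retract[OF _ s(5,4)]) (simp_all add: s(6))
    have C: "inadd G ?C {A}" by (rule inadd_retract[OF _ s(8,7)]) (simp_all add: s(9))
    have A: "inadd G A {?B, ?C}"
    proof -
      have "fac G A {?B, ?C} (\<lambda>i j. mm {..<r} P Q i j + mm {..<r'} P' Q' i j)"
        using fac_add[OF fac_one[of ?C "{?B, ?C}" G A P' Q'] fac_one[of ?B "{?B, ?C}" G A P Q]] s by simp
      moreover have "(\<lambda>i j. mm {..<r} P Q i j + mm {..<r'} P' Q' i j) = idm (fst A)"
        by (intro ext) (rule s(12)[rule_format])
      ultimately show ?thesis by (simp add: inadd_def)
    qed
    have "inadd G A (\<X> \<union> \<Y>)"
    proof (rule inadd_trans[OF A])
      fix D assume "D \<in> {?B, ?C}"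
      then consider "D = ?B" | "D = ?C" by blast
      then show "inadd G D (\<X> \<union> \<Y>) \<and> finite (fst D)"
      proof cases
        case 1
        show ?thesis unfolding 1 using inadd_mono[OF X(2) Un_upper1] by simp
      next
        case 2
        show ?thesis unfolding 2 using inadd_mono[OF Y(2) Un_upper2] by simp
      qed
    qed
    moreover have "inadd G D {A}" if "D \<in> \<X> \<union> \<Y>" for D
    proof -
      have "inadd G D {?B} \<or> inadd G D {?C}"
        using that bspec[OF X(3), of D] bspec[OF Y(3), of D] by (elim UnE) simp_all
      then consider "inadd G D {?B}" | "inadd G D {?C}" by (elim disjE)
      then show ?thesis
      proof cases
        case 1
        show ?thesis by (rule inadd_trans[OF 1]) (use B in simp)
      next
        case 2
        show ?thesis by (rule inadd_trans[OF 2]) (use C in simp)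
      qed
    qed
    moreover have "conn G D \<and> (\<exists>m. fst D = {..<m})" if "D \<in> \<X> \<union> \<Y>" for D
      using that bspec[OF X(3), of D] bspec[OF Y(3), of D] by (elim UnE) simp_all
    moreover have "finite (\<X> \<union> \<Y>)" using X(1) Y(1) by simp
    ultimately show ?thesis by (intro exI[of _ "\<X> \<union> \<Y>"] conjI ballI) simp_all
  qed
qed

section \<open>Translation between matrix representations and index-set representations\<close>

definition jrep :: "nat \<Rightarrow> ('g \<Rightarrow> 'k::field mat) \<Rightarrow> ('g, nat, 'k) irep" where
  "jrep d \<rho> = ({..<d}, \<lambda>g i j. \<rho> g $$ (i, j))"

lemma fst_jrep [simp]: "fst (jrep d \<rho>) = {..<d}" by (simp add: jrep_def)
lemma snd_jrep [simp]: "snd (jrep d \<rho>) g i j = \<rho> g $$ (i, j)" by (simp add: jrep_def)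

lemma mat_mm: "mat a c (\<lambda>(i, j). mm {..<b} f h i j) = mat a b (\<lambda>(i, j). f i j) * mat b c (\<lambda>(i, j). h i j)"
  by (rule eq_matI) (auto simp: mm_def scalar_prod_def atLeast0LessThan)

lemma mat_mult_index:
  "A \<in> carrier_mat a b \<Longrightarrow> B \<in> carrier_mat b c \<Longrightarrow> i < a \<Longrightarrow> j < c \<Longrightarrow>
     (A * B) $$ (i, j) = (\<Sum>k<b. A $$ (i, k) * B $$ (k, j))"
  by (auto simp: scalar_prod_def atLeast0LessThan)

lemma mat_jrep: "M \<in> carrier_mat d d' \<Longrightarrow> mat d d' (($$) M) = M"
  by (rule eq_matI) auto

lemma mat_idm: "mat d d (\<lambda>(i, j). idm {..<d} i j) = 1\<^sub>m d"
  by (rule eq_matI) (auto simp: idm_def)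

lemma rep_sum_carrier:
  "\<sigma> g \<in> carrier_mat a a \<Longrightarrow> \<tau> g \<in> carrier_mat b b \<Longrightarrow> rep_sum a \<sigma> b \<tau> g \<in> carrier_mat (a + b) (a + b)"
  by (simp add: rep_sum_def)

lemma rep_sum_index:
  assumes "\<sigma> g \<in> carrier_mat a a" "\<tau> g \<in> carrier_mat b b" "i < a + b" "j < a + b"
  shows "rep_sum a \<sigma> b \<tau> g $$ (i, j) = (if i < a then if j < a then \<sigma> g $$ (i, j) else 0
      else if j < a then 0 else \<tau> g $$ (i - a, j - a))"
  using assms by (simp add: rep_sum_def)

text \<open>Let S(g) = Q g P. Since Q intertwines, Q g = S(g) Q, so S(g h) = Q g h P = S(g) S(h);
  and S of the unit is Q P = 1.\<close>

lemma is_rep_subrep: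
  fixes \<rho> :: "'g \<Rightarrow> 'k::field mat"
  assumes rep: "is_rep G mul e d \<rho>"
    and Q: "ihom G (jrep d \<rho>) (subrep r P Q (jrep d \<rho>)) Q" and QP: "mm {..<d} Q P = idm {..<r}"
    and P: "supported {..<d} {..<r} P"
  shows "is_rep G mul e r (\<lambda>g. mat r r (\<lambda>(i, j). snd (subrep r P Q (jrep d \<rho>)) g i j))"
proof -
  let ?A = "jrep d \<rho>"
  let ?S = "snd (subrep r P Q ?A)"
  have S: "?S g = mm {..<d} Q (mm {..<d} (snd ?A g) P)" for g by (simp add: subrep_def)
  have car: "\<rho> g \<in> carrier_mat d d" if "g \<in> G" for g using rep that by (simp add: is_rep_def)
  have mult: "?S (mul g h) i j = mm {..<r} (?S g) (?S h) i j" if g: "g \<in> G" and h: "h \<in> G" and i: "i < r" for g h i j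
  proof -
    have m: "snd ?A (mul g h) k l = mm {..<d} (snd ?A g) (snd ?A h) k l" if "k < d" "l < d" for k l
      using rep g h mat_mult_index[OF car[OF g] car[OF h] that] by (simp add: is_rep_def mm_def)
    have "?S (mul g h) i j = (\<Sum>k<d. Q i k * (\<Sum>l<d. mm {..<d} (snd ?A g) (snd ?A h) k l * P l j))"
      unfolding S mm_def[of _ Q] mm_def[of _ _ P] using m by (intro sum.cong refl arg_cong2[of _ _ _ _ "(*)"]) auto
    also have "\<dots> = mm {..<d} Q (mm {..<d} (mm {..<d} (snd ?A g) (snd ?A h)) P) i j"
      by (simp add: mm_def)
    also have "\<dots> = mm {..<d} (mm {..<d} Q (snd ?A g)) (mm {..<d} (snd ?A h) P) i j"
      by (simp only: mm_assoc)
    also have "\<dots> = mm {..<d} (mm {..<r} (?S g) Q) (mm {..<d} (snd ?A h) P) i j"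
      by (rule mm_cong) (use ihomD[OF Q g, of i] i in simp_all)
    finally show ?thesis by (simp only: mm_assoc S)
  qed
  have one: "?S e i j = idm {..<r} i j" for i j
  proof -
    have "mm {..<d} (snd ?A e) P k j = P k j" if "k < d" for k
    proof -
      have "mm {..<d} (snd ?A e) P k j = mm {..<d} (idm {..<d}) P k j"
        using rep that by (intro mm_cong) (auto simp: is_rep_def idm_def)
      then show ?thesis using mm_idm_left[OF _ P] by simp
    qed
    then have "?S e i j = mm {..<d} Q P i j"
      unfolding S by (intro mm_cong) auto
    then show ?thesis using QP by simp
  qed
  show ?thesis
    unfolding is_rep_def
  proof (intro conjI ballI)
    fix g h assume "g \<in> G" "h \<in> G"
    then have "mat r r (\<lambda>(i, j). ?S (mul g h) i j) = mat r r (\<lambda>(i, j). mm {..<r} (?S g) (?S h) i j)"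
      using mult by (intro eq_matI) auto
    then show "mat r r (\<lambda>(i, j). ?S (mul g h) i j) = mat r r (\<lambda>(i, j). ?S g i j) * mat r r (\<lambda>(i, j). ?S h i j)"
      by (simp add: mat_mm)
  next
    show "mat r r (\<lambda>(i, j). ?S e i j) = 1\<^sub>m r" by (simp only: one mat_idm)
  qed simp
qed

text \<open>A nontrivial idempotent gives two projections Q and Q'. Stacked, they form an invertible
  matrix that carries the module to the block sum of the two images, against
  indecomposability.\<close>

lemma indecomposable_conn:
  fixes \<rho> :: "'g \<Rightarrow> 'k::field mat"
  assumes ind: "indecomposable G mul e d \<rho>"
  shows "conn G (jrep d \<rho>)"
proof (rule ccontr)
  let ?A = "jrep d \<rho>"
  assume nc: "\<not> conn G ?A"
  have rep: "is_rep G mul e d \<rho>" and d: "d > 0" using ind by (auto simp: indecomposable_def)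
  have fin: "finite (fst ?A)" and ne: "fst ?A \<noteq> {}" using d by auto
  obtain r r' P Q P' Q' where s:
      "r > 0" "r' > 0" "r + r' = card (fst ?A)"
      "ihom G (subrep r P Q ?A) ?A P" "ihom G ?A (subrep r P Q ?A) Q" "mm (fst ?A) Q P = idm {..<r}"
      "ihom G (subrep r' P' Q' ?A) ?A P'" "ihom G ?A (subrep r' P' Q' ?A) Q'" "mm (fst ?A) Q' P' = idm {..<r'}"
      "mm {..<r + r'} (stack_cols r P P') (stack_rows r Q Q') = idm (fst ?A)"
      "mm (fst ?A) (stack_rows r Q Q') (stack_cols r P P') = idm {..<r + r'}"
      "\<forall>i j. mm {..<r} P Q i j + mm {..<r'} P' Q' i j = idm (fst ?A) i j"
    using nonconn_split[OF fin ne nc] .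
  let ?R = "\<lambda>i j. stack_rows r Q Q' i j" and ?C = "\<lambda>i j. stack_cols r P P' i j"
  have rd: "r + r' = d" using s(3) by simp
  let ?\<sigma> = "\<lambda>g. mat r r (\<lambda>(i, j). snd (subrep r P Q ?A) g i j)"
  let ?\<tau> = "\<lambda>g. mat r' r' (\<lambda>(i, j). snd (subrep r' P' Q' ?A) g i j)"
  have 1: "is_rep G mul e r ?\<sigma>"
    by (rule is_rep_subrep[OF rep s(5)]) (use s(6) ihom_supported[OF s(4)] in simp_all)
  have 2: "is_rep G mul e r' ?\<tau>"
    by (rule is_rep_subrep[OF rep s(8)]) (use s(9) ihom_supported[OF s(7)] in simp_all)
  let ?P = "mat d d (\<lambda>(i, j). ?R i j)" and ?P' = "mat d d (\<lambda>(i, j). ?C i j)"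
  have PP': "?P * ?P' = 1\<^sub>m d" "?P' * ?P = 1\<^sub>m d"
    using s(10,11) rd by (simp_all add: mat_mm[symmetric] mat_idm)
  then have invP: "invertible_mat ?P"
    unfolding invertible_mat_def inverts_mat_def by auto
  have "?P * \<rho> g = rep_sum r ?\<sigma> r' ?\<tau> g * ?P" if g: "g \<in> G" for g
  proof (rule eq_matI)
    have car: "\<rho> g \<in> carrier_mat d d" using rep g by (simp add: is_rep_def)
    show "dim_row (?P * \<rho> g) = dim_row (rep_sum r ?\<sigma> r' ?\<tau> g * ?P)"
      "dim_col (?P * \<rho> g) = dim_col (rep_sum r ?\<sigma> r' ?\<tau> g * ?P)"
      using rd car by (auto simp: rep_sum_def)
    fix n i assume "n < dim_row (rep_sum r ?\<sigma> r' ?\<tau> g * ?P)" "i < dim_col (rep_sum r ?\<sigma> r' ?\<tau> g * ?P)"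
    then have n: "n < r + r'" and i: "i < d" by (auto simp: rep_sum_def)
    have L: "(?P * \<rho> g) $$ (n, i) = mm {..<d} (stack_rows r Q Q') (snd ?A g) n i"
      using n i rd by (subst mat_mult_index[OF _ car, of _ d]) (simp_all add: mm_def)
    let ?S = "rep_sum r ?\<sigma> r' ?\<tau> g"
    have S: "?S \<in> carrier_mat d d" unfolding rd[symmetric] by (rule rep_sum_carrier) simp_all
    have fb: "?S $$ (n, j) = (if n < r then if j < r then snd (subrep r P Q ?A) g n j else 0
      else if j < r then 0 else snd (subrep r' P' Q' ?A) g (n - r) (j - r))" if "j < r + r'" for j
      using n that by (subst rep_sum_index) auto
    have "(?S * ?P) $$ (n, i) = (\<Sum>j<d. ?S $$ (n, j) * ?R j i)"
      using n i rd by (subst mat_mult_index[OF S, of _ d]) simp_all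
    also have "\<dots> = (\<Sum>j<r. ?S $$ (n, j) * Q j i) + (\<Sum>j<r'. ?S $$ (n, r + j) * Q' j i)"
      unfolding rd[symmetric] sum_lessThan_add by (simp add: stack_rows_def)
    also have "\<dots> = mm {..<d} (stack_rows r Q Q') (snd ?A g) n i"
    proof (cases "n < r")
      case True
      have "(\<Sum>j<r. ?S $$ (n, j) * Q j i) = mm {..<r} (snd (subrep r P Q ?A) g) Q n i"
        unfolding mm_def using True by (intro sum.cong) (simp_all add: fb)
      moreover have "(\<Sum>j<r'. ?S $$ (n, r + j) * Q' j i) = 0"
        using True by (intro sum.neutral) (simp add: fb)
      moreover have "mm {..<d} (stack_rows r Q Q') (snd ?A g) n i = mm {..<d} Q (snd ?A g) n i"
        using True by (simp add: mm_def stack_rows_def)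
      ultimately show ?thesis using ihomD[OF s(5) g, of n i] True i by simp
    next
      case False
      have "(\<Sum>j<r'. ?S $$ (n, r + j) * Q' j i) = mm {..<r'} (snd (subrep r' P' Q' ?A) g) Q' (n - r) i"
        unfolding mm_def using False by (intro sum.cong) (simp_all add: fb)
      moreover have "(\<Sum>j<r. ?S $$ (n, j) * Q j i) = 0"
        using False by (intro sum.neutral) (simp add: fb)
      moreover have "mm {..<d} (stack_rows r Q Q') (snd ?A g) n i = mm {..<d} Q' (snd ?A g) (n - r) i"
        using False by (simp add: mm_def stack_rows_def)
      moreover have "n - r < r'" using False n by simp
      ultimately show ?thesis using ihomD[OF s(8) g, of "n - r" i] i by simp
    qed
    finally show "(?P * \<rho> g) $$ (n, i) = (rep_sum r ?\<sigma> r' ?\<tau> g * ?P) $$ (n, i)" using L by simp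
  qed
  then have "\<forall>g\<in>G. ?P * \<rho> g = rep_sum r ?\<sigma> r' ?\<tau> g * ?P" by blast
  moreover have "?P \<in> carrier_mat d d" by simp
  ultimately have "rep_iso G d \<rho> (r + r') (rep_sum r ?\<sigma> r' ?\<tau>)"
    unfolding rep_iso_def using rd[symmetric] invP by blast
  then show False using ind s(1,2) 1 2 unfolding indecomposable_def by blast
qed

lemma invertible_matE:
  assumes "invertible_mat P" "P \<in> carrier_mat d d"
  obtains P' where "P' \<in> carrier_mat d d" "P * P' = 1\<^sub>m d" "P' * P = 1\<^sub>m d"
proof -
  obtain B where B: "P * B = 1\<^sub>m (dim_row P)" "B * P = 1\<^sub>m (dim_row B)"
    using assms by (auto simp: invertible_mat_def inverts_mat_def)
  have "dim_col B = d" using arg_cong[OF B(1), of dim_col] assms(2) by simp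
  moreover have "dim_row B = d" using arg_cong[OF B(2), of dim_col] assms(2) by simp
  ultimately show ?thesis using that[of B] B assms(2) by auto
qed

text \<open>The first d' rows of the change of basis P form the projection onto the summand, and the
  first d' columns of its inverse form the inclusion.\<close>

lemma direct_summand_inadd:
  fixes \<rho> :: "'g \<Rightarrow> 'k::field mat"
  assumes ds: "direct_summand G mul e d' \<sigma> d \<rho>" and rep: "is_rep G mul e d' \<sigma>"
    and car: "\<And>g. g \<in> G \<Longrightarrow> \<rho> g \<in> carrier_mat d d"
  shows "inadd G (jrep d' \<sigma>) {jrep d \<rho>}"
proof -
  obtain d'' \<tau> P where \<tau>: "is_rep G mul e d'' \<tau>" and d: "d = d' + d''" and P: "P \<in> carrier_mat d d" "invertible_mat P"
    and PP: "\<And>g. g \<in> G \<Longrightarrow> P * \<rho> g = rep_sum d' \<sigma> d'' \<tau> g * P"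
    using ds by (auto simp: direct_summand_def rep_iso_def)
  obtain P' where P': "P' \<in> carrier_mat d d" "P * P' = 1\<^sub>m d" "P' * P = 1\<^sub>m d"
    using invertible_matE[OF P(2,1)] .
  have s: "rep_sum d' \<sigma> d'' \<tau> g \<in> carrier_mat d d" if "g \<in> G" for g
    using rep \<tau> that by (auto simp: is_rep_def rep_sum_def d)
  have PP2: "\<rho> g * P' = P' * rep_sum d' \<sigma> d'' \<tau> g" if g: "g \<in> G" for g
  proof -
    have "P' * (P * \<rho> g) * P' = P' * (rep_sum d' \<sigma> d'' \<tau> g * P) * P'" using PP[OF g] by simp
    moreover have "P' * (P * \<rho> g) * P' = \<rho> g * P'"
      using P P' car[OF g] by (simp add: assoc_mult_mat[symmetric, of _ d d _ d _ d])
    moreover have "P' * (rep_sum d' \<sigma> d'' \<tau> g * P) * P' = P' * rep_sum d' \<sigma> d'' \<tau> g"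
      using P P' s[OF g] by (simp add: assoc_mult_mat[of _ d d _ d _ d])
    ultimately show ?thesis by simp
  qed
  let ?f = "\<lambda>i j. if i < d' \<and> j < d then P $$ (i, j) else 0"
  let ?h = "\<lambda>i j. if i < d \<and> j < d' then P' $$ (i, j) else 0"
  have fb: "rep_sum d' \<sigma> d'' \<tau> g $$ (i, j) = (if i < d' then if j < d' then \<sigma> g $$ (i, j) else 0
      else if j < d' then 0 else \<tau> g $$ (i - d', j - d'))" if "i < d" "j < d" "g \<in> G" for g i j
    using that rep \<tau> unfolding d is_rep_def by (intro rep_sum_index) auto
  show ?thesis
  proof (rule inadd_retract[of "jrep d \<rho>"])
    show "ihom G (jrep d \<rho>) (jrep d' \<sigma>) ?f" unfolding ihom_def
    proof (intro conjI ballI)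
      show "supported (fst (jrep d' \<sigma>)) (fst (jrep d \<rho>)) ?f" by (auto simp: supported_def)
      fix g i j assume g: "g \<in> G" and i: "i \<in> fst (jrep d' \<sigma>)" and j: "j \<in> fst (jrep d \<rho>)"
      have "(\<Sum>k<d. P $$ (i, k) * \<rho> g $$ (k, j)) = (P * \<rho> g) $$ (i, j)"
        using i j d by (subst mat_mult_index[OF P(1) car[OF g]]) simp_all
      also have "\<dots> = (\<Sum>k<d. rep_sum d' \<sigma> d'' \<tau> g $$ (i, k) * P $$ (k, j))"
        using i j d unfolding PP[OF g] by (subst mat_mult_index[OF s[OF g] P(1)]) simp_all
      also have "\<dots> = (\<Sum>k<d. if k < d' then \<sigma> g $$ (i, k) * P $$ (k, j) else 0)"
        using i j d fb[OF _ _ g, of i] by (intro sum.cong) auto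
      also have "\<dots> = (\<Sum>k<d'. \<sigma> g $$ (i, k) * P $$ (k, j))"
        unfolding d by (simp add: sum_lessThan_add)
      finally show "mm (fst (jrep d \<rho>)) ?f (snd (jrep d \<rho>) g) i j = mm (fst (jrep d' \<sigma>)) (snd (jrep d' \<sigma>) g) ?f i j"
        using i j by (simp add: mm_def)
    qed
    show "ihom G (jrep d' \<sigma>) (jrep d \<rho>) ?h" unfolding ihom_def
    proof (intro conjI ballI)
      show "supported (fst (jrep d \<rho>)) (fst (jrep d' \<sigma>)) ?h" by (auto simp: supported_def)
      fix g i j assume g: "g \<in> G" and i: "i \<in> fst (jrep d \<rho>)" and j: "j \<in> fst (jrep d' \<sigma>)"
      have "(\<Sum>k<d. \<rho> g $$ (i, k) * P' $$ (k, j)) = (\<rho> g * P') $$ (i, j)"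
        using i j d by (subst mat_mult_index[OF car[OF g] P'(1)]) simp_all
      also have "\<dots> = (\<Sum>k<d. P' $$ (i, k) * rep_sum d' \<sigma> d'' \<tau> g $$ (k, j))"
        using i j d unfolding PP2[OF g] by (subst mat_mult_index[OF P'(1) s[OF g]]) simp_all
      also have "\<dots> = (\<Sum>k<d. if k < d' then P' $$ (i, k) * \<sigma> g $$ (k, j) else 0)"
        using i j d fb[OF _ _ g, of _ j] by (intro sum.cong) auto
      also have "\<dots> = (\<Sum>k<d'. P' $$ (i, k) * \<sigma> g $$ (k, j))"
        unfolding d by (simp add: sum_lessThan_add)
      finally show "mm (fst (jrep d' \<sigma>)) ?h (snd (jrep d' \<sigma>) g) i j = mm (fst (jrep d \<rho>)) (snd (jrep d \<rho>) g) ?h i j"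
        using i j by (simp add: mm_def)
    qed
    show "mm (fst (jrep d \<rho>)) ?f ?h = idm (fst (jrep d' \<sigma>))"
    proof (intro ext)
      fix i j
      have "(\<Sum>k<d. P $$ (i, k) * P' $$ (k, j)) = (P * P') $$ (i, j)" if "i < d'" "j < d'"
        using that d by (subst mat_mult_index[OF P(1) P'(1)]) simp_all
      then show "mm (fst (jrep d \<rho>)) ?f ?h i j = idm (fst (jrep d' \<sigma>)) i j"
        using P'(2) d by (cases "i < d' \<and> j < d'") (auto simp: mm_def idm_def)
    qed
  qed simp
qed

lemma rep_iso_of_inverse_homs:
  fixes \<sigma> :: "'g \<Rightarrow> 'k::field mat"
  assumes f: "ihom G (jrep d' \<sigma>') (jrep d \<sigma>) f" and h: "ihom G (jrep d \<sigma>) (jrep d' \<sigma>') h"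
    and fh: "mm {..<d'} f h = idm {..<d}" and hf: "mm {..<d} h f = idm {..<d'}"
    and car: "\<And>g. g \<in> G \<Longrightarrow> \<sigma> g \<in> carrier_mat d d" "\<And>g. g \<in> G \<Longrightarrow> \<sigma>' g \<in> carrier_mat d' d'"
  shows "rep_iso G d \<sigma> d' \<sigma>'"
proof -
  have sf: "supported {..<d} {..<d'} f" and sh: "supported {..<d'} {..<d} h"
    using ihom_supported[OF f] ihom_supported[OF h] by simp_all
  have dd: "d' = d"
    using card_le_of_left_inverse[OF _ _ sf fh] card_le_of_left_inverse[OF _ _ sh hf] by simp
  let ?P = "mat d d (\<lambda>(i, j). h i j)"
  have "?P * mat d d (\<lambda>(i, j). f i j) = 1\<^sub>m d" "mat d d (\<lambda>(i, j). f i j) * ?P = 1\<^sub>m d"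
    using fh hf by (simp_all add: mat_mm[symmetric] dd mat_idm)
  then have "invertible_mat ?P" unfolding invertible_mat_def inverts_mat_def by auto
  moreover have "?P * \<sigma> g = \<sigma>' g * ?P" if g: "g \<in> G" for g
  proof -
    have "mat d d (\<lambda>(i, j). mm {..<d} h (snd (jrep d \<sigma>) g) i j) = mat d d (\<lambda>(i, j). mm {..<d'} (snd (jrep d' \<sigma>') g) h i j)"
      using ihomD[OF h g] dd by (intro eq_matI) auto
    then show ?thesis
      using car(1)[OF g] car(2)[OF g] dd by (simp add: mat_mm mat_jrep)
  qed
  ultimately show ?thesis unfolding rep_iso_def dd by (intro conjI bexI[of _ ?P] ballI) (simp_all only: mat_carrier)
qed

lemma kron_carrier:
  assumes "A \<in> carrier_mat a a" "B \<in> carrier_mat b b"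
  shows "kron A B \<in> carrier_mat (a * b) (a * b)"
  using assms by (auto simp: kron_def)

lemma tensor_pow_carrier:
  assumes "\<rho> g \<in> carrier_mat d d" "n \<ge> 1"
  shows "tensor_pow \<rho> n g \<in> carrier_mat (d ^ n) (d ^ n)"
  using assms(2)
proof (induction n rule: nat_induct_at_least)
  case base then show ?case using assms by simp
next
  case (Suc n)
  then obtain m where "n = Suc m" by (cases n) auto
  then show ?case using kron_carrier[OF Suc(2) assms(1)] by (simp add: mult.commute)
qed

lemma bij_betw_div_mod:
  assumes "(d::nat) > 0"
  shows "bij_betw (\<lambda>i. (i div d, i mod d)) {..<m * d} ({..<m} \<times> {..<d})"
proof (rule bij_betw_byWitness[where f' = "\<lambda>(a, b). a * d + b"])
  show "(\<lambda>(a, b). a * d + b) ` ({..<m} \<times> {..<d}) \<subseteq> {..<m * d}"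
  proof clarsimp
    fix a b assume "a < m" "b < d"
    then have "a * d + b < Suc a * d" "Suc a * d \<le> m * d" by (simp, intro mult_le_mono1, simp)
    then show "a * d + b < m * d" by linarith
  qed
qed (use assms in \<open>auto simp: less_mult_imp_div_less\<close>)

text \<open>The Kronecker product gives the pair (a, b) the number a d + b, so quotient and
  remainder by d recover the basis of the tensor product.\<close>

lemma tensor_pow_inadd_tens:
  assumes car: "\<And>g. g \<in> G \<Longrightarrow> \<rho> g \<in> carrier_mat d d" and n: "n \<ge> 1" and "d > 0"
  shows "inadd G (jrep (d ^ Suc n) (tensor_pow \<rho> (Suc n))) {tens (jrep (d ^ n) (tensor_pow \<rho> n)) (jrep d \<rho>)}"
proof (rule inadd_reindex[where \<pi> = "\<lambda>i. (i div d, i mod d)"])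
  show "bij_betw (\<lambda>i. (i div d, i mod d)) (fst (jrep (d ^ Suc n) (tensor_pow \<rho> (Suc n))))
     (fst (tens (jrep (d ^ n) (tensor_pow \<rho> n)) (jrep d \<rho>)))"
    using bij_betw_div_mod[OF \<open>d > 0\<close>, of "d ^ n"] by (simp add: mult.commute)
  fix g i i' assume g: "g \<in> G" and i: "i \<in> fst (jrep (d ^ Suc n) (tensor_pow \<rho> (Suc n)))"
    and i': "i' \<in> fst (jrep (d ^ Suc n) (tensor_pow \<rho> (Suc n)))"
  obtain m where "n = Suc m" using n by (cases n) auto
  then show "snd (jrep (d ^ Suc n) (tensor_pow \<rho> (Suc n))) g i i'
     = snd (tens (jrep (d ^ n) (tensor_pow \<rho> n)) (jrep d \<rho>)) g (i div d, i mod d) (i' div d, i' mod d)"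
    using i i' car[OF g] tensor_pow_carrier[of \<rho> g d n] n g
    by (simp add: tens_def kron_def mult.commute)
qed auto

section \<open>Descent along an extension of fields\<close>

lemma (in field_hom) vector_space_hom: "Vector_Spaces.vector_space (\<lambda>c x. hom c * x)"
  by unfold_locales (simp_all add: algebra_simps hom_add hom_mult)

context field_hom begin

interpretation ext: Vector_Spaces.vector_space "\<lambda>c x. hom c * x"
  by (rule vector_space_hom)

text \<open>Linearity is over the small field, which acts on the large one through
  \<open>hom\<close>. Applied entrywise, such maps bring matrices over the extension down to the
  small field.\<close>

definition lin_functional :: "('b \<Rightarrow> 'a) \<Rightarrow> bool" where
  "lin_functional u \<longleftrightarrow> (\<forall>x y. u (x + y) = u x + u y) \<and> (\<forall>c x. u (hom c * x) = c * u x)"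

lemma lin_functional_add: "lin_functional u \<Longrightarrow> u (x + y) = u x + u y"
  and lin_functional_scale: "lin_functional u \<Longrightarrow> u (hom c * x) = c * u x"
  by (simp_all add: lin_functional_def)

lemma lin_functional_scale': "lin_functional u \<Longrightarrow> u (x * hom c) = u x * c"
  using lin_functional_scale[of u c x] by (simp add: mult.commute)

lemma lin_functional_zero: "lin_functional u \<Longrightarrow> u 0 = 0"
  using lin_functional_scale[of u 0 0] by simp

lemma lin_functional_sum: "lin_functional u \<Longrightarrow> u (\<Sum>x\<in>S. F x) = (\<Sum>x\<in>S. u (F x))"
  by (induction S rule: infinite_finite_induct) (simp_all add: lin_functional_zero lin_functional_add)

lemma lin_functional_mult_right: "lin_functional u \<Longrightarrow> lin_functional (\<lambda>x. u (x * b))"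
  by (simp add: lin_functional_def distrib_right mult.assoc)

text \<open>Coordinates in a basis of the extension that is chosen to contain 1, so that the
  coordinate at 1 retracts the embedding. The expansion is stated over any finite set containing the
  support, because one set has to serve all entries of a matrix at once.\<close>

lemma basis_expansion:
  "\<exists>coord. (\<forall>v. lin_functional (coord v)) \<and> (\<forall>x. finite {v. coord v x \<noteq> 0}) \<and>
     (\<forall>x S. finite S \<longrightarrow> {v. coord v x \<noteq> 0} \<subseteq> S \<longrightarrow> x = (\<Sum>v\<in>S. hom (coord v x) * v)) \<and> coord 1 1 = 1"
proof -
  have i1: "ext.independent {1}" by (simp add: ext.dependent_single)
  define B where "B = ext.extend_basis {1}"
  have B: "ext.independent B" "ext.span B = UNIV" "1 \<in> B"
    using ext.independent_extend_basis[OF i1] ext.span_extend_basis[OF i1] ext.extend_basis_superset[OF i1]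
    by (auto simp: B_def)
  define coord where "coord = (\<lambda>v x. ext.representation B x v)"
  have 1: "lin_functional (coord v)" for v
    unfolding lin_functional_def coord_def
    using ext.representation_add[OF B(1)] ext.representation_scale[OF B(1)] B(2) by auto
  have 2: "finite {v. coord v x \<noteq> 0}" for x
    unfolding coord_def by (rule ext.finite_representation)
  have 3: "x = (\<Sum>v\<in>S. hom (coord v x) * v)" if "finite S" "{v. coord v x \<noteq> 0} \<subseteq> S" for x S
  proof -
    have "(\<Sum>v\<in>S. hom (coord v x) * v) = (\<Sum>v\<in>{v. coord v x \<noteq> 0}. hom (coord v x) * v)"
      using that by (intro sum.mono_neutral_right) auto
    also have "\<dots> = x"
      unfolding coord_def by (rule ext.sum_nonzero_representation_eq[OF B(1)]) (simp add: B(2))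
    finally show ?thesis by simp
  qed
  have "coord 1 1 = 1"
    unfolding coord_def using ext.representation_basis[OF B(1,3)] by simp
  then show ?thesis using 1 2 3 by (intro exI[of _ coord] conjI allI impI)
qed

text \<open>The action matrices have entries in the small field, so a functional that is linear over
  it passes through both sides of the intertwining equation.\<close>

lemma ihom_descend:
  assumes l: "lin_functional u" and f: "ihom G (base_change hom A) (base_change hom B) f"
  shows "ihom G A B (\<lambda>i j. u (f i j))"
  unfolding ihom_def
proof (intro conjI ballI)
  show "supported (fst B) (fst A) (\<lambda>i j. u (f i j))"
  proof -
    have "f i j \<noteq> 0" if "u (f i j) \<noteq> 0" for i j using that lin_functional_zero[OF l] by metis
    then show ?thesis using ihom_supported[OF f] unfolding supported_def fst_base_change by blast
  qed
  fix g j i assume "g \<in> G" "j \<in> fst B" "i \<in> fst A"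
  then have "u (\<Sum>k\<in>fst A. f j k * hom (snd A g k i)) = u (\<Sum>k\<in>fst B. hom (snd B g j k) * f k i)"
    using ihomD[OF f, of g j i] by (simp add: mm_def)
  then show "mm (fst A) (\<lambda>i j. u (f i j)) (snd A g) j i = mm (fst B) (snd B g) (\<lambda>i j. u (f i j)) j i"
    by (simp add: mm_def lin_functional_sum[OF l] lin_functional_scale[OF l] lin_functional_scale'[OF l])
qed

text \<open>Expand the second factor in a basis of the extension; a linear functional applied to
  \<open>f h\<close> then becomes a sum of composites over the small field.\<close>

lemma fac_descend:
  assumes "fac G (base_change hom A) \<C> \<phi>" and C: "\<C> \<subseteq> base_change hom ` \<B>" and l: "lin_functional u"
    and fin: "finite (fst A)" "\<And>B. B \<in> \<B> \<Longrightarrow> finite (fst B)"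
  shows "fac G A \<B> (\<lambda>i j. u (\<phi> i j))"
  using assms(1)
proof (induction rule: fac.induct)
  case fac_zero
  show ?case using fac.fac_zero lin_functional_zero[OF l] by simp
next
  case (fac_step D f h \<phi>)
  obtain B where B: "B \<in> \<B>" "D = base_change hom B" using fac_step C by auto
  obtain coord :: "'b \<Rightarrow> 'b \<Rightarrow> 'a" where coord:
    "\<forall>v. lin_functional (coord v)" "\<forall>x. finite {v. coord v x \<noteq> 0}"
    "\<forall>x S. finite S \<longrightarrow> {v. coord v x \<noteq> 0} \<subseteq> S \<longrightarrow> x = (\<Sum>v\<in>S. hom (coord v x) * v)" "coord 1 1 = 1"
    using basis_expansion by (elim exE conjE) (rule that)
  note coord = coord[rule_format]
  define S where "S = (\<Union>j\<in>fst B. \<Union>i\<in>fst A. {v. coord v (h j i) \<noteq> 0})"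
  have S: "finite S" unfolding S_def using fin B coord(2) by auto
  have sh: "supported (fst B) (fst A) h" using ihom_supported[OF fac_step(3)] B by simp
  have ex: "h j i = (\<Sum>v\<in>S. hom (coord v (h j i)) * v)" for j i
  proof (cases "j \<in> fst B \<and> i \<in> fst A")
    case True
    then show ?thesis by (intro coord(3)[OF S]) (auto simp: S_def)
  next
    case False
    then have "h j i = 0" using supported_outside[OF sh] by blast
    then show ?thesis using lin_functional_zero[OF coord(1)] by simp
  qed
  have "u (mm (fst B) f h i l) = (\<Sum>v\<in>S. mm (fst B) (\<lambda>i j. u (f i j * v)) (\<lambda>j l. coord v (h j l)) i l)" for i l
  proof -
    have "u (f i j * h j l) = (\<Sum>v\<in>S. u (f i j * v) * coord v (h j l))" for j
    proof -
      have "f i j * h j l = f i j * (\<Sum>v\<in>S. hom (coord v (h j l)) * v)"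
        by (rule arg_cong[OF ex])
      also have "\<dots> = (\<Sum>v\<in>S. hom (coord v (h j l)) * (f i j * v))"
        by (simp add: sum_distrib_left mult.left_commute)
      finally have "u (f i j * h j l) = u (\<Sum>v\<in>S. hom (coord v (h j l)) * (f i j * v))"
        by (rule arg_cong)
      also have "\<dots> = (\<Sum>v\<in>S. coord v (h j l) * u (f i j * v))"
        by (simp only: lin_functional_sum[OF l] lin_functional_scale[OF l])
      finally show ?thesis by (simp add: mult.commute)
    qed
    then show ?thesis unfolding mm_def lin_functional_sum[OF l] by (subst sum.swap) simp
  qed
  then have eq: "(\<lambda>i j. u (\<phi> i j + mm (fst D) f h i j))
      = (\<lambda>i j. u (\<phi> i j) + (\<Sum>v\<in>S. mm (fst B) (\<lambda>i j. u (f i j * v)) (\<lambda>j l. coord v (h j l)) i j))"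
    by (simp add: B lin_functional_add[OF l])
  have "fac G A \<B> (\<lambda>i j. \<Sum>v\<in>S. mm (fst B) (\<lambda>i j. u (f i j * v)) (\<lambda>j l. coord v (h j l)) i j)"
    by (intro fac_sum fac_one[OF B(1)] ihom_descend[OF lin_functional_mult_right[OF l]] ihom_descend[OF coord(1)])
       (use fac_step B in simp_all)
  from fac_add[OF this fac_step(5)] show ?case unfolding eq .
qed

text \<open>A form of the Noether-Deuring theorem: a functional with value 1 at 1 takes the identity
  over the extension to the identity over the small field, and sums of composites through base
  changes to sums of composites through the original objects.\<close>

lemma inadd_descend:
  assumes "inadd G (base_change hom A) (base_change hom ` \<B>)"
    and fin: "finite (fst A)" "\<And>B. B \<in> \<B> \<Longrightarrow> finite (fst B)"
  shows "inadd G A \<B>"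
proof -
  obtain coord :: "'b \<Rightarrow> 'b \<Rightarrow> 'a" where coord:
    "\<forall>v. lin_functional (coord v)" "\<forall>x. finite {v. coord v x \<noteq> 0}"
    "\<forall>x S. finite S \<longrightarrow> {v. coord v x \<noteq> 0} \<subseteq> S \<longrightarrow> x = (\<Sum>v\<in>S. hom (coord v x) * v)" "coord 1 1 = 1"
    using basis_expansion by (elim exE conjE) (rule that)
  note coord = coord[rule_format]
  define u where "u = coord 1"
  have l: "lin_functional u" "u 1 = 1" using coord(1,4) by (simp_all add: u_def)
  have "(\<lambda>i j. u (idm (fst (base_change hom A)) i j)) = idm (fst A)"
    using l(2) lin_functional_zero[OF l(1)] by (auto simp: idm_def fun_eq_iff)
  moreover have "fac G A \<B> (\<lambda>i j. u (idm (fst (base_change hom A)) i j))"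
    by (rule fac_descend[OF assms(1)[unfolded inadd_def] subset_refl l(1)]) (use fin in auto)
  ultimately show ?thesis by (simp add: inadd_def)
qed

lemma ihom_base_change: "ihom G A B f \<Longrightarrow> ihom G (base_change hom A) (base_change hom B) (\<lambda>i j. hom (f i j))"
  by (auto simp: ihom_def supported_def mm_def hom_mult[symmetric] hom_sum[symmetric])

lemma fac_base_change:
  "fac G A \<B> \<phi> \<Longrightarrow> fac G (base_change hom A) (base_change hom ` \<B>) (\<lambda>i j. hom (\<phi> i j))"
proof (induction rule: fac.induct)
  case (fac_step B f h \<phi>)
  have "(\<lambda>i j. hom (mm (fst B) f h i j)) = mm (fst (base_change hom B)) (\<lambda>i j. hom (f i j)) (\<lambda>i j. hom (h i j))"
    by (simp add: mm_def hom_mult hom_sum)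
  moreover have "fac G (base_change hom A) (base_change hom ` \<B>)
     (mm (fst (base_change hom B)) (\<lambda>i j. hom (f i j)) (\<lambda>i j. hom (h i j)))"
    using fac_step by (intro fac_one ihom_base_change) auto
  ultimately show ?case using fac_add[OF _ fac_step(5)] by (simp add: hom_add)
qed (simp add: fac_zero)

lemma inadd_base_change: "inadd G A \<B> \<Longrightarrow> inadd G (base_change hom A) (base_change hom ` \<B>)"
proof -
  assume "inadd G A \<B>"
  moreover have "(\<lambda>i j. hom (idm (fst A) i j)) = idm (fst (base_change hom A))"
    by (auto simp: idm_def fun_eq_iff)
  ultimately show ?thesis using fac_base_change[of G A \<B> "idm (fst A)"] by (simp add: inadd_def)
qed

end

section \<open>From a finite cover over the extension to finitely many indecomposables\<close>

lemma inadd_reindex_nat: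
  fixes A :: "('g, 'i, 'k::field) irep"
  assumes fin: "finite (fst A)"
  obtains B :: "('g, nat, 'k) irep" where "fst B = {..<card (fst A)}" "inadd G A {B}"
proof -
  obtain \<pi> where \<pi>: "bij_betw \<pi> (fst A) {..<card (fst A)}"
    using ex_bij_betw_finite_nat[OF fin] by (auto simp: atLeast0LessThan)
  let ?B = "({..<card (fst A)}, \<lambda>g i j. snd A g (inv_into (fst A) \<pi> i) (inv_into (fst A) \<pi> j))"
  have "inadd G A {?B}"
    by (rule inadd_reindex[where \<pi> = \<pi> and B = ?B])
       (use \<pi> fin in \<open>simp_all add: bij_betw_def inv_into_f_f\<close>)
  then show ?thesis using that[of ?B] by simp
qed

lemma conn_decomposition':
  fixes A :: "('g, nat, 'k::field) irep"
  assumes "fst A = {..<d}"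
  shows "\<exists>\<X> :: ('g, nat, 'k) irep set. finite \<X> \<and> inadd G A \<X> \<and> (\<forall>B\<in>\<X>. conn G B) \<and> (\<forall>B\<in>\<X>. inadd G B {A})"
proof -
  obtain \<X> where X: "finite \<X> \<and> inadd G A \<X> \<and> (\<forall>B\<in>\<X>. conn G B \<and> (\<exists>m. fst B = {..<m::nat}) \<and> inadd G B {A})"
    using conn_decomposition[OF assms, of G] by (elim exE) (rule that)
  show ?thesis
  proof (intro exI[of _ \<X>] conjI ballI)
    fix B assume "B \<in> \<X>"
    with X have "conn G B \<and> (\<exists>m. fst B = {..<m::nat}) \<and> inadd G B {A}" by (elim conjE) (rule bspec)
    then show "conn G B" "inadd G B {A}" by simp_all
  qed (rule X[THEN conjunct1], rule X[THEN conjunct2, THEN conjunct1])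
qed

lemma finite_conn_cover:
  fixes \<E> :: "('g, 'i, 'k::field) irep set"
  assumes "finite \<E>" "\<And>E. E \<in> \<E> \<Longrightarrow> finite (fst E)"
  shows "\<exists>\<X> :: ('g, nat, 'k) irep set. finite \<X> \<and> (\<forall>E\<in>\<E>. inadd G E \<X>) \<and> (\<forall>B\<in>\<X>. conn G B)"
  using assms
proof (induction rule: finite_induct)
  case empty
  then show ?case by (intro exI[of _ "{}"]) simp
next
  case (insert E \<E>)
  then obtain \<X> :: "('g, nat, 'k) irep set" where X: "finite \<X>" "\<forall>E\<in>\<E>. inadd G E \<X>" "\<forall>B\<in>\<X>. conn G B" by auto
  have "finite (fst E)" using insert by simp
  then obtain B :: "('g, nat, 'k) irep" where B: "fst B = {..<card (fst E)}" "inadd G E {B}"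
    by (rule inadd_reindex_nat)
  obtain \<Y> :: "('g, nat, 'k) irep set" where Y: "finite \<Y>" "inadd G B \<Y>" "\<forall>D\<in>\<Y>. conn G D"
    using conn_decomposition'[OF B(1), of G] by (elim exE conjE) (rule that)
  have "inadd G E \<Y>" by (rule inadd_trans[OF B(2)]) (simp add: Y(2) B(1))
  then have "inadd G E (\<X> \<union> \<Y>)" by (rule inadd_mono) simp
  moreover have "\<forall>F\<in>\<E>. inadd G F (\<X> \<union> \<Y>)"
  proof (rule ballI)
    fix F assume "F \<in> \<E>"
    with X(2) have "inadd G F \<X>" by (rule bspec)
    then show "inadd G F (\<X> \<union> \<Y>)" by (rule inadd_mono) simp
  qed
  ultimately have "\<forall>F\<in>insert E \<E>. inadd G F (\<X> \<union> \<Y>)" unfolding ball_simps by (rule conjI)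
  moreover have "\<forall>B\<in>\<X> \<union> \<Y>. conn G B" unfolding ball_Un using X(3) Y(3) by (rule conjI)
  ultimately show ?case using X(1) Y(1) by (intro exI[of _ "\<X> \<union> \<Y>"] conjI finite_UnI)
qed

lemma finite_choice_of_representatives:
  assumes "finite (f ` N)" "\<And>x y. x \<in> N \<Longrightarrow> y \<in> N \<Longrightarrow> f x = f y \<Longrightarrow> R x y"
  obtains S where "finite S" "\<And>x. x \<in> N \<Longrightarrow> \<exists>y\<in>S. R x y"
proof
  let ?S = "(\<lambda>J. SOME y. y \<in> N \<and> f y = J) ` f ` N"
  show "finite ?S" using assms(1) by simp
  fix x assume x: "x \<in> N"
  have "(SOME y. y \<in> N \<and> f y = f x) \<in> N \<and> f (SOME y. y \<in> N \<and> f y = f x) = f x"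
    by (rule someI[of "\<lambda>y. y \<in> N \<and> f y = f x" x]) (simp add: x)
  then have "R x (SOME y. y \<in> N \<and> f y = f x)" using assms(2)[OF x] by simp
  then show "\<exists>y\<in>?S. R x y" using x by (intro bexI[of _ "SOME y. y \<in> N \<and> f y = f x"] imageI)
qed

text \<open>An indecomposable summand over the small field is determined by the set of those
  indecomposables over the extension that occur in its base change.\<close>

theorem algebraic_of_finite_cover:
  fixes \<rho> :: "'g \<Rightarrow> 'k::field mat" and \<iota> :: "'k \<Rightarrow> 'l::field" and \<E> :: "('g, 'i, 'l) irep set"
  assumes hom: "field_hom \<iota>" and rep: "is_rep G mul e d \<rho>"
    and E: "finite \<E>" "\<And>E. E \<in> \<E> \<Longrightarrow> finite (fst E)"
    and cover: "\<And>n. n \<ge> 1 \<Longrightarrow> inadd G (base_change \<iota> (jrep (d ^ n) (tensor_pow \<rho> n))) \<E>"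
  shows "algebraic G mul e d \<rho>"
proof -
  interpret \<iota>: field_hom \<iota> by (rule hom)
  have "\<exists>\<X> :: ('g, nat, 'l) irep set. finite \<X> \<and> (\<forall>E\<in>\<E>. inadd G E \<X>) \<and> (\<forall>B\<in>\<X>. conn G B)"
    by (rule finite_conn_cover[OF E(1)]) (rule E(2))
  then obtain \<X> :: "('g, nat, 'l) irep set" where X: "finite \<X>" "\<forall>E\<in>\<E>. inadd G E \<X>" "\<forall>B\<in>\<X>. conn G B"
    by (elim exE conjE) (rule that)
  have Xfin: "finite (fst B)" if "B \<in> \<X>" for B using X(3) that by (simp add: conn_def)
  define rp where "rp = (\<lambda>x :: nat \<times> ('g \<Rightarrow> 'k mat). jrep (fst x) (snd x))"
  \<comment> \<open>Since \<X> is finite there are only finitely many such sets, and the set will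
    turn out to determine the isomorphism class of x.\<close>
  define supp where "supp = (\<lambda>x. {B \<in> \<X>. inadd G B {base_change \<iota> (rp x)}})"
  define N where "N = {x :: nat \<times> ('g \<Rightarrow> 'k mat). indecomposable G mul e (fst x) (snd x) \<and>
     (\<exists>n\<ge>1. direct_summand G mul e (fst x) (snd x) (d ^ n) (tensor_pow \<rho> n))}"
  have car: "\<rho> g \<in> carrier_mat d d" if "g \<in> G" for g using rep that by (simp add: is_rep_def)
  have carx: "snd x g \<in> carrier_mat (fst x) (fst x)" if "x \<in> N" "g \<in> G" for x g
    using that by (auto simp: N_def indecomposable_def is_rep_def)
  have conn: "conn G (rp x)" if "x \<in> N" for x
    using that indecomposable_conn by (auto simp: N_def rp_def)
  have in_supp: "inadd G (base_change \<iota> (rp x)) (supp x)" if x: "x \<in> N" for x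
  proof -
    obtain n where n: "n \<ge> 1" "direct_summand G mul e (fst x) (snd x) (d ^ n) (tensor_pow \<rho> n)"
      and rx: "is_rep G mul e (fst x) (snd x)" using x by (auto simp: N_def indecomposable_def)
    let ?T = "jrep (d ^ n) (tensor_pow \<rho> n)"
    have "inadd G (rp x) {?T}" unfolding rp_def
      by (rule direct_summand_inadd[OF n(2) rx]) (intro tensor_pow_carrier car n(1))
    then have "inadd G (base_change \<iota> (rp x)) {base_change \<iota> ?T}"
      using \<iota>.inadd_base_change[of G "rp x" "{?T}"] by simp
    then have "inadd G (base_change \<iota> (rp x)) \<E>"
      by (rule inadd_trans) (use cover[OF n(1)] in simp)
    then have xX: "inadd G (base_change \<iota> (rp x)) \<X>"
      by (rule inadd_trans) (intro conjI bspec[OF X(2)] E(2))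
    have "fst (base_change \<iota> (rp x)) = {..<fst x}" by (simp add: rp_def)
    from conn_decomposition'[OF this, of G]
    obtain \<Y> :: "('g, nat, 'l) irep set" where Y: "inadd G (base_change \<iota> (rp x)) \<Y>" "\<forall>B\<in>\<Y>. conn G B" "\<forall>B\<in>\<Y>. inadd G B {base_change \<iota> (rp x)}"
      by (elim exE conjE) (rule that)
    \<comment> \<open>Every component B of the base change is isomorphic to some D in \<X>. Through
      this isomorphism D is a summand of the base change, so D belongs to \<open>supp x\<close> and
      the identity of B factors through it.\<close>
    show ?thesis
    proof (rule inadd_trans[OF Y(1)])
      fix B assume BY: "B \<in> \<Y>"
      have B: "conn G B" "inadd G B {base_change \<iota> (rp x)}"
        by (rule bspec[OF Y(2) BY], rule bspec[OF Y(3) BY])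
      have "inadd G B \<X>" by (rule inadd_trans[OF B(2)]) (use xX in \<open>simp add: rp_def\<close>)
      have "\<exists>D\<in>\<X>. \<exists>f h. ihom G D B f \<and> ihom G B D h \<and> mm (fst D) f h = idm (fst B) \<and> mm (fst B) h f = idm (fst D)"
        by (rule conn_inadd_iso[OF B(1) \<open>inadd G B \<X>\<close>]) (rule bspec[OF X(3)])
      then obtain D f h where D: "D \<in> \<X>" "ihom G D B f" "ihom G B D h"
        "mm (fst D) f h = idm (fst B)" "mm (fst B) h f = idm (fst D)"
        by (elim bexE exE conjE) (rule that)
      have "inadd G D {B}" by (rule inadd_retract[OF _ D(3,2,5)]) simp
      then have "inadd G D {base_change \<iota> (rp x)}"
        by (rule inadd_trans) (use B in \<open>simp add: conn_def\<close>)
      then have "D \<in> supp x" using D(1) by (simp add: supp_def)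
      then have "inadd G B (supp x)" by (rule inadd_retract[OF _ D(2-4)])
      then show "inadd G B (supp x) \<and> finite (fst B)" using B(1) by (simp add: conn_def)
    qed
  qed
  \<comment> \<open>Equal supports put the base change of x into the additive closure of that of y.
    This descends to the small field, where both modules are connected, so the factorisation is an
    isomorphism.\<close>
  have iso: "rep_iso G (fst x) (snd x) (fst y) (snd y)" if x: "x \<in> N" and y: "y \<in> N" and eq: "supp x = supp y" for x y
  proof -
    have "inadd G (base_change \<iota> (rp x)) {base_change \<iota> (rp y)}"
    proof (rule inadd_trans[OF in_supp[OF x]])
      fix B assume "B \<in> supp x"
      then have "B \<in> supp y" by (simp only: eq)
      then show "inadd G B {base_change \<iota> (rp y)} \<and> finite (fst B)" using Xfin by (simp add: supp_def)
    qed
    then have "inadd G (rp x) {rp y}"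
      by (intro \<iota>.inadd_descend) (simp_all add: rp_def)
    then have "\<exists>B\<in>{rp y}. \<exists>f h. ihom G B (rp x) f \<and> ihom G (rp x) B h \<and>
        mm (fst B) f h = idm (fst (rp x)) \<and> mm (fst (rp x)) h f = idm (fst B)"
      by (rule conn_inadd_iso[OF conn[OF x]]) (simp add: conn[OF y])
    then obtain f h where "ihom G (rp y) (rp x) f" "ihom G (rp x) (rp y) h"
      "mm (fst (rp y)) f h = idm (fst (rp x))" "mm (fst (rp x)) h f = idm (fst (rp y))"
      unfolding bex_simps by (elim exE conjE disjE FalseE) (rule that)
    then show ?thesis
      by (intro rep_iso_of_inverse_homs[of G _ _ _ _ f h]) (use carx x y in \<open>simp_all add: rp_def\<close>)
  qed
  have "finite (supp ` N)" by (rule finite_subset[of _ "Pow \<X>"]) (auto simp: supp_def X(1))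
  then obtain S where S: "finite S" "\<And>x. x \<in> N \<Longrightarrow> \<exists>y\<in>S. rep_iso G (fst x) (snd x) (fst y) (snd y)"
    by (rule finite_choice_of_representatives[of supp N "\<lambda>x y. rep_iso G (fst x) (snd x) (fst y) (snd y)"])
       (use iso in blast)+
  show ?thesis unfolding algebraic_def
  proof (intro exI[of _ S] conjI allI impI)
    fix n :: nat and d' \<sigma>
    assume "1 \<le> n" "indecomposable G mul e d' \<sigma> \<and> direct_summand G mul e d' \<sigma> (d ^ n) (tensor_pow \<rho> n)"
    then have "(d', \<sigma>) \<in> N" by (auto simp: N_def)
    then show "\<exists>(d'', \<sigma>')\<in>S. rep_iso G d' \<sigma> d'' \<sigma>'" using S(2)[of "(d', \<sigma>)"] by (simp add: case_prod_unfold)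
  qed (rule S(1))
qed

section \<open>Tensor products of two-dimensional modules, as functions on words\<close>

definition words :: "nat set \<Rightarrow> (nat \<Rightarrow> bool) set" where
  "words A = {w. \<forall>j. w j \<longrightarrow> j \<in> A}"

text \<open>The tensor product over the positions j in A of the two-dimensional modules
  \<open>\<tau> j\<close>. A word chooses a basis vector at each position; being false outside A,
  every basis vector is represented by exactly one function.\<close>

definition erep :: "nat set \<Rightarrow> (nat \<Rightarrow> 'g \<Rightarrow> bool \<Rightarrow> bool \<Rightarrow> 'k::field) \<Rightarrow> ('g, nat \<Rightarrow> bool, 'k) irep" where
  "erep A \<tau> = (words A, \<lambda>g v w. \<Prod>j\<in>A. \<tau> j g (v j) (w j))"

lemma fst_erep [simp]: "fst (erep A \<tau>) = words A" by (simp add: erep_def)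

lemma words_insert: "words (insert a B) = (\<lambda>(w, x). w(a := x)) ` (words B \<times> UNIV)"
proof (intro equalityI subsetI)
  fix w assume w: "w \<in> words (insert a B)"
  have "w = (\<lambda>(w, x). w(a := x)) (w(a := False), w a)" by simp
  moreover have "w(a := False) \<in> words B" using w by (auto simp: words_def)
  ultimately show "w \<in> (\<lambda>(w, x). w(a := x)) ` (words B \<times> UNIV)" by blast
qed (auto simp: words_def split: if_splits)

lemma sum_words_insert:
  assumes "a \<notin> B"
  shows "(\<Sum>w\<in>words (insert a B). F w) = (\<Sum>w\<in>words B. F (w(a := False)) + F (w(a := True)))"
proof -
  have inj: "inj_on (\<lambda>(w, x). w(a := x)) (words B \<times> UNIV)"
  proof (rule inj_onI, clarsimp)
    fix w x w' x' assume w: "w \<in> words B" "w' \<in> words B" and eq: "w(a := x) = w'(a := x')"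
    have "\<not> w a" "\<not> w' a" using w assms by (auto simp: words_def)
    moreover have "w j = w' j" if "j \<noteq> a" for j using fun_cong[OF eq, of j] that by simp
    ultimately have "w = w'" by (intro ext) (metis (full_types))
    moreover have "x = x'" using fun_cong[OF eq, of a] by simp
    ultimately show "w = w' \<and> x = x'" by simp
  qed
  have "(\<Sum>w\<in>words (insert a B). F w) = (\<Sum>w\<in>words B. \<Sum>x\<in>UNIV. F (w(a := x)))"
    unfolding words_insert sum.reindex[OF inj]
    by (simp add: sum.cartesian_product case_prod_unfold comp_def)
  then show ?thesis by (simp add: UNIV_bool)
qed

lemma finite_words [simp]: "finite A \<Longrightarrow> finite (words A)"
proof (induction A rule: finite_induct)
  case (insert a A)
  then show ?case unfolding words_insert by simp
next
  case empty
  have "words {} = {\<lambda>_. False}" by (auto simp: words_def)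
  then show ?case by simp
qed

text \<open>Vectors of the tensor product over A are functions on all words that ignore the
  positions outside A. One type thus serves every A, and operators that insert or remove positions
  act without transport between domains.\<close>

definition depends_on :: "nat set \<Rightarrow> ((nat \<Rightarrow> bool) \<Rightarrow> 'k) \<Rightarrow> bool" where
  "depends_on A \<phi> \<longleftrightarrow> (\<forall>w w'. (\<forall>j\<in>A. w j = w' j) \<longrightarrow> \<phi> w = \<phi> w')"

lemma depends_onD: "depends_on A \<phi> \<Longrightarrow> (\<And>j. j \<in> A \<Longrightarrow> w j = w' j) \<Longrightarrow> \<phi> w = \<phi> w'"
  unfolding depends_on_def by blast

lemma depends_onI: "(\<And>w w'. (\<And>j. j \<in> A \<Longrightarrow> w j = w' j) \<Longrightarrow> \<phi> w = \<phi> w') \<Longrightarrow> depends_on A \<phi>"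
  unfolding depends_on_def by blast

lemma depends_on_compose2:
  assumes "depends_on A \<phi>" "depends_on A \<psi>"
  shows "depends_on A (\<lambda>w. f (\<phi> w) (\<psi> w))"
proof (rule depends_onI)
  fix w w' :: "nat \<Rightarrow> bool" assume e: "\<And>j. j \<in> A \<Longrightarrow> w j = w' j"
  have "\<phi> w = \<phi> w'" by (rule depends_onD[OF assms(1) e])
  moreover have "\<psi> w = \<psi> w'" by (rule depends_onD[OF assms(2) e])
  ultimately show "f (\<phi> w) (\<psi> w) = f (\<phi> w') (\<psi> w')" by simp
qed

definition point :: "nat set \<Rightarrow> (nat \<Rightarrow> bool) \<Rightarrow> (nat \<Rightarrow> bool) \<Rightarrow> 'k::field" where
  "point A w u = (if \<forall>j\<in>A. u j = w j then 1 else 0)"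

lemma depends_on_point [simp]: "depends_on A (point A w)"
  by (simp add: depends_on_def point_def)

lemma restrict_in_words [simp]: "(\<lambda>j. j \<in> A \<and> u j) \<in> words A"
  by (simp add: words_def)

lemma agree_on_iff:
  assumes "w \<in> words A"
  shows "(\<forall>j\<in>A. u j = w j) \<longleftrightarrow> w = (\<lambda>j. j \<in> A \<and> u j)"
proof
  assume h: "\<forall>j\<in>A. u j = w j"
  show "w = (\<lambda>j. j \<in> A \<and> u j)"
  proof
    fix j show "w j = (j \<in> A \<and> u j)"
      using bspec[OF h, of j] assms unfolding words_def by blast
  qed
next
  assume "w = (\<lambda>j. j \<in> A \<and> u j)"
  then show "\<forall>j\<in>A. u j = w j" by simp
qed

lemma depends_on_expand:
  fixes \<phi> :: "(nat \<Rightarrow> bool) \<Rightarrow> 'k::field"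
  assumes "finite A" "depends_on A \<phi>"
  shows "\<phi> u = (\<Sum>w\<in>words A. \<phi> w * point A w u)"
proof -
  let ?u = "\<lambda>j. j \<in> A \<and> u j"
  have "(\<Sum>w\<in>words A. \<phi> w * point A w u) = (\<Sum>w\<in>words A. if w = ?u then \<phi> ?u else 0)"
    by (intro sum.cong refl) (simp add: point_def agree_on_iff)
  also have "\<dots> = \<phi> ?u" using assms(1) by simp
  also have "\<dots> = \<phi> u" by (rule depends_onD[OF assms(2)]) simp
  finally show ?thesis by simp
qed

definition op_linear :: "(((nat \<Rightarrow> bool) \<Rightarrow> 'k::field) \<Rightarrow> (nat \<Rightarrow> bool) \<Rightarrow> 'k) \<Rightarrow> bool" where
  "op_linear T \<longleftrightarrow> (\<forall>\<phi> \<psi>. T (\<lambda>w. \<phi> w + \<psi> w) = (\<lambda>w. T \<phi> w + T \<psi> w)) \<and> (\<forall>c \<phi>. T (\<lambda>w. c * \<phi> w) = (\<lambda>w. c * T \<phi> w))"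

lemma op_linear_add: "op_linear T \<Longrightarrow> T (\<lambda>w. \<phi> w + \<psi> w) = (\<lambda>w. T \<phi> w + T \<psi> w)"
  and op_linear_scale: "op_linear T \<Longrightarrow> T (\<lambda>w. c * \<phi> w) = (\<lambda>w. c * T \<phi> w)"
  by (simp_all add: op_linear_def)

lemma op_linearI:
  "(\<And>\<phi> \<psi>. T (\<lambda>w. \<phi> w + \<psi> w) = (\<lambda>w. T \<phi> w + T \<psi> w)) \<Longrightarrow> (\<And>c \<phi>. T (\<lambda>w. c * \<phi> w) = (\<lambda>w. c * T \<phi> w)) \<Longrightarrow> op_linear T"
  unfolding op_linear_def by (intro conjI allI)

lemma op_linear_zero: "op_linear T \<Longrightarrow> T (\<lambda>w. 0) = (\<lambda>w. 0)"
  using op_linear_scale[of T 0 "\<lambda>w. 0"] by simp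

lemma op_linear_sum: "op_linear T \<Longrightarrow> T (\<lambda>w. \<Sum>x\<in>S. F x w) = (\<lambda>w. \<Sum>x\<in>S. T (F x) w)"
proof (induction S rule: infinite_finite_induct)
  case (insert x S)
  show ?case using op_linear_add[OF insert.prems, of "F x"] insert by simp
qed (simp_all add: op_linear_zero)

lemma op_linear_diff:
  assumes "op_linear T" shows "T (\<lambda>w. \<phi> w - \<psi> w) = (\<lambda>w. T \<phi> w - T \<psi> w)"
  using op_linear_add[OF assms, of \<phi> "\<lambda>w. (-1) * \<psi> w"] op_linear_scale[OF assms, of "-1" \<psi>] by simp

definition act :: "nat set \<Rightarrow> (nat \<Rightarrow> 'g \<Rightarrow> bool \<Rightarrow> bool \<Rightarrow> 'k::field) \<Rightarrow> 'g \<Rightarrow> ((nat \<Rightarrow> bool) \<Rightarrow> 'k) \<Rightarrow> (nat \<Rightarrow> bool) \<Rightarrow> 'k" where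
  "act A \<tau> g \<phi> = (\<lambda>v. \<Sum>w\<in>words A. (\<Prod>j\<in>A. \<tau> j g (v j) (w j)) * \<phi> w)"

lemma depends_on_act [simp]: "depends_on A (act A \<tau> g \<phi>)"
  unfolding depends_on_def act_def by (auto intro!: sum.cong prod.cong arg_cong2[of _ _ _ _ "(*)"])

lemma op_linear_act: "op_linear (act A \<tau> g)"
  by (simp add: op_linear_def act_def fun_eq_iff algebra_simps sum.distrib sum_distrib_left)

text \<open>Equivariance is demanded for functions depending on A, as these are the ones that stand
  for vectors.\<close>

definition op_hom :: "'g set \<Rightarrow> nat set \<Rightarrow> (nat \<Rightarrow> 'g \<Rightarrow> bool \<Rightarrow> bool \<Rightarrow> 'k::field) \<Rightarrow>
    nat set \<Rightarrow> (nat \<Rightarrow> 'g \<Rightarrow> bool \<Rightarrow> bool \<Rightarrow> 'k) \<Rightarrow> (((nat \<Rightarrow> bool) \<Rightarrow> 'k) \<Rightarrow> (nat \<Rightarrow> bool) \<Rightarrow> 'k) \<Rightarrow> bool" where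
  "op_hom G A \<tau> B \<tau>' T \<longleftrightarrow> op_linear T \<and> (\<forall>\<phi>. depends_on A \<phi> \<longrightarrow> depends_on B (T \<phi>)) \<and>
     (\<forall>g\<in>G. \<forall>\<phi>. depends_on A \<phi> \<longrightarrow> T (act A \<tau> g \<phi>) = act B \<tau>' g (T \<phi>))"

lemma op_homD:
  assumes "op_hom G A \<tau> B \<tau>' T"
  shows "op_linear T" "depends_on A \<phi> \<Longrightarrow> depends_on B (T \<phi>)"
    "g \<in> G \<Longrightarrow> depends_on A \<phi> \<Longrightarrow> T (act A \<tau> g \<phi>) = act B \<tau>' g (T \<phi>)"
proof -
  note h = assms[unfolded op_hom_def]
  show "op_linear T" by (rule conjunct1[OF h])
  show "depends_on A \<phi> \<Longrightarrow> depends_on B (T \<phi>)"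
    by (rule conjunct1[OF conjunct2[OF h], rule_format])
  show "g \<in> G \<Longrightarrow> depends_on A \<phi> \<Longrightarrow> T (act A \<tau> g \<phi>) = act B \<tau>' g (T \<phi>)"
    by (rule conjunct2[OF conjunct2[OF h], rule_format])
qed

text \<open>The matrix of T in the basis of point functions; by \<open>op_mat_apply\<close> it
  reproduces T on functions depending on A.\<close>

definition op_mat :: "nat set \<Rightarrow> nat set \<Rightarrow> (((nat \<Rightarrow> bool) \<Rightarrow> 'k::field) \<Rightarrow> (nat \<Rightarrow> bool) \<Rightarrow> 'k) \<Rightarrow>
    (nat \<Rightarrow> bool) \<Rightarrow> (nat \<Rightarrow> bool) \<Rightarrow> 'k" where
  "op_mat A B T = (\<lambda>v w. if v \<in> words B \<and> w \<in> words A then T (point A w) v else 0)"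

lemma op_mat_apply:
  assumes "finite A" "op_linear T" "depends_on A \<phi>" "v \<in> words B"
  shows "(\<Sum>w\<in>words A. op_mat A B T v w * \<phi> w) = T \<phi> v"
proof -
  have "\<phi> = (\<lambda>u. \<Sum>w\<in>words A. \<phi> w * point A w u)"
    by (rule ext) (rule depends_on_expand[OF assms(1,3)])
  then have "T \<phi> v = T (\<lambda>u. \<Sum>w\<in>words A. \<phi> w * point A w u) v"
    by (rule arg_cong[of _ _ "\<lambda>f. T f v"])
  also have "\<dots> = (\<Sum>w\<in>words A. \<phi> w * T (point A w) v)"
    by (simp add: op_linear_sum[OF assms(2)] op_linear_scale[OF assms(2)])
  finally show ?thesis using assms(4) by (simp add: op_mat_def mult.commute)
qed

lemma act_point:
  fixes \<tau> :: "nat \<Rightarrow> 'g \<Rightarrow> bool \<Rightarrow> bool \<Rightarrow> 'k::field"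
  assumes "finite A" "w \<in> words A"
  shows "act A \<tau> g (point A w) = (\<lambda>v. \<Prod>j\<in>A. \<tau> j g (v j) (w j))"
proof
  fix v
  have "act A \<tau> g (point A w) v = (\<Sum>u\<in>words A. if u = w then \<Prod>j\<in>A. \<tau> j g (v j) (w j) else 0)"
    unfolding act_def
  proof (intro sum.cong refl)
    fix u assume u: "u \<in> words A"
    have "point A w u = (if u = w then 1 else 0 :: 'k)"
      using agree_on_iff[OF u, of w] agree_on_iff[OF assms(2), of w] by (simp add: point_def eq_commute)
    then show "(\<Prod>j\<in>A. \<tau> j g (v j) (u j)) * point A w u = (if u = w then \<Prod>j\<in>A. \<tau> j g (v j) (w j) else 0)"
      by simp
  qed
  then show "act A \<tau> g (point A w) v = (\<Prod>j\<in>A. \<tau> j g (v j) (w j))" using assms by simp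
qed

lemma ihom_op_mat:
  assumes fin: "finite A" "finite B" and T: "op_hom G A \<tau> B \<tau>' T"
  shows "ihom G (erep A \<tau>) (erep B \<tau>') (op_mat A B T)"
  unfolding ihom_def
proof (intro conjI ballI)
  show "supported (fst (erep B \<tau>')) (fst (erep A \<tau>)) (op_mat A B T)"
    by (auto simp: supported_def op_mat_def)
  fix g v w assume g: "g \<in> G" and v: "v \<in> fst (erep B \<tau>')" and w: "w \<in> fst (erep A \<tau>)"
  have ap: "act A \<tau> g (point A w) = (\<lambda>v. \<Prod>j\<in>A. \<tau> j g (v j) (w j))"
    using w by (intro act_point fin) simp
  have "mm (fst (erep A \<tau>)) (op_mat A B T) (snd (erep A \<tau>) g) v w
     = (\<Sum>u\<in>words A. op_mat A B T v u * act A \<tau> g (point A w) u)"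
    unfolding ap by (simp add: mm_def erep_def)
  also have "\<dots> = T (act A \<tau> g (point A w)) v"
    using v by (intro op_mat_apply fin op_homD[OF T]) auto
  also have "\<dots> = act B \<tau>' g (T (point A w)) v"
    using op_homD(3)[OF T g, of "point A w"] by simp
  also have "\<dots> = mm (fst (erep B \<tau>')) (snd (erep B \<tau>') g) (op_mat A B T) v w"
    unfolding act_def mm_def erep_def op_mat_def using w by (auto intro!: sum.cong)
  finally show "mm (fst (erep A \<tau>)) (op_mat A B T) (snd (erep A \<tau>) g) v w
     = mm (fst (erep B \<tau>')) (snd (erep B \<tau>') g) (op_mat A B T) v w" .
qed

text \<open>The bridge from operators to matrices: the reduction of tensor powers is carried out
  with operators, and its composites enter the ideal \<open>fac\<close> through this lemma.\<close>

lemma fac_op_mat: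
  assumes fin: "finite A" "finite B" and Y: "op_hom G B \<tau>' A \<tau> Y" and Z: "op_hom G A \<tau> B \<tau>' Z"
    and mem: "erep B \<tau>' \<in> \<B>"
  shows "fac G (erep A \<tau>) \<B> (op_mat A A (\<lambda>\<phi>. Y (Z \<phi>)))"
proof -
  have "mm (fst (erep B \<tau>')) (op_mat B A Y) (op_mat A B Z) = op_mat A A (\<lambda>\<phi>. Y (Z \<phi>))"
  proof (rule supported_eqI)
    show "supported (words A) (words A) (mm (fst (erep B \<tau>')) (op_mat B A Y) (op_mat A B Z))"
      by (rule supported_mm) (auto simp: supported_def op_mat_def)
    show "supported (words A) (words A) (op_mat A A (\<lambda>\<phi>. Y (Z \<phi>)))"
      by (auto simp: supported_def op_mat_def)
    fix v w :: "nat \<Rightarrow> bool" assume v: "v \<in> words A" and w: "w \<in> words A"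
    have "mm (fst (erep B \<tau>')) (op_mat B A Y) (op_mat A B Z) v w
       = (\<Sum>u\<in>words B. op_mat B A Y v u * Z (point A w) u)"
      using w by (simp add: mm_def op_mat_def)
    also have "\<dots> = Y (Z (point A w)) v"
      using v by (intro op_mat_apply fin op_homD(1)[OF Y] op_homD(2)[OF Z]) simp_all
    finally show "mm (fst (erep B \<tau>')) (op_mat B A Y) (op_mat A B Z) v w = op_mat A A (\<lambda>\<phi>. Y (Z \<phi>)) v w"
      using v w by (simp add: op_mat_def)
  qed
  then show ?thesis
    using fac_one[OF mem ihom_op_mat[OF fin(2,1) Y] ihom_op_mat[OF fin Z]] by simp
qed

lemma op_mat_id: "op_mat A A (\<lambda>\<phi>. \<phi>) = idm (words A)"
  by (auto simp: op_mat_def idm_def point_def words_def fun_eq_iff)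

lemma op_hom_id: "op_hom G A \<tau> A \<tau> (\<lambda>\<phi>. \<phi>)"
  by (simp add: op_hom_def op_linear_def)

lemma op_homI:
  assumes "op_linear T" "\<And>\<phi>. depends_on A \<phi> \<Longrightarrow> depends_on B (T \<phi>)"
    "\<And>g \<phi>. g \<in> G \<Longrightarrow> depends_on A \<phi> \<Longrightarrow> T (act A \<tau> g \<phi>) = act B \<tau>' g (T \<phi>)"
  shows "op_hom G A \<tau> B \<tau>' T"
  unfolding op_hom_def by (intro conjI allI impI ballI assms)

lemma op_hom_comp:
  assumes T: "op_hom G A \<tau> B \<tau>' T" and U: "op_hom G B \<tau>' C \<tau>'' U"
  shows "op_hom G A \<tau> C \<tau>'' (\<lambda>\<phi>. U (T \<phi>))"
proof (rule op_homI)
  show "op_linear (\<lambda>\<phi>. U (T \<phi>))"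
    by (rule op_linearI) (simp_all only: op_linear_add[OF op_homD(1)[OF T]] op_linear_scale[OF op_homD(1)[OF T]]
      op_linear_add[OF op_homD(1)[OF U]] op_linear_scale[OF op_homD(1)[OF U]])
  fix \<phi> :: "(nat \<Rightarrow> bool) \<Rightarrow> 'b" assume d: "depends_on A \<phi>"
  show "depends_on C (U (T \<phi>))" by (rule op_homD(2)[OF U op_homD(2)[OF T d]])
  fix g assume "g \<in> G"
  then show "U (T (act A \<tau> g \<phi>)) = act C \<tau>'' g (U (T \<phi>))"
    by (simp only: op_homD(3)[OF T _ d] op_homD(3)[OF U _ op_homD(2)[OF T d]])
qed

lemma op_hom_scale:
  assumes T: "op_hom G A \<tau> B \<tau>' T"
  shows "op_hom G A \<tau> B \<tau>' (\<lambda>\<phi> w. c * T \<phi> w)"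
proof (rule op_homI)
  show "op_linear (\<lambda>\<phi> w. c * T \<phi> w)"
    by (rule op_linearI) (simp_all only: op_linear_add[OF op_homD(1)[OF T]] op_linear_scale[OF op_homD(1)[OF T]]
      distrib_left mult.left_commute)
  fix \<phi> :: "(nat \<Rightarrow> bool) \<Rightarrow> 'b" assume d: "depends_on A \<phi>"
  show "depends_on B (\<lambda>w. c * T \<phi> w)"
    using depends_on_compose2[OF op_homD(2)[OF T d] op_homD(2)[OF T d], of "\<lambda>x _. c * x"] by simp
  fix g assume "g \<in> G"
  then show "(\<lambda>w. c * T (act A \<tau> g \<phi>) w) = act B \<tau>' g (\<lambda>w. c * T \<phi> w)"
    by (simp only: op_homD(3)[OF T _ d] op_linear_scale[OF op_linear_act])
qed

lemma op_hom_add: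
  assumes T: "op_hom G A \<tau> B \<tau>' T" and U: "op_hom G A \<tau> B \<tau>' U"
  shows "op_hom G A \<tau> B \<tau>' (\<lambda>\<phi> w. T \<phi> w + U \<phi> w)"
proof (rule op_homI)
  show "op_linear (\<lambda>\<phi> w. T \<phi> w + U \<phi> w)"
    by (rule op_linearI) (simp_all only: op_linear_add[OF op_homD(1)[OF T]] op_linear_scale[OF op_homD(1)[OF T]]
      op_linear_add[OF op_homD(1)[OF U]] op_linear_scale[OF op_homD(1)[OF U]] distrib_left ac_simps)
  fix \<phi> :: "(nat \<Rightarrow> bool) \<Rightarrow> 'b" assume d: "depends_on A \<phi>"
  show "depends_on B (\<lambda>w. T \<phi> w + U \<phi> w)"
    by (rule depends_on_compose2[OF op_homD(2)[OF T d] op_homD(2)[OF U d]])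
  fix g assume "g \<in> G"
  then show "(\<lambda>w. T (act A \<tau> g \<phi>) w + U (act A \<tau> g \<phi>) w) = act B \<tau>' g (\<lambda>w. T \<phi> w + U \<phi> w)"
    by (simp only: op_homD(3)[OF T _ d] op_homD(3)[OF U _ d] op_linear_add[OF op_linear_act])
qed

lemma op_hom_zero: "op_hom G A \<tau> B \<tau>' (\<lambda>\<phi> w. 0)"
  by (simp add: op_hom_def op_linear_def depends_on_def act_def)

lemma op_hom_sum: "(\<And>x. x \<in> S \<Longrightarrow> op_hom G A \<tau> B \<tau>' (T x)) \<Longrightarrow> op_hom G A \<tau> B \<tau>' (\<lambda>\<phi> w. \<Sum>x\<in>S. T x \<phi> w)"
  by (induction S rule: infinite_finite_induct) (simp_all add: op_hom_zero op_hom_add)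

lemma op_hom_diff: "op_hom G A \<tau> B \<tau>' T \<Longrightarrow> op_hom G A \<tau> B \<tau>' U \<Longrightarrow> op_hom G A \<tau> B \<tau>' (\<lambda>\<phi> w. T \<phi> w - U \<phi> w)"
  using op_hom_add[OF _ op_hom_scale[of G A \<tau> B \<tau>' U "-1"]] by simp

section \<open>Transpositions, the invariant alternating form and the Casimir operator\<close>

definition swp :: "nat \<Rightarrow> nat \<Rightarrow> (nat \<Rightarrow> bool) \<Rightarrow> nat \<Rightarrow> bool" where
  "swp a b w = w(a := w b, b := w a)"

lemma swp_swp [simp]: "swp a b (swp a b w) = w" by (auto simp: swp_def)
lemma swp_commute: "swp a b w = swp b a w" by (auto simp: swp_def fun_eq_iff)
lemma swp_words: "a \<in> A \<Longrightarrow> b \<in> A \<Longrightarrow> w \<in> words A \<Longrightarrow> swp a b w \<in> words A"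
  by (auto simp: swp_def words_def split: if_splits)

definition swap_op :: "nat \<Rightarrow> nat \<Rightarrow> ((nat \<Rightarrow> bool) \<Rightarrow> 'k) \<Rightarrow> (nat \<Rightarrow> bool) \<Rightarrow> 'k" where
  "swap_op a b \<phi> w = \<phi> (swp a b w)"

text \<open>The alternating form on a two-dimensional space, preserved by matrices of determinant 1.
  \<open>cup\<close> inserts it at two positions and \<open>cap\<close> contracts two positions with
  it, as in Temperley-Lieb diagrams.\<close>

definition vol :: "bool \<Rightarrow> bool \<Rightarrow> 'k::field" where
  "vol x y = (if x = y then 0 else if y then 1 else -1)"

definition cup :: "nat \<Rightarrow> nat \<Rightarrow> ((nat \<Rightarrow> bool) \<Rightarrow> 'k::field) \<Rightarrow> (nat \<Rightarrow> bool) \<Rightarrow> 'k" where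
  "cup a b \<psi> w = vol (w a) (w b) * \<psi> w"

definition cap :: "nat \<Rightarrow> nat \<Rightarrow> ((nat \<Rightarrow> bool) \<Rightarrow> 'k::field) \<Rightarrow> (nat \<Rightarrow> bool) \<Rightarrow> 'k" where
  "cap a b \<phi> w = \<phi> (w(a := False, b := True)) - \<phi> (w(a := True, b := False))"

text \<open>The exterior square of a two-dimensional space is a line. Hence antisymmetrising in two
  positions is the same as contracting with the alternating form and inserting it again.\<close>

lemma diff_swap: "a \<noteq> b \<Longrightarrow> \<phi> w - swap_op a b \<phi> w = cup a b (cap a b \<phi>) w"
proof -
  assume "a \<noteq> b"
  consider "w a" "w b" | "w a" "\<not> w b" | "\<not> w a" "w b" | "\<not> w a" "\<not> w b" by blast
  then show ?thesis
  proof cases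
    case 2
    then have "w(a := True, b := False) = w" "swp a b w = w(a := False, b := True)"
      using \<open>a \<noteq> b\<close> by (auto simp: swp_def fun_eq_iff)
    then show ?thesis using 2 by (simp add: swap_op_def cup_def cap_def vol_def)
  next
    case 3
    then have "w(a := False, b := True) = w" "swp a b w = w(a := True, b := False)"
      using \<open>a \<noteq> b\<close> by (auto simp: swp_def fun_eq_iff)
    then show ?thesis using 3 by (simp add: swap_op_def cup_def cap_def vol_def)
  next
    case 1
    then have "swp a b w = w" by (auto simp: swp_def fun_eq_iff)
    then show ?thesis using 1 by (simp add: swap_op_def cup_def vol_def)
  next
    case 4
    then have "swp a b w = w" by (auto simp: swp_def fun_eq_iff)
    then show ?thesis using 4 by (simp add: swap_op_def cup_def vol_def)
  qed
qed

lemma op_linear_swap: "op_linear (swap_op a b)"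
  by (simp add: op_linear_def swap_op_def fun_eq_iff)

lemma op_linear_cup: "op_linear (cup a b)"
  by (simp add: op_linear_def cup_def fun_eq_iff algebra_simps)

lemma op_linear_cap: "op_linear (cap a b)"
  by (simp add: op_linear_def cap_def fun_eq_iff algebra_simps)

lemma depends_on_swap:
  assumes "a \<in> A" "b \<in> A" "depends_on A \<phi>"
  shows "depends_on A (swap_op a b \<phi>)"
proof (rule depends_onI)
  fix w w' :: "nat \<Rightarrow> bool" assume e: "\<And>j. j \<in> A \<Longrightarrow> w j = w' j"
  show "swap_op a b \<phi> w = swap_op a b \<phi> w'"
    unfolding swap_op_def by (rule depends_onD[OF assms(3)]) (simp add: swp_def e assms(1,2))
qed

lemma depends_on_cup:
  assumes "a \<in> A" "b \<in> A" "depends_on (A - {a, b}) \<psi>"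
  shows "depends_on A (cup a b \<psi>)"
proof (rule depends_onI)
  fix w w' :: "nat \<Rightarrow> bool" assume e: "\<And>j. j \<in> A \<Longrightarrow> w j = w' j"
  have "\<psi> w = \<psi> w'" by (rule depends_onD[OF assms(3)]) (simp add: e)
  then show "cup a b \<psi> w = cup a b \<psi> w'" unfolding cup_def by (simp add: e assms(1,2))
qed

lemma depends_on_cap:
  assumes "depends_on A \<phi>"
  shows "depends_on (A - {a, b}) (cap a b \<phi>)"
proof (rule depends_onI)
  fix w w' :: "nat \<Rightarrow> bool" assume e: "\<And>j. j \<in> A - {a, b} \<Longrightarrow> w j = w' j"
  have "\<phi> (w(a := x, b := y)) = \<phi> (w'(a := x, b := y))" for x y
    by (rule depends_onD[OF assms]) (simp add: e)
  then show "cap a b \<phi> w = cap a b \<phi> w'" unfolding cap_def by simp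
qed

lemma depends_on_upd: "depends_on A \<phi> \<Longrightarrow> a \<notin> A \<Longrightarrow> \<phi> (w(a := x)) = \<phi> w"
  by (rule depends_onD) auto

lemma act_swap:
  fixes t :: "'g \<Rightarrow> bool \<Rightarrow> bool \<Rightarrow> 'k::field"
  assumes ab: "a \<in> A" "b \<in> A" and fin: "finite A"
  shows "swap_op a b (act A (\<lambda>_. t) g \<phi>) = act A (\<lambda>_. t) g (swap_op a b \<phi>)"
proof
  fix v
  have pr: "(\<Prod>j\<in>A. t g (swp a b v j) (w j)) = (\<Prod>j\<in>A. t g (v j) (swp a b w j))" for w
    by (rule prod.reindex_bij_witness[of _ "\<lambda>j. if j = a then b else if j = b then a else j"
          "\<lambda>j. if j = a then b else if j = b then a else j"])
       (use ab in \<open>auto simp: swp_def split: if_splits\<close>)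
  have "swap_op a b (act A (\<lambda>_. t) g \<phi>) v = (\<Sum>w\<in>words A. (\<Prod>j\<in>A. t g (v j) (swp a b w j)) * \<phi> w)"
    by (simp add: swap_op_def act_def pr)
  also have "\<dots> = (\<Sum>w\<in>words A. (\<Prod>j\<in>A. t g (v j) (w j)) * \<phi> (swp a b w))"
    by (rule sum.reindex_bij_witness[of _ "swp a b" "swp a b"]) (use ab in \<open>simp_all add: swp_words\<close>)
  finally show "swap_op a b (act A (\<lambda>_. t) g \<phi>) v = act A (\<lambda>_. t) g (swap_op a b \<phi>) v"
    by (simp add: act_def swap_op_def)
qed

lemma op_hom_swap: "a \<in> A \<Longrightarrow> b \<in> A \<Longrightarrow> finite A \<Longrightarrow> op_hom G A (\<lambda>_. t) A (\<lambda>_. t) (swap_op a b)"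
  by (simp add: op_hom_def op_linear_swap depends_on_swap act_swap)

definition unimodular :: "'g set \<Rightarrow> ('g \<Rightarrow> bool \<Rightarrow> bool \<Rightarrow> 'k::field) \<Rightarrow> bool" where
  "unimodular G t \<longleftrightarrow> (\<forall>g\<in>G. t g False False * t g True True - t g False True * t g True False = 1)"

lemma act_cup:
  fixes t :: "'g \<Rightarrow> bool \<Rightarrow> bool \<Rightarrow> 'k::field"
  assumes t: "unimodular G t" and g: "g \<in> G" and ab: "a \<in> A" "b \<in> A" "a \<noteq> b" and fin: "finite A"
    and dep: "depends_on (A - {a, b}) \<psi>"
  shows "cup a b (act (A - {a, b}) (\<lambda>_. t) g \<psi>) = act A (\<lambda>_. t) g (cup a b \<psi>)"
proof
  fix v
  let ?B = "A - {a, b}"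
  have A: "A = insert a (insert b ?B)" using ab by auto
  have det: "t g False False * t g True True - t g False True * t g True False = 1"
    using t g by (simp add: unimodular_def)
  have ps: "\<psi> (w(b := x, a := y)) = \<psi> w" for w x y
    using depends_on_upd[OF dep] by simp
  have pr: "(\<Prod>j\<in>A. t g (v j) ((w(b := x, a := y)) j)) = t g (v a) y * t g (v b) x * (\<Prod>j\<in>?B. t g (v j) (w j))" for w x y
  proof -
    have "(\<Prod>j\<in>A. t g (v j) ((w(b := x, a := y)) j)) = t g (v a) y * (t g (v b) x * (\<Prod>j\<in>?B. t g (v j) ((w(b := x, a := y)) j)))"
      using ab fin by (subst A) simp
    also have "(\<Prod>j\<in>?B. t g (v j) ((w(b := x, a := y)) j)) = (\<Prod>j\<in>?B. t g (v j) (w j))"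
      by (intro prod.cong) auto
    finally show ?thesis by (simp only: mult.assoc)
  qed
  \<comment> \<open>The terms with different letters at a and b combine to a 2 by 2 minor of the
    matrix of g; as the determinant is 1, the minor is the value of the form itself.\<close>
  have d: "t g (v a) False * t g (v b) True - t g (v a) True * t g (v b) False = vol (v a) (v b)"
    using det by (cases "v a"; cases "v b") (simp_all add: vol_def algebra_simps)
  define T where "T = (\<lambda>w. (\<Prod>j\<in>A. t g (v j) (w j)) * cup a b \<psi> w)"
  have "act A (\<lambda>_. t) g (cup a b \<psi>) v = (\<Sum>w\<in>words (insert a (insert b ?B)). T w)"
    unfolding A[symmetric] by (simp add: act_def T_def)
  also have "\<dots> = (\<Sum>w\<in>words ?B. T (w(b := False, a := False)) + T (w(b := False, a := True))
       + (T (w(b := True, a := False)) + T (w(b := True, a := True))))"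
    using ab by (subst sum_words_insert, simp, subst sum_words_insert, simp) (simp add: sum.distrib)
  also have "\<dots> = (\<Sum>w\<in>words ?B. (t g (v a) False * t g (v b) True - t g (v a) True * t g (v b) False) *
      ((\<Prod>j\<in>?B. t g (v j) (w j)) * \<psi> w))"
    unfolding T_def pr cup_def ps using ab(3) by (intro sum.cong) (simp_all add: vol_def algebra_simps)
  finally show "cup a b (act ?B (\<lambda>_. t) g \<psi>) v = act A (\<lambda>_. t) g (cup a b \<psi>) v"
    unfolding d by (simp add: cup_def act_def sum_distrib_left)
qed

lemma op_hom_cup:
  "unimodular G t \<Longrightarrow> a \<in> A \<Longrightarrow> b \<in> A \<Longrightarrow> a \<noteq> b \<Longrightarrow> finite A \<Longrightarrow> op_hom G (A - {a, b}) (\<lambda>_. t) A (\<lambda>_. t) (cup a b)"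
  by (simp add: op_hom_def op_linear_cup depends_on_cup act_cup)

lemma cup_injective:
  assumes "a \<noteq> b" "depends_on (A - {a, b}) \<phi>" "depends_on (A - {a, b}) \<psi>" "cup a b \<phi> = cup a b \<psi>"
  shows "\<phi> = \<psi>"
proof
  fix w
  have "cup a b \<phi> (w(a := False, b := True)) = cup a b \<psi> (w(a := False, b := True))" using assms(4) by simp
  then show "\<phi> w = \<psi> w"
    using assms(1) depends_on_upd[OF assms(2)] depends_on_upd[OF assms(3)] by (simp add: cup_def vol_def)
qed

text \<open>Deduced from \<open>cup\<close> instead of computed: \<open>cup\<close> after
  \<open>cap\<close> is 1 minus a transposition, which commutes with the action, while
  \<open>cup\<close> is equivariant and injective.\<close>

lemma op_hom_cap:
  fixes t :: "'g \<Rightarrow> bool \<Rightarrow> bool \<Rightarrow> 'k::field"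
  assumes t: "unimodular G t" and ab: "a \<in> A" "b \<in> A" "a \<noteq> b" and fin: "finite A"
  shows "op_hom G A (\<lambda>_. t) (A - {a, b}) (\<lambda>_. t) (cap a b)"
proof (rule op_homI)
  fix g and \<phi> :: "(nat \<Rightarrow> bool) \<Rightarrow> 'k" assume g: "g \<in> G" and dep: "depends_on A \<phi>"
  let ?g = "act A (\<lambda>_. t) g" and ?h = "act (A - {a, b}) (\<lambda>_. t) g"
  have cc: "cup a b (cap a b \<psi>) = (\<lambda>w. \<psi> w - swap_op a b \<psi> w)" for \<psi> :: "(nat \<Rightarrow> bool) \<Rightarrow> 'k"
    using diff_swap[OF ab(3), of \<psi>] by (simp add: fun_eq_iff)
  have "cup a b (cap a b (?g \<phi>)) = (\<lambda>w. ?g \<phi> w - ?g (swap_op a b \<phi>) w)"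
    unfolding cc act_swap[OF ab(1,2) fin] ..
  also have "\<dots> = ?g (cup a b (cap a b \<phi>))"
    unfolding cc op_linear_diff[OF op_linear_act] ..
  also have "\<dots> = cup a b (?h (cap a b \<phi>))"
    by (rule act_cup[OF t g ab fin depends_on_cap[OF dep], symmetric])
  finally show "cap a b (?g \<phi>) = ?h (cap a b \<phi>)"
    by (rule cup_injective[OF ab(3) depends_on_cap[OF depends_on_act] depends_on_act])
qed (simp_all add: op_linear_cap depends_on_cap)

text \<open>The condition a < b lets each transposition be counted once.\<close>

definition pairs :: "nat set \<Rightarrow> (nat \<times> nat) set" where
  "pairs A = {(a, b). a \<in> A \<and> b \<in> A \<and> a < b}"

lemma finite_pairs [simp]: "finite A \<Longrightarrow> finite (pairs A)"
  by (rule finite_subset[of _ "A \<times> A"]) (auto simp: pairs_def)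

lemma sum_pairs_remove:
  assumes fin: "finite A" and x: "x \<in> A" and sym: "\<And>a b. F a b = F b a"
  shows "(\<Sum>(a, b)\<in>pairs A. F a b) = (\<Sum>(a, b)\<in>pairs (A - {x}). F a b) + (\<Sum>c\<in>A - {x}. F x c)"
proof -
  let ?p = "\<lambda>c. (min x c, max x c)"
  have eq: "pairs A = pairs (A - {x}) \<union> ?p ` (A - {x})"
  proof (intro equalityI subsetI)
    fix q assume "q \<in> pairs A"
    then obtain a b where q: "q = (a, b)" "a \<in> A" "b \<in> A" "a < b" by (auto simp: pairs_def)
    consider "a = x" | "b = x" | "a \<noteq> x" "b \<noteq> x" by blast
    then show "q \<in> pairs (A - {x}) \<union> ?p ` (A - {x})"
    proof cases
      case 1
      then have "q = ?p b" "b \<in> A - {x}" using q by auto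
      then show ?thesis by blast
    next
      case 2
      then have "q = ?p a" "a \<in> A - {x}" using q by auto
      then show ?thesis by blast
    next
      case 3
      then show ?thesis using q by (simp add: pairs_def)
    qed
  next
    fix q assume "q \<in> pairs (A - {x}) \<union> ?p ` (A - {x})"
    then show "q \<in> pairs A" using x by (auto simp: pairs_def min_def max_def)
  qed
  have inj: "inj_on ?p (A - {x})" by (auto simp: inj_on_def min_def max_def split: if_splits)
  have disj: "pairs (A - {x}) \<inter> ?p ` (A - {x}) = {}" by (auto simp: pairs_def min_def max_def split: if_splits)
  have "(\<Sum>(a, b)\<in>pairs A. F a b) = (\<Sum>(a, b)\<in>pairs (A - {x}). F a b) + (\<Sum>(a, b)\<in>?p ` (A - {x}). F a b)"
    unfolding eq by (rule sum.union_disjoint) (use fin disj in auto)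
  also have "(\<Sum>(a, b)\<in>?p ` (A - {x}). F a b) = (\<Sum>c\<in>A - {x}. F (min x c) (max x c))"
    by (simp add: sum.reindex[OF inj] comp_def)
  also have "\<dots> = (\<Sum>c\<in>A - {x}. F x c)"
    by (intro sum.cong refl) (auto simp: min_def max_def sym)
  finally show ?thesis .
qed

text \<open>A central element of the group algebra of the symmetric group; in characteristic 0,
  Schur-Weyl duality matches it with the quadratic Casimir element up to normalisation. By
  \<open>casimir_cup_cap\<close> it is a sum of maps through two factors fewer.\<close>

definition casimir :: "nat set \<Rightarrow> ((nat \<Rightarrow> bool) \<Rightarrow> 'k::field) \<Rightarrow> (nat \<Rightarrow> bool) \<Rightarrow> 'k" where
  "casimir A \<phi> w = (\<Sum>(a, b)\<in>pairs A. \<phi> w - swap_op a b \<phi> w)"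

lemma casimir_cup_cap: "casimir A \<phi> w = (\<Sum>(a, b)\<in>pairs A. cup a b (cap a b \<phi>) w)"
  unfolding casimir_def by (intro sum.cong refl) (auto simp: pairs_def diff_swap)

text \<open>Sorts the pairs by how many of a and b they contain, the form in which they are
  evaluated both for \<open>cup\<close> and for transpositions.\<close>

lemma casimir_split:
  assumes "finite A" "a \<in> A" "b \<in> A" "a \<noteq> b"
  shows "casimir A \<phi> w = casimir (A - {a, b}) \<phi> w + (\<phi> w - swap_op a b \<phi> w)
     + (\<Sum>c\<in>A - {a, b}. (\<phi> w - swap_op a c \<phi> w) + (\<phi> w - swap_op b c \<phi> w))"
proof -
  let ?F = "\<lambda>a b. \<phi> w - swap_op a b \<phi> w"
  have sym: "?F a b = ?F b a" for a b by (simp add: swap_op_def swp_commute)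
  have AB: "A - {a} - {b} = A - {a, b}" by auto
  have "(\<Sum>c\<in>A - {a}. ?F a c) = ?F a b + (\<Sum>c\<in>A - {a, b}. ?F a c)"
    using assms by (subst sum.remove[of "A - {a}" b]) (simp_all add: AB)
  moreover have "casimir A \<phi> w = (\<Sum>(a, b)\<in>pairs (A - {a}). ?F a b) + (\<Sum>c\<in>A - {a}. ?F a c)"
    unfolding casimir_def by (rule sum_pairs_remove[OF assms(1,2) sym])
  moreover have "(\<Sum>(a, b)\<in>pairs (A - {a}). ?F a b) = casimir (A - {a, b}) \<phi> w + (\<Sum>c\<in>A - {a, b}. ?F b c)"
    unfolding casimir_def AB[symmetric] by (rule sum_pairs_remove[OF _ _ sym]) (use assms in auto)
  ultimately show ?thesis by (simp only: sum.distrib add_ac)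
qed

lemma vol_swap: "vol y x = - (vol x y :: 'k::field)" by (auto simp: vol_def)

text \<open>The pair of a and b contributes twice the vector, because the form changes sign. For
  every further c, the pairs of a with c and of b with c together contribute the vector once, since
  antisymmetrising three positions of a two-dimensional space gives zero. Apart from the pairs
  avoiding a and b, this makes 2 + (|A| - 2) = |A|.\<close>

lemma casimir_cup:
  fixes \<psi> :: "(nat \<Rightarrow> bool) \<Rightarrow> 'k::field"
  assumes fin: "finite A" and ab: "a \<in> A" "b \<in> A" "a \<noteq> b" and dep: "depends_on (A - {a, b}) \<psi>"
  shows "casimir A (cup a b \<psi>) = cup a b (\<lambda>w. casimir (A - {a, b}) \<psi> w + of_nat (card A) * \<psi> w)"
proof
  fix w
  let ?x = "cup a b \<psi> w"
  have 1: "?x - swap_op a b (cup a b \<psi>) w = 2 * ?x"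
  proof -
    have "\<psi> (swp a b w) = \<psi> w" by (rule depends_onD[OF dep]) (simp add: swp_def)
    then show ?thesis using ab(3) vol_swap[of "w b" "w a", where 'k = 'k]
      by (simp add: swap_op_def cup_def swp_def)
  qed
  have 2: "(?x - swap_op a c (cup a b \<psi>) w) + (?x - swap_op b c (cup a b \<psi>) w) = ?x" if c: "c \<in> A - {a, b}" for c
  proof -
    have p: "\<psi> (swp a c w) = \<psi> (w(c := w a))" "\<psi> (swp b c w) = \<psi> (w(c := w b))"
      by (rule depends_onD[OF dep]; simp add: swp_def)+
    have s: "swap_op a c (cup a b \<psi>) w = vol (w c) (w b) * \<psi> (w(c := w a))"
      "swap_op b c (cup a b \<psi>) w = vol (w a) (w c) * \<psi> (w(c := w b))"
      using c ab(3) unfolding swap_op_def cup_def p by (auto simp: swp_def)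
    have i: "w(c := w a) = w" if "w a = w c" using that by (auto simp: fun_eq_iff)
    have j: "w(c := w b) = w" if "w b = w c" using that by (auto simp: fun_eq_iff)
    have "vol (w c) (w b) * \<psi> (w(c := w a)) + vol (w a) (w c) * \<psi> (w(c := w b)) = ?x"
      using i j by (cases "w a"; cases "w b"; cases "w c") (simp_all add: vol_def cup_def)
    then show ?thesis unfolding s by (simp add: algebra_simps)
  qed
  have 3: "casimir (A - {a, b}) (cup a b \<psi>) w = vol (w a) (w b) * casimir (A - {a, b}) \<psi> w"
    unfolding casimir_def sum_distrib_left
  proof (intro sum.cong refl, clarify)
    fix c d assume "(c, d) \<in> pairs (A - {a, b})"
    then have "swp c d w a = w a" "swp c d w b = w b" by (auto simp: pairs_def swp_def)
    then show "?x - swap_op c d (cup a b \<psi>) w = vol (w a) (w b) * (\<psi> w - swap_op c d \<psi> w)"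
      by (simp add: swap_op_def cup_def algebra_simps)
  qed
  have "card A = Suc (Suc (card (A - {a, b})))"
    using fin ab card_Suc_Diff1[OF fin ab(1)] card_Suc_Diff1[of "A - {a}" b]
    by (simp add: Diff_insert2[symmetric] insert_commute)
  then have n: "of_nat (card A) = (2 + of_nat (card (A - {a, b})) :: 'k)" by simp
  have 2: "(\<Sum>c\<in>A - {a, b}. (?x - swap_op a c (cup a b \<psi>) w) + (?x - swap_op b c (cup a b \<psi>) w)) = (\<Sum>c\<in>A - {a, b}. ?x)"
    by (rule sum.cong[OF refl 2])
  have "casimir A (cup a b \<psi>) w = vol (w a) (w b) * casimir (A - {a, b}) \<psi> w + 2 * ?x + of_nat (card (A - {a, b})) * ?x"
    unfolding casimir_split[OF fin ab] 1 3 2 by simp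
  then show "casimir A (cup a b \<psi>) w = cup a b (\<lambda>w. casimir (A - {a, b}) \<psi> w + of_nat (card A) * \<psi> w) w"
    unfolding n by (simp add: cup_def algebra_simps)
qed

lemma op_linear_casimir: "op_linear (casimir A)"
  by (rule op_linearI) (simp_all add: casimir_def swap_op_def fun_eq_iff case_prod_unfold algebra_simps
      sum.distrib sum_subtractf sum_distrib_left)

lemma op_hom_casimir:
  assumes "finite A"
  shows "op_hom G A (\<lambda>_. t) A (\<lambda>_. t) (casimir A)"
proof -
  have "op_hom G A (\<lambda>_. t) A (\<lambda>_. t) (\<lambda>\<phi> w. \<Sum>q\<in>pairs A. \<phi> w - swap_op (fst q) (snd q) \<phi> w)"
    by (intro op_hom_sum op_hom_diff op_hom_id op_hom_swap assms) (auto simp: pairs_def)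
  then show ?thesis by (simp add: casimir_def[abs_def] case_prod_unfold)
qed

text \<open>\<open>pol A [x\<^sub>1, \<dots>, x\<^sub>r]\<close> is the product of the operators \<open>casimir A - x\<^sub>i\<close>, and
  \<open>pol_rem\<close> is its quotient by \<open>casimir A\<close>, up to the constant term.\<close>

fun pol :: "nat set \<Rightarrow> 'k::field list \<Rightarrow> ((nat \<Rightarrow> bool) \<Rightarrow> 'k) \<Rightarrow> (nat \<Rightarrow> bool) \<Rightarrow> 'k" where
  "pol A [] \<phi> = \<phi>"
| "pol A (x # xs) \<phi> = (\<lambda>w. casimir A (pol A xs \<phi>) w - x * pol A xs \<phi> w)"

fun pol_rem :: "nat set \<Rightarrow> 'k::field list \<Rightarrow> ((nat \<Rightarrow> bool) \<Rightarrow> 'k) \<Rightarrow> (nat \<Rightarrow> bool) \<Rightarrow> 'k" where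
  "pol_rem A [] \<phi> = (\<lambda>w. 0)"
| "pol_rem A (x # xs) \<phi> = (\<lambda>w. pol A xs \<phi> w - x * pol_rem A xs \<phi> w)"

lemma op_hom_pol:
  fixes t :: "'g \<Rightarrow> bool \<Rightarrow> bool \<Rightarrow> 'k::field"
  assumes "finite A"
  shows "op_hom G A (\<lambda>_. t) A (\<lambda>_. t) (pol A xs)"
proof (induction xs)
  case Nil
  have "(pol A [] :: (_ \<Rightarrow> 'k) \<Rightarrow> _) = (\<lambda>\<phi>. \<phi>)" by (rule ext) simp
  then show ?case by (simp only: op_hom_id)
next
  case (Cons x xs)
  have "pol A (x # xs) = (\<lambda>\<phi> w. casimir A (pol A xs \<phi>) w - x * pol A xs \<phi> w)" by (rule ext) simp
  then show ?case
    by (simp only:) (intro op_hom_diff op_hom_scale op_hom_comp[OF Cons op_hom_casimir] Cons assms)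
qed

lemma op_hom_pol_rem:
  fixes t :: "'g \<Rightarrow> bool \<Rightarrow> bool \<Rightarrow> 'k::field"
  assumes "finite A"
  shows "op_hom G A (\<lambda>_. t) A (\<lambda>_. t) (pol_rem A xs)"
proof (induction xs)
  case Nil
  have "(pol_rem A [] :: (_ \<Rightarrow> 'k) \<Rightarrow> _) = (\<lambda>\<phi> w. 0)" by (rule ext) simp
  then show ?case by (simp only: op_hom_zero)
next
  case (Cons x xs)
  have "pol_rem A (x # xs) = (\<lambda>\<phi> w. pol A xs \<phi> w - x * pol_rem A xs \<phi> w)" by (rule ext) simp
  then show ?case
    by (simp only:) (intro op_hom_diff op_hom_scale op_hom_pol Cons assms)
qed

lemma op_linear_pol: "finite A \<Longrightarrow> op_linear (pol A xs)"
  by (rule op_homD(1)[OF op_hom_pol])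

lemma depends_on_pol: "finite A \<Longrightarrow> depends_on A \<phi> \<Longrightarrow> depends_on A (pol A xs \<phi>)"
  by (rule op_homD(2)[OF op_hom_pol])

lemma casimir_diff_scale: "casimir A (\<lambda>w. \<phi> w - x * \<psi> w) = (\<lambda>w. casimir A \<phi> w - x * casimir A \<psi> w)"
  using op_linear_diff[OF op_linear_casimir, of A \<phi> "\<lambda>w. x * \<psi> w"] op_linear_scale[OF op_linear_casimir, of A x \<psi>]
  by simp

lemma pol_casimir: "pol A xs (casimir A \<phi>) = casimir A (pol A xs \<phi>)"
  by (induction xs) (simp_all add: casimir_diff_scale)

lemma pol_rem_casimir: "pol_rem A xs (casimir A \<phi>) = casimir A (pol_rem A xs \<phi>)"
  by (induction xs) (simp_all add: casimir_diff_scale pol_casimir op_linear_zero[OF op_linear_casimir])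

lemma pol_decompose: "pol A xs \<phi> w = prod_list (map uminus xs) * \<phi> w + casimir A (pol_rem A xs \<phi>) w"
proof (induction xs arbitrary: w)
  case Nil
  then show ?case using fun_cong[OF op_linear_zero[OF op_linear_casimir], of A w] by simp
next
  case (Cons x xs)
  show ?case
    by (simp add: casimir_diff_scale) (simp add: Cons algebra_simps)
qed

lemma pol_cup:
  fixes \<psi> :: "(nat \<Rightarrow> bool) \<Rightarrow> 'k::field"
  assumes fin: "finite A" and ab: "a \<in> A" "b \<in> A" "a \<noteq> b" and dep: "depends_on (A - {a, b}) \<psi>"
  shows "pol A xs (cup a b \<psi>) = cup a b (pol (A - {a, b}) (map (\<lambda>x. x - of_nat (card A)) xs) \<psi>)"
proof (induction xs)
  case (Cons x xs)
  let ?\<theta> = "pol (A - {a, b}) (map (\<lambda>x. x - of_nat (card A)) xs) \<psi>"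
  have "depends_on (A - {a, b}) ?\<theta>" by (rule depends_on_pol) (use fin dep in auto)
  from casimir_cup[OF fin ab this] show ?case
    by (simp add: Cons) (simp add: cup_def fun_eq_iff algebra_simps)
qed simp

text \<open>The candidates for eigenvalues of \<open>casimir\<close> on m factors, besides 0. The
  index k counts copies of the alternating form that are split off, each of which occupies two
  positions.\<close>

definition evs :: "nat \<Rightarrow> 'k::field list" where
  "evs m = map (\<lambda>k. of_nat k * (of_nat (m + 1) - of_nat k)) [1..<m div 2 + 1]"

text \<open>With m = n + 2, subtracting m from k (m + 1 - k) leaves (k - 1)((m - 2) + 1 - (k - 1)).
  These are the values for two factors fewer, preceded by 0 from k = 1.\<close>

lemma evs_shift: "map (\<lambda>x. x - of_nat (Suc (Suc n))) (evs (Suc (Suc n))) = (0 # evs n :: 'k::field list)"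
proof -
  have "[1..<Suc (Suc n) div 2 + 1] = map Suc (0 # [1..<n div 2 + 1])"
    by (simp add: map_Suc_upt upt_conv_Cons del: upt_Suc)
  then show ?thesis by (simp add: evs_def comp_def algebra_simps)
qed

text \<open>Moving the operator past \<open>cup\<close> shifts its roots by |A|, and the shifted
  list starts with 0, that is, with \<open>casimir\<close> on the remaining positions. The latter is
  again a sum of values of \<open>cup\<close>, so the induction applies to it.\<close>

lemma pol_evs_cup:
  fixes \<psi> :: "(nat \<Rightarrow> bool) \<Rightarrow> 'k::field"
  assumes "finite A" "a \<in> A" "b \<in> A" "a \<noteq> b" "depends_on (A - {a, b}) \<psi>"
  shows "pol A (evs (card A)) (cup a b \<psi>) = (\<lambda>w. 0)"
  using assms
proof (induction "card A" arbitrary: A a b \<psi> rule: less_induct)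
  case less
  let ?B = "A - {a, b}"
  have cA: "card A = Suc (Suc (card ?B))"
    using less.prems card_Suc_Diff1[OF less.prems(1,2)] card_Suc_Diff1[of "A - {a}" b]
    by (simp add: Diff_insert2[symmetric] insert_commute)
  have fB: "finite ?B" using less.prems by simp
  have sh: "map (\<lambda>x. x - of_nat (card A)) (evs (card A)) = (0 # evs (card ?B) :: 'k list)"
    unfolding cA by (rule evs_shift)
  have "casimir ?B \<psi> = (\<lambda>w. \<Sum>q\<in>pairs ?B. cup (fst q) (snd q) (cap (fst q) (snd q) \<psi>) w)"
    by (simp add: casimir_cup_cap case_prod_unfold fun_eq_iff)
  then have "pol ?B (evs (card ?B)) (casimir ?B \<psi>)
     = (\<lambda>w. \<Sum>q\<in>pairs ?B. pol ?B (evs (card ?B)) (cup (fst q) (snd q) (cap (fst q) (snd q) \<psi>)) w)"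
    by (simp only: op_linear_sum[OF op_linear_pol[OF fB]])
  also have "\<dots> = (\<lambda>w. 0)"
  proof
    fix w
    have "pol ?B (evs (card ?B)) (cup (fst q) (snd q) (cap (fst q) (snd q) \<psi>)) = (\<lambda>w. 0)" if "q \<in> pairs ?B" for q
      by (rule less.hyps) (use that fB cA less.prems(5) in \<open>auto simp: pairs_def intro!: depends_on_cap\<close>)
    then show "(\<Sum>q\<in>pairs ?B. pol ?B (evs (card ?B)) (cup (fst q) (snd q) (cap (fst q) (snd q) \<psi>)) w) = 0"
      by (intro sum.neutral ballI) simp
  qed
  finally have "pol ?B (0 # evs (card ?B)) \<psi> = (\<lambda>w. 0)" by (simp add: pol_casimir)
  then show ?case
    unfolding pol_cup[OF less.prems] sh by (simp add: cup_def fun_eq_iff)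
qed

text \<open>The difference of \<phi> and its transposed function lies in the image of
  \<open>cup\<close>, which is killed. Together with \<open>pol_swap\<close> this makes every value
  of the operator a symmetric tensor.\<close>

lemma pol_evs_swap:
  assumes fin: "finite A" and ab: "a \<in> A" "b \<in> A" and dep: "depends_on A \<phi>"
  shows "pol A (evs (card A)) (swap_op a b \<phi>) = pol A (evs (card A)) \<phi>"
proof (cases "a = b")
  case True
  then have "swap_op a b \<phi> = \<phi>" by (simp add: swap_op_def swp_def fun_eq_iff)
  then show ?thesis by simp
next
  case False
  have "(\<lambda>w. \<phi> w - swap_op a b \<phi> w) = cup a b (cap a b \<phi>)"
    using diff_swap[OF False, of \<phi>] by (simp add: fun_eq_iff)
  then have "pol A (evs (card A)) (\<lambda>w. \<phi> w - swap_op a b \<phi> w) = (\<lambda>w. 0)"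
    using pol_evs_cup[OF fin ab False depends_on_cap[OF dep]] by simp
  then show ?thesis
    unfolding op_linear_diff[OF op_linear_pol[OF fin]] by (simp add: fun_eq_iff)
qed

lemma casimir_swap:
  assumes "finite A" "a \<in> A" "b \<in> A" "a \<noteq> b"
  shows "casimir A (swap_op a b \<phi>) = swap_op a b (casimir A \<phi>)"
proof
  fix w
  let ?s = "swp a b w"
  have 1: "casimir (A - {a, b}) (swap_op a b \<phi>) w = casimir (A - {a, b}) \<phi> ?s"
    unfolding casimir_def
  proof (intro sum.cong refl, clarify)
    fix c d assume "(c, d) \<in> pairs (A - {a, b})"
    then have "swp a b (swp c d w) = swp c d ?s" by (auto simp: pairs_def swp_def fun_eq_iff)
    then show "swap_op a b \<phi> w - swap_op c d (swap_op a b \<phi>) w = \<phi> ?s - swap_op c d \<phi> ?s"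
      by (simp add: swap_op_def)
  qed
  have 2: "(swap_op a b \<phi> w - swap_op a c (swap_op a b \<phi>) w) + (swap_op a b \<phi> w - swap_op b c (swap_op a b \<phi>) w)
     = (\<phi> ?s - swap_op a c \<phi> ?s) + (\<phi> ?s - swap_op b c \<phi> ?s)" if "c \<in> A - {a, b}" for c
  proof -
    have "swp a b (swp a c w) = swp b c ?s" "swp a b (swp b c w) = swp a c ?s"
      using that assms(4) by (auto simp: swp_def fun_eq_iff)
    then show ?thesis by (simp add: swap_op_def)
  qed
  have 3: "swap_op a b \<phi> w - swap_op a b (swap_op a b \<phi>) w = \<phi> ?s - swap_op a b \<phi> ?s"
    by (simp add: swap_op_def)
  have "casimir A (swap_op a b \<phi>) w = casimir A \<phi> ?s"
    unfolding casimir_split[OF assms] 1 3 by (rule arg_cong[OF sum.cong[OF refl 2]])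
  then show "casimir A (swap_op a b \<phi>) w = swap_op a b (casimir A \<phi>) w"
    unfolding swap_op_def[of a b "casimir A \<phi>"] .
qed

lemma pol_swap:
  assumes "finite A" "a \<in> A" "b \<in> A"
  shows "swap_op a b (pol A xs \<phi>) = pol A xs (swap_op a b \<phi>)"
proof (cases "a = b")
  case True
  then have "swap_op a b \<phi> = \<phi>" for \<phi> :: "(nat \<Rightarrow> bool) \<Rightarrow> 'a" by (simp add: swap_op_def swp_def fun_eq_iff)
  then show ?thesis by simp
next
  case False
  show ?thesis
  proof (induction xs)
    case (Cons x xs)
    have "swap_op a b (pol A (x # xs) \<phi>) = (\<lambda>w. swap_op a b (casimir A (pol A xs \<phi>)) w - x * swap_op a b (pol A xs \<phi>) w)"
      by (simp add: swap_op_def fun_eq_iff)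
    also have "\<dots> = pol A (x # xs) (swap_op a b \<phi>)"
      unfolding casimir_swap[OF assms False, symmetric] Cons by simp
    finally show ?case .
  qed simp
qed

section \<open>Symmetric functions on words modulo p, and the Frobenius twist\<close>

lemma swap_invariant_card_eq:
  assumes inv: "\<And>a b S. a \<in> Z \<Longrightarrow> b \<in> Z \<Longrightarrow> S \<subseteq> Z \<Longrightarrow> a \<in> S \<Longrightarrow> b \<notin> S \<Longrightarrow> F (insert b (S - {a})) = F S"
    and fin: "finite Z" and "S \<subseteq> Z" "T \<subseteq> Z" "card S = card T"
  shows "F S = F T"
  using assms(3,5)
proof (induction "card (S - T)" arbitrary: S rule: less_induct)
  case less
  have fST: "finite S" "finite T" using fin less.prems assms(4) finite_subset by auto
  show ?case
  proof (cases "S = T")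
    case False
    have nT: "\<not> S \<subseteq> T" using False card_subset_eq[OF fST(2), of S] less.prems by blast
    have nS: "\<not> T \<subseteq> S" using False card_subset_eq[OF fST(1), of T] less.prems by auto
    obtain a where a: "a \<in> S" "a \<notin> T" using nT by blast
    obtain b where b: "b \<in> T" "b \<notin> S" using nS by blast
    let ?S = "insert b (S - {a})"
    have "?S - T = S - T - {a}" using a b by auto
    moreover have "card (S - T - {a}) < card (S - T)" by (rule card_Diff1_less) (use a fST(1) in simp_all)
    ultimately have 1: "card (?S - T) < card (S - T)" by simp
    have aZ: "a \<in> Z" using a(1) less.prems(1) by (rule rev_subsetD)
    have bZ: "b \<in> Z" using b(1) assms(4) by (rule rev_subsetD)
    have 2: "?S \<subseteq> Z" using less.prems(1) bZ by blast
    have "card S > 0" using a(1) fST(1) card_gt_0_iff by blast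
    then have 3: "card ?S = card T" using less.prems(2) a(1) b(2) fST(1) by simp
    have "F ?S = F T" by (rule less.hyps[OF 1 2 3])
    moreover have "F ?S = F S" by (rule inv[OF aZ bZ less.prems(1) a(1) b(2)])
    ultimately show ?thesis by simp
  qed simp
qed

text \<open>Invariance under exchanges makes F a function of the cardinality. The sets of size k
  contribute a multiple of the binomial coefficient p over k, which vanishes for 0 < k < p, and the
  two extreme sets contribute 0 by \<open>zero\<close>.\<close>

lemma sum_Pow_freshman:
  fixes F :: "nat set \<Rightarrow> 'k::field"
  assumes inv: "\<And>a b S. a \<in> Z \<Longrightarrow> b \<in> Z \<Longrightarrow> S \<subseteq> Z \<Longrightarrow> a \<in> S \<Longrightarrow> b \<notin> S \<Longrightarrow> F (insert b (S - {a})) = F S"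
    and fin: "finite Z" and p: "prime (card Z)" "CHAR('k) = card Z"
    and zero: "F {} = 0" "F Z = 0"
  shows "(\<Sum>S\<in>Pow Z. F S) = 0"
proof -
  have "(\<Sum>S\<in>Pow Z. F S) = (\<Sum>k\<le>card Z. \<Sum>S\<in>{S \<in> Pow Z. card S = k}. F S)"
    by (rule sum.group[symmetric]) (use fin in \<open>auto simp: card_mono\<close>)
  also have "\<dots> = 0"
  proof (rule sum.neutral, rule ballI)
    fix k assume k: "k \<in> {..card Z}"
    consider "k = 0" | "k = card Z" | "0 < k" "k < card Z" using k by fastforce
    then show "(\<Sum>S\<in>{S \<in> Pow Z. card S = k}. F S) = 0"
    proof cases
      case 1
      show ?thesis
      proof (rule sum.neutral, rule ballI)
        fix S assume "S \<in> {S \<in> Pow Z. card S = k}"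
        then have S: "S \<subseteq> Z" "card S = 0" using 1 by simp_all
        have "S = {}" using S(2) finite_subset[OF S(1) fin] by simp
        then show "F S = 0" by (simp only: zero)
      qed
    next
      case 2
      show ?thesis
      proof (rule sum.neutral, rule ballI)
        fix S assume "S \<in> {S \<in> Pow Z. card S = k}"
        then have S: "S \<subseteq> Z" "card S = card Z" using 2 by simp_all
        have "S = Z" by (rule card_subset_eq[OF fin S])
        then show "F S = 0" by (simp only: zero)
      qed
    next
      case 3
      obtain T where T: "T \<subseteq> Z" "card T = k" using obtain_subset_with_card_n[OF less_imp_le[OF 3(2)]] by blast
      have "(\<Sum>S\<in>{S \<in> Pow Z. card S = k}. F S) = (\<Sum>S\<in>{S \<in> Pow Z. card S = k}. F T)"
      proof (intro sum.cong refl)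
        fix S assume "S \<in> {S \<in> Pow Z. card S = k}"
        then have S: "S \<subseteq> Z" "card S = card T" using T by auto
        show "F S = F T" by (rule swap_invariant_card_eq[of Z F S T, OF _ fin S(1) T(1) S(2)]) (rule inv)
      qed
      also have "\<dots> = of_nat (card Z choose k) * F T"
        using n_subsets[OF fin, of k] by simp
      also have "of_nat (card Z choose k) = (0 :: 'k)"
        unfolding of_nat_eq_0_iff_char_dvd p(2) using p(1) 3 by (intro dvd_choose_prime) auto
      finally show ?thesis by simp
    qed
  qed
  finally show ?thesis .
qed

text \<open>A word is its part outside Z together with the set of positions in Z where it is true;
  this turns sums over words into sums over subsets of Z.\<close>

lemma sum_words_split:
  assumes fin: "finite A" and Z: "Z \<subseteq> A"
  shows "(\<Sum>w\<in>words A. F w) = (\<Sum>u\<in>words (A - Z). \<Sum>S\<in>Pow Z. F (\<lambda>j. u j \<or> j \<in> S))"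
proof -
  have "(\<Sum>w\<in>words A. F w) = (\<Sum>q\<in>words (A - Z) \<times> Pow Z. F (\<lambda>j. fst q j \<or> j \<in> snd q))"
  proof (rule sum.reindex_bij_witness[where i = "\<lambda>q j. fst q j \<or> j \<in> snd q"
        and j = "\<lambda>w. (\<lambda>j. w j \<and> j \<notin> Z, {j \<in> Z. w j})"])
    fix w assume w: "w \<in> words A"
    show "(\<lambda>j. fst (\<lambda>j. w j \<and> j \<notin> Z, {j \<in> Z. w j}) j \<or> j \<in> snd (\<lambda>j. w j \<and> j \<notin> Z, {j \<in> Z. w j})) = w"
      by (auto simp: fun_eq_iff)
    then show "F (\<lambda>j. fst (\<lambda>j. w j \<and> j \<notin> Z, {j \<in> Z. w j}) j \<or> j \<in> snd (\<lambda>j. w j \<and> j \<notin> Z, {j \<in> Z. w j})) = F w"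
      by simp
    show "(\<lambda>j. w j \<and> j \<notin> Z, {j \<in> Z. w j}) \<in> words (A - Z) \<times> Pow Z"
      using w by (auto simp: words_def)
  next
    fix q assume q: "q \<in> words (A - Z) \<times> Pow Z"
    obtain u S where uS: "q = (u, S)" by (cases q)
    have u: "u j \<Longrightarrow> j \<in> A - Z" for j using q uS by (auto simp: words_def)
    have S: "S \<subseteq> Z" using q uS by auto
    have "(\<lambda>j. (u j \<or> j \<in> S) \<and> j \<notin> Z) = u" using u S by (auto simp: fun_eq_iff)
    moreover have "{j \<in> Z. u j \<or> j \<in> S} = S" using u S by auto
    ultimately show "(\<lambda>j. (fst q j \<or> j \<in> snd q) \<and> j \<notin> Z, {j \<in> Z. fst q j \<or> j \<in> snd q}) = q" by (simp add: uS)
    show "(\<lambda>j. fst q j \<or> j \<in> snd q) \<in> words A" using u S Z uS by (auto simp: words_def)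
  qed
  then show ?thesis by (simp add: sum.cartesian_product case_prod_unfold)
qed

definition const_on :: "nat set \<Rightarrow> (nat \<Rightarrow> bool) \<Rightarrow> bool" where
  "const_on Z w \<longleftrightarrow> (\<forall>i\<in>Z. \<forall>j\<in>Z. w i = w j)"

lemma const_onI: "(\<And>i j. i \<in> Z \<Longrightarrow> j \<in> Z \<Longrightarrow> w i = w j) \<Longrightarrow> const_on Z w"
  unfolding const_on_def by (intro ballI)

lemma const_onD: "const_on Z w \<Longrightarrow> i \<in> Z \<Longrightarrow> j \<in> Z \<Longrightarrow> w i = w j"
  unfolding const_on_def by blast

lemma const_on_cong:
  assumes "\<And>j. j \<in> Z \<Longrightarrow> w j = w' j"
  shows "const_on Z w = const_on Z w'"
  by (simp add: const_on_def assms)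

lemma const_on_swp_eq:
  assumes "const_on Z w" "a \<in> Z" "b \<in> Z"
  shows "swp a b w = w"
proof -
  have "w a = w b" by (rule const_onD[OF assms])
  then show ?thesis by (auto simp: swp_def fun_eq_iff)
qed

lemma sum_words_freshman:
  fixes F :: "(nat \<Rightarrow> bool) \<Rightarrow> 'k::field"
  assumes fin: "finite A" and Z: "Z \<subseteq> A" and p: "prime (card Z)" "CHAR('k) = card Z"
    and inv: "\<And>a b w. a \<in> Z \<Longrightarrow> b \<in> Z \<Longrightarrow> F (swp a b w) = F w"
    and zero: "\<And>w. const_on Z w \<Longrightarrow> F w = 0"
  shows "(\<Sum>w\<in>words A. F w) = 0"
  unfolding sum_words_split[OF fin Z]
proof (rule sum.neutral, rule ballI)
  fix u assume u: "u \<in> words (A - Z)"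
  then have uZ: "\<not> u j" if "j \<in> Z" for j using that by (auto simp: words_def)
  show "(\<Sum>S\<in>Pow Z. F (\<lambda>j. u j \<or> j \<in> S)) = 0"
  proof (rule sum_Pow_freshman)
    fix a b S assume ab: "a \<in> Z" "b \<in> Z" "S \<subseteq> Z" "a \<in> S" "b \<notin> S"
    have "swp a b (\<lambda>j. u j \<or> j \<in> S) = (\<lambda>j. u j \<or> j \<in> insert b (S - {a}))"
      using ab uZ[OF ab(1)] uZ[OF ab(2)] by (auto simp: swp_def fun_eq_iff)
    then show "F (\<lambda>j. u j \<or> j \<in> insert b (S - {a})) = F (\<lambda>j. u j \<or> j \<in> S)"
      using inv[OF ab(1,2), of "\<lambda>j. u j \<or> j \<in> S"] by simp
  next
    show "F (\<lambda>j. u j \<or> j \<in> {}) = 0" by (rule zero, rule const_onI) (simp add: uZ)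
    show "F (\<lambda>j. u j \<or> j \<in> Z) = 0" by (rule zero, rule const_onI) simp
  qed (rule finite_subset[OF Z fin], rule p(1), rule p(2))
qed

text \<open>Extension by zero from the words constant on Z, on which the p positions of Z behave
  like the single position z. The map in the other direction is substitution of
  \<open>diag_word\<close>.\<close>

definition restrict_diag :: "nat set \<Rightarrow> ((nat \<Rightarrow> bool) \<Rightarrow> 'k::field) \<Rightarrow> (nat \<Rightarrow> bool) \<Rightarrow> 'k" where
  "restrict_diag Z \<phi> w = (if const_on Z w then \<phi> w else 0)"

lemma op_linear_restrict_diag: "op_linear (restrict_diag Z)"
  by (rule op_linearI) (simp_all add: restrict_diag_def fun_eq_iff)

lemma depends_on_restrict_diag:
  assumes "Z \<subseteq> A" "z \<in> Z" "depends_on (insert z (A - Z)) \<phi>"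
  shows "depends_on A (restrict_diag Z \<phi>)"
proof (rule depends_onI)
  fix w w' :: "nat \<Rightarrow> bool" assume e: "\<And>j. j \<in> A \<Longrightarrow> w j = w' j"
  have eZ: "w j = w' j" if "j \<in> Z" for j using e assms(1) that by blast
  have "\<phi> w = \<phi> w'" by (rule depends_onD[OF assms(3)]) (use e eZ assms in blast)
  then show "restrict_diag Z \<phi> w = restrict_diag Z \<phi> w'" using const_on_cong[of Z w w', OF eZ] by (simp add: restrict_diag_def)
qed

lemma restrict_diag_swp:
  assumes "a \<in> Z" "b \<in> Z"
  shows "restrict_diag Z \<phi> (swp a b w) = restrict_diag Z \<phi> w"
proof (cases "const_on Z w")
  case True
  then have "swp a b w = w" by (rule const_on_swp_eq[OF _ assms])
  then show ?thesis by simp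
next
  case False
  have "\<not> (const_on Z (swp a b w))"
  proof
    assume h: "const_on Z (swp a b w)"
    then have "swp a b (swp a b w) = swp a b w" by (rule const_on_swp_eq[OF _ assms])
    then show False using False h by simp
  qed
  then show ?thesis using False by (simp only: restrict_diag_def if_False)
qed

text \<open>On words constant on Z the p equal positions contribute the p-th power of one matrix
  entry. This is an entry of the Frobenius twist, carried by z alone.\<close>

definition frob_at :: "nat \<Rightarrow> nat \<Rightarrow> ('g \<Rightarrow> bool \<Rightarrow> bool \<Rightarrow> 'k::field) \<Rightarrow> nat \<Rightarrow> 'g \<Rightarrow> bool \<Rightarrow> bool \<Rightarrow> 'k" where
  "frob_at p z t = (\<lambda>j g x y. if j = z then t g x y ^ p else t g x y)"

definition diag_word :: "nat set \<Rightarrow> nat \<Rightarrow> (nat \<Rightarrow> bool) \<Rightarrow> nat \<Rightarrow> bool" where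
  "diag_word Z z w = (\<lambda>j. if j \<in> Z then w z else w j)"

text \<open>Only words constant on Z survive in the sum. They correspond to words over
  \<open>insert z (A - Z)\<close>, and their equal factors over Z merge into one power.\<close>

lemma act_restrict_diag:
  fixes t :: "'g \<Rightarrow> bool \<Rightarrow> bool \<Rightarrow> 'k::field"
  assumes fin: "finite A" and Z: "Z \<subseteq> A" "z \<in> Z"
  shows "act A (\<lambda>_. t) g (restrict_diag Z \<phi>) (diag_word Z z v)
    = act (insert z (A - Z)) (frob_at (card Z) z t) g (\<lambda>w. \<phi> (diag_word Z z w)) v"
proof -
  let ?B = "insert z (A - Z)" and ?D = "diag_word Z z"
  have pr: "(\<Prod>j\<in>A. t g (?D v j) (?D w j)) = (\<Prod>j\<in>?B. frob_at (card Z) z t j g (v j) (w j))" for w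
  proof -
    have "(\<Prod>j\<in>A. t g (?D v j) (?D w j)) = (\<Prod>j\<in>A - Z. t g (?D v j) (?D w j)) * (\<Prod>j\<in>Z. t g (?D v j) (?D w j))"
      by (rule prod.subset_diff[OF Z(1) fin])
    also have "(\<Prod>j\<in>Z. t g (?D v j) (?D w j)) = t g (v z) (w z) ^ card Z"
      by (simp add: diag_word_def)
    also have "(\<Prod>j\<in>A - Z. t g (?D v j) (?D w j)) = (\<Prod>j\<in>A - Z. frob_at (card Z) z t j g (v j) (w j))"
      using Z(2) by (intro prod.cong) (auto simp: diag_word_def frob_at_def)
    also have "t g (v z) (w z) ^ card Z = frob_at (card Z) z t z g (v z) (w z)"
      by (simp add: frob_at_def)
    finally show ?thesis using fin Z(2) by (simp add: mult.commute)
  qed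
  let ?W = "{w \<in> words A. const_on Z w}"
  have "act A (\<lambda>_. t) g (restrict_diag Z \<phi>) (?D v) = (\<Sum>w\<in>?W. (\<Prod>j\<in>A. t g (?D v j) (w j)) * \<phi> w)"
    unfolding act_def using fin by (intro sum.mono_neutral_cong_right) (auto simp: restrict_diag_def)
  also have "\<dots> = (\<Sum>w\<in>words ?B. (\<Prod>j\<in>A. t g (?D v j) (?D w j)) * \<phi> (?D w))"
  proof (rule sum.reindex_bij_witness[where i = ?D and j = "\<lambda>w j. w j \<and> j \<in> ?B"])
    fix w assume w: "w \<in> ?W"
    have eq: "?D (\<lambda>j. w j \<and> j \<in> ?B) = w"
    proof
      fix j
      show "?D (\<lambda>j. w j \<and> j \<in> ?B) j = w j"
      proof (cases "j \<in> Z")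
        case True
        then have "w j = w z" using w Z(2) by (intro const_onD[of Z w]) auto
        then show ?thesis using True by (simp add: diag_word_def)
      next
        case False
        then show ?thesis using w by (auto simp: diag_word_def words_def)
      qed
    qed
    show "?D (\<lambda>j. w j \<and> j \<in> ?B) = w" by (rule eq)
    show "(\<Prod>j\<in>A. t g (?D v j) (?D (\<lambda>j. w j \<and> j \<in> ?B) j)) * \<phi> (?D (\<lambda>j. w j \<and> j \<in> ?B))
      = (\<Prod>j\<in>A. t g (?D v j) (w j)) * \<phi> w" unfolding eq ..
    show "(\<lambda>j. w j \<and> j \<in> ?B) \<in> words ?B" by (simp add: words_def)
  next
    fix w assume w: "w \<in> words ?B"
    then have w': "w j \<Longrightarrow> j = z \<or> j \<in> A \<and> j \<notin> Z" for j by (auto simp: words_def)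
    show "(\<lambda>j. ?D w j \<and> j \<in> ?B) = w"
    proof
      fix j show "(?D w j \<and> j \<in> ?B) = w j" using w'[of j] Z(2) by (auto simp: diag_word_def)
    qed
    have "?D w j \<Longrightarrow> j \<in> A" for j using w'[of j] Z by (auto simp: diag_word_def split: if_splits)
    moreover have "const_on Z (?D w)" by (rule const_onI) (simp add: diag_word_def)
    ultimately show "?D w \<in> ?W" by (simp add: words_def)
  qed
  finally show ?thesis by (simp only: pr act_def)
qed

text \<open>At a diagonal argument the matrix coefficient is symmetric over Z, as \<phi> is, so the
  words not constant on Z cancel in orbits of size divisible by p. On symmetric functions,
  restriction to the diagonal is therefore equivariant.\<close>

lemma act_symmetric_vanish:
  fixes t :: "'g \<Rightarrow> bool \<Rightarrow> bool \<Rightarrow> 'k::field"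
  assumes fin: "finite A" and Z: "Z \<subseteq> A" "z \<in> Z" and p: "prime (card Z)" "CHAR('k) = card Z"
    and inv: "\<And>a b w. a \<in> Z \<Longrightarrow> b \<in> Z \<Longrightarrow> \<phi> (swp a b w) = \<phi> w"
  shows "act A (\<lambda>_. t) g \<phi> (diag_word Z z v) = act A (\<lambda>_. t) g (restrict_diag Z \<phi>) (diag_word Z z v)"
proof -
  let ?v = "diag_word Z z v"
  let ?F = "\<lambda>w. (\<Prod>j\<in>A. t g (?v j) (w j)) * (\<phi> w - restrict_diag Z \<phi> w)"
  have "(\<Sum>w\<in>words A. ?F w) = 0"
  proof (rule sum_words_freshman[OF fin Z(1) p])
    fix a b w assume ab: "a \<in> Z" "b \<in> Z"
    then have abA: "a \<in> A" "b \<in> A" using Z by auto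
    have "swp a b ?v = ?v" using ab by (auto simp: swp_def diag_word_def fun_eq_iff)
    moreover have "(\<Prod>j\<in>A. t g (?v j) (swp a b w j)) = (\<Prod>j\<in>A. t g (swp a b ?v j) (w j))"
      by (rule prod.reindex_bij_witness[of _ "\<lambda>j. if j = a then b else if j = b then a else j"
            "\<lambda>j. if j = a then b else if j = b then a else j"])
         (use abA in \<open>auto simp: swp_def split: if_splits\<close>)
    ultimately have pr: "(\<Prod>j\<in>A. t g (?v j) (swp a b w j)) = (\<Prod>j\<in>A. t g (?v j) (w j))" by simp
    show "?F (swp a b w) = ?F w" by (simp only: pr inv[OF ab] restrict_diag_swp[OF ab])
  next
    fix w :: "nat \<Rightarrow> bool" assume "const_on Z w"
    then have "restrict_diag Z \<phi> w = \<phi> w" by (simp only: restrict_diag_def if_True)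
    then show "?F w = 0" by simp
  qed
  then show ?thesis by (simp add: act_def algebra_simps sum_subtractf)
qed

lemma agree_swp:
  assumes "a \<in> A" "b \<in> A" "\<forall>j\<in>A. u j = swp a b w j"
  shows "\<forall>j\<in>A. swp a b u j = w j"
proof
  fix j assume "j \<in> A"
  then show "swp a b u j = w j"
    using bspec[OF assms(3,1)] bspec[OF assms(3,2)] bspec[OF assms(3), of j]
    by (simp add: swp_def split: if_splits)
qed

text \<open>By \<open>pol_evs_swap\<close> the image of a basis vector depends only on its orbit.
  The operator thus sums a symmetric function over orbits under permutations of Z, whose sizes
  vanish modulo p away from the words constant on Z.\<close>

lemma pol_symmetric_vanish:
  fixes \<phi> :: "(nat \<Rightarrow> bool) \<Rightarrow> 'k::field"
  assumes fin: "finite A" and Z: "Z \<subseteq> A" and p: "prime (card Z)" "CHAR('k) = card Z"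
    and dep: "depends_on A \<phi>"
    and inv: "\<And>a b w. a \<in> Z \<Longrightarrow> b \<in> Z \<Longrightarrow> \<phi> (swp a b w) = \<phi> w"
    and zero: "\<And>w. const_on Z w \<Longrightarrow> \<phi> w = 0"
  shows "pol A (evs (card A)) \<phi> = (\<lambda>w. 0)"
proof
  fix v
  let ?Q = "pol A (evs (card A)) :: ((nat \<Rightarrow> bool) \<Rightarrow> 'k) \<Rightarrow> _"
  note lin = op_linear_pol[OF fin]
  have "\<phi> = (\<lambda>u. \<Sum>w\<in>words A. \<phi> w * point A w u)"
    by (rule ext) (rule depends_on_expand[OF fin dep])
  then have "?Q \<phi> v = ?Q (\<lambda>u. \<Sum>w\<in>words A. \<phi> w * point A w u) v"
    by (rule arg_cong[of _ _ "\<lambda>f. ?Q f v"])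
  also have "\<dots> = (\<Sum>w\<in>words A. \<phi> w * ?Q (point A w) v)"
    by (simp only: op_linear_sum[OF lin] op_linear_scale[OF lin])
  also have "\<dots> = 0"
  proof (rule sum_words_freshman[OF fin Z p])
    fix a b w assume ab: "a \<in> Z" "b \<in> Z"
    then have abA: "a \<in> A" "b \<in> A" using Z by auto
    have "(point A (swp a b w) :: _ \<Rightarrow> 'k) = swap_op a b (point A w)"
    proof
      fix u
      have "(\<forall>j\<in>A. u j = swp a b w j) \<longleftrightarrow> (\<forall>j\<in>A. swp a b u j = w j)"
        using agree_swp[OF abA, of u w] agree_swp[OF abA, of w u] by (metis (full_types))
      then show "point A (swp a b w) u = (swap_op a b (point A w) u :: 'k)"
        by (simp only: point_def swap_op_def)
    qed
    then have "?Q (point A (swp a b w)) = ?Q (point A w)"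
      using pol_evs_swap[OF fin abA depends_on_point] by simp
    then show "\<phi> (swp a b w) * ?Q (point A (swp a b w)) v = \<phi> w * ?Q (point A w) v"
      using inv[OF ab] by simp
  qed (simp add: zero)
  finally show "?Q \<phi> v = 0" .
qed

text \<open>The Frobenius twist enters here: a \<open>p\<close>-fold symmetric power of the natural module contains
  its twist, and everything in between vanishes by the binomial theorem modulo \<open>p\<close>.\<close>

lemma erep_frobenius_homs:
  fixes t :: "'g \<Rightarrow> bool \<Rightarrow> bool \<Rightarrow> 'k::field"
  assumes fin: "finite A" and Z: "Z \<subseteq> A" "z \<in> Z" and p: "prime (card Z)" "CHAR('k) = card Z"
  defines "B \<equiv> insert z (A - Z)" and "\<tau> \<equiv> frob_at (card Z) z t" and "Q \<equiv> pol A (evs (card A))"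
  shows "op_hom G A (\<lambda>_. t) B \<tau> (\<lambda>\<phi> w. Q \<phi> (diag_word Z z w))"
    and "op_hom G B \<tau> A (\<lambda>_. t) (\<lambda>\<psi>. Q (restrict_diag Z \<psi>))"
    and "depends_on A \<phi> \<Longrightarrow> Q (restrict_diag Z (\<lambda>w. Q \<phi> (diag_word Z z w))) = Q (Q \<phi>)"
proof -
  let ?D = "diag_word Z z"
  have Qh: "op_hom G A (\<lambda>_. t) A (\<lambda>_. t) Q" for G :: "'g set" unfolding Q_def by (rule op_hom_pol[OF fin])
  note lin = op_homD(1)[OF Qh] and dep = op_homD(2)[OF Qh]
  have sym: "Q \<phi> (swp a b w) = Q \<phi> w" if d: "depends_on A \<phi>" and ab: "a \<in> A" "b \<in> A" for a b w \<phi>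
    using fun_cong[OF pol_swap[OF fin ab, of "evs (card A)" \<phi>], of w] fun_cong[OF pol_evs_swap[OF fin ab d], of w]
    by (simp add: Q_def swap_op_def)
  have dD: "depends_on B (\<lambda>w. \<phi> (?D w))" if d: "depends_on A \<phi>" for \<phi> :: "(nat \<Rightarrow> bool) \<Rightarrow> 'k"
  proof (rule depends_onI)
    fix w w' :: "nat \<Rightarrow> bool" assume e: "\<And>j. j \<in> B \<Longrightarrow> w j = w' j"
    show "\<phi> (?D w) = \<phi> (?D w')" by (rule depends_onD[OF d]) (simp add: diag_word_def e B_def)
  qed
  have DD: "\<phi> (?D w) = \<phi> w" if d: "depends_on A \<phi>" and w: "const_on Z w" for \<phi> :: "(nat \<Rightarrow> bool) \<Rightarrow> 'k" and w
  proof (rule depends_onD[OF d])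
    fix j show "?D w j = w j" using const_onD[OF w Z(2), of j] by (simp add: diag_word_def)
  qed
  show "op_hom G A (\<lambda>_. t) B \<tau> (\<lambda>\<phi> w. Q \<phi> (?D w))"
  proof (rule op_homI)
    show "op_linear (\<lambda>\<phi> w. Q \<phi> (?D w))"
      by (rule op_linearI) (simp_all only: op_linear_add[OF lin] op_linear_scale[OF lin])
    fix \<phi> :: "(nat \<Rightarrow> bool) \<Rightarrow> 'k" assume d: "depends_on A \<phi>"
    show "depends_on B (\<lambda>w. Q \<phi> (?D w))" by (rule dD[OF dep[OF d]])
    fix g assume "g \<in> G"
    then have "Q (act A (\<lambda>_. t) g \<phi>) = act A (\<lambda>_. t) g (Q \<phi>)" by (rule op_homD(3)[OF Qh _ d])
    moreover have "act A (\<lambda>_. t) g (Q \<phi>) (?D w) = act B \<tau> g (\<lambda>w. Q \<phi> (?D w)) w" for w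
      unfolding B_def \<tau>_def act_restrict_diag[OF fin Z, symmetric]
      by (rule act_symmetric_vanish[OF fin Z p]) (rule sym[OF d], use Z in auto)
    ultimately show "(\<lambda>w. Q (act A (\<lambda>_. t) g \<phi>) (?D w)) = act B \<tau> g (\<lambda>w. Q \<phi> (?D w))" by simp
  qed
  show "op_hom G B \<tau> A (\<lambda>_. t) (\<lambda>\<psi>. Q (restrict_diag Z \<psi>))"
  proof (rule op_homI)
    show "op_linear (\<lambda>\<psi>. Q (restrict_diag Z \<psi>))"
      by (rule op_linearI) (simp_all only: op_linear_add[OF lin] op_linear_scale[OF lin]
          op_linear_add[OF op_linear_restrict_diag] op_linear_scale[OF op_linear_restrict_diag])
    fix \<psi> :: "(nat \<Rightarrow> bool) \<Rightarrow> 'k" assume d: "depends_on B \<psi>"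
    have r: "depends_on A (restrict_diag Z \<psi>')" if "depends_on B \<psi>'" for \<psi>' :: "(nat \<Rightarrow> bool) \<Rightarrow> 'k"
      by (rule depends_on_restrict_diag[OF Z]) (use that in \<open>simp add: B_def\<close>)
    show "depends_on A (Q (restrict_diag Z \<psi>))" by (rule dep[OF r[OF d]])
    fix g assume g: "g \<in> G"
    let ?x = "act A (\<lambda>_. t) g (restrict_diag Z \<psi>)" and ?y = "restrict_diag Z (act B \<tau> g \<psi>)"
    have Zf: "a \<in> A" if "a \<in> Z" for a using that Z by auto
    \<comment> \<open>Extension by zero alone commutes with the action only up to an error off the
      diagonal. The error is symmetric over Z and vanishes on words constant on Z, so Q removes
      it.\<close>
    have "Q (\<lambda>w. ?x w - ?y w) = (\<lambda>w. 0)"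
      unfolding Q_def
    proof (rule pol_symmetric_vanish[OF fin Z(1) p])
      show "depends_on A (\<lambda>w. ?x w - ?y w)"
        by (rule depends_on_compose2) (simp, rule r, simp)
      fix a b w assume ab: "a \<in> Z" "b \<in> Z"
      have "swap_op a b (restrict_diag Z \<psi>) = restrict_diag Z \<psi>"
        by (rule ext) (simp only: swap_op_def restrict_diag_swp[OF ab])
      then have "?x (swp a b w) = ?x w"
        using fun_cong[OF act_swap[OF Zf[OF ab(1)] Zf[OF ab(2)] fin, of t g "restrict_diag Z \<psi>"], of w]
        by (simp add: swap_op_def)
      then show "?x (swp a b w) - ?y (swp a b w) = ?x w - ?y w" by (simp only: restrict_diag_swp[OF ab])
    next
      fix w :: "nat \<Rightarrow> bool" assume w: "const_on Z w"
      have ps: "(\<lambda>w. \<psi> (?D w)) = \<psi>"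
      proof
        fix w show "\<psi> (?D w) = \<psi> w" by (rule depends_onD[OF d]) (auto simp: diag_word_def B_def)
      qed
      have "?x w = ?x (?D w)" by (rule DD[OF depends_on_act w, symmetric])
      also have "\<dots> = act B \<tau> g \<psi> w"
        unfolding act_restrict_diag[OF fin Z] ps B_def \<tau>_def ..
      also have "\<dots> = ?y w" using w by (simp only: restrict_diag_def if_True)
      finally show "?x w - ?y w = 0" by simp
    qed
    then have "Q ?y = Q ?x"
      unfolding op_linear_diff[OF lin] by (simp add: fun_eq_iff)
    also have "\<dots> = act A (\<lambda>_. t) g (Q (restrict_diag Z \<psi>))"
      by (rule op_homD(3)[OF Qh g r[OF d]])
    finally show "Q ?y = act A (\<lambda>_. t) g (Q (restrict_diag Z \<psi>))" .
  qed
  assume d: "depends_on A \<phi>"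
  have e: "restrict_diag Z (\<lambda>w. Q \<phi> (?D w)) = restrict_diag Z (Q \<phi>)"
  proof
    fix w
    show "restrict_diag Z (\<lambda>w. Q \<phi> (?D w)) w = restrict_diag Z (Q \<phi>) w"
      using DD[OF dep[OF d], of w] by (simp only: restrict_diag_def split: if_split) simp
  qed
  \<comment> \<open>Cutting Q \<phi> down to the diagonal changes it by a function symmetric over Z
    that vanishes on the diagonal, which a second application of Q does not see.\<close>
  have "Q (\<lambda>w. Q \<phi> w - restrict_diag Z (Q \<phi>) w) = (\<lambda>w. 0)"
    unfolding Q_def[THEN meta_eq_to_obj_eq, THEN fun_cong, of "\<lambda>w. Q \<phi> w - restrict_diag Z (Q \<phi>) w"]
  proof (rule pol_symmetric_vanish[OF fin Z(1) p])
    have "depends_on A (restrict_diag Z (\<lambda>w. Q \<phi> (?D w)))"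
      by (rule depends_on_restrict_diag[OF Z]) (use dD[OF dep[OF d]] in \<open>simp add: B_def\<close>)
    then show "depends_on A (\<lambda>w. Q \<phi> w - restrict_diag Z (Q \<phi>) w)"
      unfolding e by (rule depends_on_compose2[OF dep[OF d]])
    fix a b w assume ab: "a \<in> Z" "b \<in> Z"
    then have "a \<in> A" "b \<in> A" using Z by auto
    then show "Q \<phi> (swp a b w) - restrict_diag Z (Q \<phi>) (swp a b w) = Q \<phi> w - restrict_diag Z (Q \<phi>) w"
      by (simp only: restrict_diag_swp[OF ab] sym[OF d])
  next
    fix w :: "nat \<Rightarrow> bool" assume "const_on Z w"
    then have "restrict_diag Z (Q \<phi>) w = Q \<phi> w" by (simp only: restrict_diag_def if_True)
    then show "Q \<phi> w - restrict_diag Z (Q \<phi>) w = 0" by simp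
  qed
  then show "Q (restrict_diag Z (\<lambda>w. Q \<phi> (?D w))) = Q (Q \<phi>)"
    unfolding e op_linear_diff[OF lin] by (simp add: fun_eq_iff)
qed

text \<open>For m = 2p - 1 the values are k (2p - k) with 1 \<le> k < p, and p divides neither
  factor. For p \<le> m < 2p - 1 the list would contain a multiple of p, namely the value at k = m +
  1 - p.\<close>

lemma prod_list_evs_nonzero:
  assumes p: "prime p" "CHAR('k::field) = p"
  shows "prod_list (map uminus (evs (2 * p - 1) :: 'k list)) \<noteq> 0"
proof -
  have "of_nat k * (of_nat (2 * p - 1 + 1) - of_nat k) \<noteq> (0 :: 'k)" if k: "1 \<le> k" "k < (2 * p - 1) div 2 + 1" for k
  proof -
    have pp: "p > 0" "k < p" using k prime_gt_0_nat[OF p(1)] by auto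
    have "\<not> p dvd k" using k pp by (auto dest: dvd_imp_le)
    moreover have "\<not> p dvd 2 * p - k"
    proof
      assume "p dvd 2 * p - k"
      then obtain c where c: "2 * p - k = p * c" by (elim dvdE)
      have "p * 1 < p * c" "p * c < p * 2" using c pp k(1) by linarith+
      then have "1 < c" "c < 2" by (simp_all only: mult_less_cancel1)
      then show False by simp
    qed
    moreover have "of_nat (2 * p - 1 + 1) - of_nat k = (of_nat (2 * p - k) :: 'k)"
      using pp by (simp add: of_nat_diff)
    ultimately show ?thesis by (simp add: of_nat_eq_0_iff_char_dvd p(2))
  qed
  then show ?thesis by (auto simp: evs_def prod_list_zero_iff)
qed

text \<open>Write Q = c + \<open>casimir\<close> R with the nonzero constant term c, so that 1 = Q /
  c - \<open>casimir\<close> R / c. Here \<open>casimir\<close> passes through two factors fewer.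
  Moreover Q Q = c Q, since \<open>casimir\<close> kills symmetric tensors and commutes with R;
  hence Q / c = Q Q / c^2, and Q Q factors through the Frobenius twist by way of the
  diagonal.\<close>

theorem erep_reduction:
  fixes t :: "'g \<Rightarrow> bool \<Rightarrow> bool \<Rightarrow> 'k::field"
  assumes t: "unimodular G t" and fin: "finite A" and p: "prime p" "CHAR('k) = p" and card: "card A = 2 * p - 1"
    and Z: "Z \<subseteq> A" "z \<in> Z" "card Z = p"
  shows "inadd G (erep A (\<lambda>_. t))
    (insert (erep (insert z (A - Z)) (frob_at p z t)) {erep (A - {a, b}) (\<lambda>_. t) | a b. a \<in> A \<and> b \<in> A \<and> a \<noteq> b})"
    (is "inadd G ?E ?\<B>")
proof -
  let ?Q = "pol A (evs (card A)) :: ((nat \<Rightarrow> bool) \<Rightarrow> 'k) \<Rightarrow> _"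
  let ?R = "pol_rem A (evs (card A)) :: ((nat \<Rightarrow> bool) \<Rightarrow> 'k) \<Rightarrow> _"
  let ?B = "insert z (A - Z)"
  let ?h = "\<lambda>\<phi> w. ?Q \<phi> (diag_word Z z w)" and ?f = "\<lambda>\<psi>. ?Q (restrict_diag Z \<psi>)"
  define c where "c = prod_list (map uminus (evs (card A) :: 'k list))"
  have c: "c \<noteq> 0" unfolding c_def card by (rule prod_list_evs_nonzero[OF p])
  have p': "prime (card Z)" "CHAR('k) = card Z" using p Z(3) by auto
  note fr = erep_frobenius_homs(1,2)[OF fin Z(1,2) p', where t = t and G = G, unfolded Z(3)]
    and fr3 = erep_frobenius_homs(3)[OF fin Z(1,2) p']
  have fB: "finite ?B" using fin by simp
  have 1: "fac G ?E ?\<B> (op_mat A A (\<lambda>\<phi>. ?f (\<lambda>w. (1 / c\<^sup>2) * ?h \<phi> w)))"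
    by (rule fac_op_mat[OF fin fB fr(2) op_hom_scale[OF fr(1)]]) simp
  have 2: "fac G ?E ?\<B> (op_mat A A (\<lambda>\<phi>. cup (fst q) (snd q) (\<lambda>w. (- 1 / c) * cap (fst q) (snd q) (?R \<phi>) w)))"
    if q: "q \<in> pairs A" for q
  proof -
    have ab: "fst q \<in> A" "snd q \<in> A" "fst q \<noteq> snd q" using q by (cases q; auto simp: pairs_def)+
    have fq: "finite (A - {fst q, snd q})" using fin by simp
    show ?thesis
      by (rule fac_op_mat[OF fin fq op_hom_cup[OF t ab fin]
            op_hom_scale[OF op_hom_comp[OF op_hom_pol_rem[OF fin] op_hom_cap[OF t ab fin]]]]) (use ab in blast)
  qed
  have QQ: "?Q (?Q \<phi>) w = c * ?Q \<phi> w" if d: "depends_on A \<phi>" for \<phi> w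
  proof -
    have s: "swap_op a b (?Q \<phi>) = ?Q \<phi>" if "(a, b) \<in> pairs A" for a b
    proof -
      have ab: "a \<in> A" "b \<in> A" using that by (simp_all add: pairs_def)
      show ?thesis using pol_swap[OF fin ab, of "evs (card A)" \<phi>] pol_evs_swap[OF fin ab d] by simp
    qed
    have "casimir A (?Q \<phi>) = (\<lambda>w. 0)"
      by (rule ext) (auto simp: casimir_def s intro!: sum.neutral)
    have "casimir A (pol_rem A (evs (card A)) (?Q \<phi>)) w = pol_rem A (evs (card A)) (casimir A (?Q \<phi>)) w"
      by (simp only: pol_rem_casimir)
    also have "\<dots> = 0"
      unfolding \<open>casimir A (?Q \<phi>) = (\<lambda>w. 0)\<close> op_linear_zero[OF op_homD(1)[OF op_hom_pol_rem[OF fin]]] ..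
    finally show ?thesis unfolding pol_decompose[of A "evs (card A)" "?Q \<phi>"] by (simp add: c_def)
  qed
  have id: "\<phi> w = ?f (\<lambda>w. (1 / c\<^sup>2) * ?h \<phi> w) w + (\<Sum>q\<in>pairs A. cup (fst q) (snd q) (\<lambda>w. (- 1 / c) * cap (fst q) (snd q) (?R \<phi>) w) w)"
    if d: "depends_on A \<phi>" for \<phi> w
  proof -
    have "?f (\<lambda>w. (1 / c\<^sup>2) * ?h \<phi> w) w = (1 / c\<^sup>2) * ?f (?h \<phi>) w"
      using fun_cong[OF op_linear_scale[OF op_homD(1)[OF fr(2)]], of "1 / c\<^sup>2" "?h \<phi>" w] by simp
    also have "?f (?h \<phi>) w = c * ?Q \<phi> w" by (rule trans[OF fun_cong[OF fr3[OF d], of w] QQ[OF d]])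
    also have "(1 / c\<^sup>2) * (c * ?Q \<phi> w) = (1 / c) * ?Q \<phi> w" using c by (simp add: power2_eq_square)
    finally have f: "?f (\<lambda>w. (1 / c\<^sup>2) * ?h \<phi> w) w = (1 / c) * ?Q \<phi> w" .
    have "(\<Sum>q\<in>pairs A. cup (fst q) (snd q) (\<lambda>w. (- 1 / c) * cap (fst q) (snd q) (?R \<phi>) w) w)
       = (- 1 / c) * casimir A (?R \<phi>) w"
      unfolding casimir_cup_cap sum_distrib_left cup_def case_prod_unfold
      by (intro sum.cong refl) (rule mult.left_commute)
    moreover have "?Q \<phi> w = c * \<phi> w + casimir A (?R \<phi>) w" unfolding c_def by (rule pol_decompose)
    ultimately show ?thesis unfolding f using c by (simp add: field_simps)
  qed
  have "(\<lambda>v w. op_mat A A (\<lambda>\<phi>. ?f (\<lambda>w. (1 / c\<^sup>2) * ?h \<phi> w)) v w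
      + (\<Sum>q\<in>pairs A. op_mat A A (\<lambda>\<phi>. cup (fst q) (snd q) (\<lambda>w. (- 1 / c) * cap (fst q) (snd q) (?R \<phi>) w)) v w)) = idm (words A)"
  proof (intro ext)
    fix v w
    show "op_mat A A (\<lambda>\<phi>. ?f (\<lambda>w. (1 / c\<^sup>2) * ?h \<phi> w)) v w
      + (\<Sum>q\<in>pairs A. op_mat A A (\<lambda>\<phi>. cup (fst q) (snd q) (\<lambda>w. (- 1 / c) * cap (fst q) (snd q) (?R \<phi>) w)) v w) = idm (words A) v w"
    proof (cases "v \<in> words A \<and> w \<in> words A")
      case True
      then show ?thesis
        unfolding op_mat_id[symmetric] using id[OF depends_on_point, of w v] by (simp add: op_mat_def)
    qed (auto simp: op_mat_def idm_def)
  qed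
  from this[symmetric] show ?thesis
    unfolding inadd_def fst_erep by (rule ssubst) (rule fac_add[OF fac_sum[OF 2] 1])
qed

section \<open>Products of Frobenius twists and their finite cover\<close>

lemma erep_reindex:
  fixes \<tau> :: "nat \<Rightarrow> 'g \<Rightarrow> bool \<Rightarrow> bool \<Rightarrow> 'k::field"
  assumes f: "bij_betw f A B" and fin: "finite A"
    and eq: "\<And>j g x y. j \<in> A \<Longrightarrow> g \<in> G \<Longrightarrow> \<tau> j g x y = \<tau>' (f j) g x y"
  shows "inadd G (erep A \<tau>) {erep B \<tau>'}"
proof (rule inadd_reindex)
  let ?\<pi> = "\<lambda>w j. j \<in> B \<and> w (inv_into A f j)"
  have inj: "inj_on f A" and im: "f ` A = B" using f by (auto simp: bij_betw_def)
  have inv: "inv_into A f (f j) = j" if "j \<in> A" for j using inj that by (rule inv_into_f_f)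
  show "bij_betw ?\<pi> (fst (erep A \<tau>)) (fst (erep B \<tau>'))"
  proof (rule bij_betw_byWitness[where f' = "\<lambda>w j. j \<in> A \<and> w (f j)"])
    show "\<forall>w\<in>fst (erep A \<tau>). (\<lambda>j. j \<in> A \<and> ?\<pi> w (f j)) = w"
    proof
      fix w assume w: "w \<in> fst (erep A \<tau>)"
      show "(\<lambda>j. j \<in> A \<and> ?\<pi> w (f j)) = w"
      proof
        fix j show "(j \<in> A \<and> ?\<pi> w (f j)) = w j"
          using w inv[of j] im by (cases "j \<in> A") (auto simp: words_def)
      qed
    qed
    show "\<forall>w\<in>fst (erep B \<tau>'). ?\<pi> (\<lambda>j. j \<in> A \<and> w (f j)) = w"
    proof
      fix w assume w: "w \<in> fst (erep B \<tau>')"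
      show "?\<pi> (\<lambda>j. j \<in> A \<and> w (f j)) = w"
      proof
        fix j show "?\<pi> (\<lambda>j. j \<in> A \<and> w (f j)) j = w j"
        proof (cases "j \<in> B")
          case True
          then have "j \<in> f ` A" using im by simp
          then show ?thesis using True by (simp add: inv_into_into f_inv_into_f)
        next
          case False
          then show ?thesis using w by (auto simp: words_def)
        qed
      qed
    qed
  qed (auto simp: words_def)
  fix g v w assume g: "g \<in> G"
  show "snd (erep A \<tau>) g v w = snd (erep B \<tau>') g (?\<pi> v) (?\<pi> w)"
  proof -
    have "snd (erep B \<tau>') g (?\<pi> v) (?\<pi> w) = (\<Prod>j\<in>A. \<tau>' (f j) g (?\<pi> v (f j)) (?\<pi> w (f j)))"
      unfolding erep_def snd_conv by (rule prod.reindex_bij_betw[OF f, symmetric])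
    also have "\<dots> = (\<Prod>j\<in>A. \<tau> j g (v j) (w j))"
    proof (rule prod.cong[OF refl])
      fix j assume j: "j \<in> A"
      then have "f j \<in> B" using im by blast
      then show "\<tau>' (f j) g (?\<pi> v (f j)) (?\<pi> w (f j)) = \<tau> j g (v j) (w j)"
        using inv[OF j] eq[OF j g] by simp
    qed
    finally show ?thesis by (simp add: erep_def)
  qed
qed (use fin in simp_all)

lemma inadd_erep_cong:
  fixes \<tau> :: "nat \<Rightarrow> 'g \<Rightarrow> bool \<Rightarrow> bool \<Rightarrow> 'k::field"
  assumes "finite A" "\<And>j g x y. j \<in> A \<Longrightarrow> g \<in> G \<Longrightarrow> \<tau> j g x y = \<tau>' j g x y"
  shows "inadd G (erep A \<tau>) {erep A \<tau>'}"
  by (rule erep_reindex[where f = id]) (use assms in simp_all)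

lemma bij_words_Un:
  assumes "A \<inter> C = {}"
  shows "bij_betw (\<lambda>w. (\<lambda>j. w j \<and> j \<in> A, \<lambda>j. w j \<and> j \<in> C)) (words (A \<union> C)) (words A \<times> words C)"
proof (rule bij_betw_byWitness[where f' = "\<lambda>q j. fst q j \<or> snd q j"])
  show "\<forall>w\<in>words (A \<union> C). (\<lambda>j. fst (\<lambda>j. w j \<and> j \<in> A, \<lambda>j. w j \<and> j \<in> C) j \<or> snd (\<lambda>j. w j \<and> j \<in> A, \<lambda>j. w j \<and> j \<in> C) j) = w"
    by (auto simp: words_def)
  show "\<forall>q\<in>words A \<times> words C. (\<lambda>j. (fst q j \<or> snd q j) \<and> j \<in> A, \<lambda>j. (fst q j \<or> snd q j) \<and> j \<in> C) = q"
  proof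
    fix q assume q: "q \<in> words A \<times> words C"
    obtain u v where uv: "q = (u, v)" by (cases q)
    have "u j \<Longrightarrow> j \<in> A" "v j \<Longrightarrow> j \<in> C" for j using q uv by (auto simp: words_def)
    then have "(\<lambda>j. (u j \<or> v j) \<and> j \<in> A) = u" "(\<lambda>j. (u j \<or> v j) \<and> j \<in> C) = v"
      using assms by blast+
    then show "(\<lambda>j. (fst q j \<or> snd q j) \<and> j \<in> A, \<lambda>j. (fst q j \<or> snd q j) \<and> j \<in> C) = q" by (simp add: uv)
  qed
qed (auto simp: words_def)

lemma erep_Un_entries:
  assumes "finite A" "finite C" "A \<inter> C = {}"
  shows "snd (erep (A \<union> C) \<tau>) g v w = snd (tens (erep A \<tau>) (erep C \<tau>)) g
     (\<lambda>j. v j \<and> j \<in> A, \<lambda>j. v j \<and> j \<in> C) (\<lambda>j. w j \<and> j \<in> A, \<lambda>j. w j \<and> j \<in> C)"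
  using assms by (simp add: erep_def tens_def prod.union_disjoint)

lemma inadd_erep_tens:
  assumes "finite A" "finite C" "A \<inter> C = {}"
  shows "inadd G (erep (A \<union> C) \<tau>) {tens (erep A \<tau>) (erep C \<tau>)}"
  by (rule inadd_reindex[OF bij_words_Un[OF assms(3), folded fst_erep[of _ \<tau>], folded fst_tens]])
     (use assms erep_Un_entries[OF assms] in simp_all)

lemma inadd_tens_erep:
  assumes "finite A" "finite C" "A \<inter> C = {}"
  shows "inadd G (tens (erep A \<tau>) (erep C \<tau>)) {erep (A \<union> C) \<tau>}"
proof (rule inadd_reindex)
  let ?F = "\<lambda>w. (\<lambda>j. w j \<and> j \<in> A, \<lambda>j. w j \<and> j \<in> C)"
  let ?H = "the_inv_into (words (A \<union> C)) ?F"
  note b = bij_words_Un[OF assms(3)]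
  show "bij_betw ?H (fst (tens (erep A \<tau>) (erep C \<tau>))) (fst (erep (A \<union> C) \<tau>))"
    using bij_betw_the_inv_into[OF b] by simp
  have FH: "?F (?H x) = x" if "x \<in> fst (tens (erep A \<tau>) (erep C \<tau>))" for x
  proof -
    have "x \<in> ?F ` words (A \<union> C)" using that bij_betw_imp_surj_on[OF b] by simp
    then show ?thesis using f_the_inv_into_f[OF bij_betw_imp_inj_on[OF b], of x] by simp
  qed
  fix g x y assume "x \<in> fst (tens (erep A \<tau>) (erep C \<tau>))" "y \<in> fst (tens (erep A \<tau>) (erep C \<tau>))"
  then have "?F (?H x) = x" "?F (?H y) = y" by (simp_all only: FH)
  then show "snd (tens (erep A \<tau>) (erep C \<tau>)) g x y = snd (erep (A \<union> C) \<tau>) g (?H x) (?H y)"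
    unfolding erep_Un_entries[OF assms] by simp
qed (use assms in simp_all)

definition twisted :: "nat \<Rightarrow> ('g \<Rightarrow> bool \<Rightarrow> bool \<Rightarrow> 'k::field) \<Rightarrow> nat set \<Rightarrow> (nat \<Rightarrow> nat) \<Rightarrow> ('g, nat \<Rightarrow> bool, 'k) irep" where
  "twisted p t A s = erep A (\<lambda>j g x y. t g x y ^ (p ^ s j))"

lemma fst_twisted [simp]: "fst (twisted p t A s) = words A" by (simp add: twisted_def)

lemma inadd_tens_twisted:
  fixes t :: "'g \<Rightarrow> bool \<Rightarrow> bool \<Rightarrow> 'k::field"
  assumes "finite A" "finite C" "A \<inter> C = {}"
    and "\<And>j g x y. j \<in> A \<Longrightarrow> g \<in> G \<Longrightarrow> \<tau> j g x y = t g x y ^ (p ^ s j)"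
  shows "inadd G (tens (erep A \<tau>) (twisted p t C s)) {twisted p t (A \<union> C) s}"
proof (rule inadd_trans)
  show "inadd G (tens (erep A \<tau>) (twisted p t C s)) ((\<lambda>B. tens B (twisted p t C s)) ` {twisted p t A s})"
    unfolding twisted_def[of p t A s]
    by (rule inadd_tens_left) (use assms in \<open>simp_all add: inadd_erep_cong\<close>)
  fix B assume "B \<in> (\<lambda>B. tens B (twisted p t C s)) ` {twisted p t A s}"
  then have B: "B = tens (twisted p t A s) (twisted p t C s)" by simp
  show "inadd G B {twisted p t (A \<union> C) s} \<and> finite (fst B)"
    unfolding B twisted_def using inadd_tens_erep[OF assms(1-3)] assms(1,2) by simp
qed

text \<open>The p^i-th power map is additive in characteristic p, so determinant 1 passes to the
  twists and \<open>erep_reduction\<close> applies to them as well.\<close>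

lemma unimodular_power:
  fixes t :: "'g \<Rightarrow> bool \<Rightarrow> bool \<Rightarrow> 'k::field"
  assumes t: "unimodular G t" and p: "prime p" "CHAR('k) = p"
  shows "unimodular G (\<lambda>g x y. t g x y ^ (p ^ i))"
  unfolding unimodular_def
proof
  fix g assume "g \<in> G"
  then have "t g False False * t g True True = 1 + t g False True * t g True False"
    using t by (simp add: unimodular_def algebra_simps)
  then have "(t g False False * t g True True) ^ (p ^ i) = (1 + t g False True * t g True False) ^ (p ^ i)"
    by (rule arg_cong)
  also have "\<dots> = 1 + (t g False True * t g True False) ^ (p ^ i)"
    using freshmans_dream'[of "p ^ i" i "1 :: 'k" "t g False True * t g True False"] p by simp
  finally show "t g False False ^ p ^ i * t g True True ^ p ^ i - t g False True ^ p ^ i * t g True False ^ p ^ i = 1"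
    by (simp add: power_mult_distrib)
qed

text \<open>Matrix entries taken from a field with p^n elements satisfy the hypothesis, so twists
  repeat with period n.\<close>

lemma twist_mod:
  fixes x :: "'k::field"
  assumes "x ^ (p ^ n) = x"
  shows "x ^ (p ^ (s mod n)) = x ^ (p ^ s)"
proof -
  have 1: "x ^ (p ^ (n * k)) = x" for k
    by (induction k) (simp_all add: power_add power_mult assms)
  have "x ^ (p ^ s) = x ^ (p ^ (n * (s div n)) * p ^ (s mod n))"
    by (simp add: power_add[symmetric])
  then show ?thesis by (simp only: power_mult 1[unfolded power_mult])
qed

lemma pigeonhole_fibre:
  assumes "finite A" "n * (m - 1) < card A" "m > 0" "\<And>j. j \<in> A \<Longrightarrow> f j < (n::nat)"
  shows "\<exists>i<n. m \<le> card {j \<in> A. f j = i}"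
proof (rule ccontr)
  assume no: "\<not> ?thesis"
  have le: "card {j \<in> A. f j = i} \<le> m - 1" if "i < n" for i
  proof -
    have "\<not> m \<le> card {j \<in> A. f j = i}" using no that by blast
    then show ?thesis by linarith
  qed
  have "f ` A \<subseteq> {..<n}" using assms(4) by auto
  then have "card A = (\<Sum>i<n. card {j \<in> A. f j = i})"
    using sum.group[of A "{..<n}" f "\<lambda>_. 1 :: nat"] assms(1) by simp
  also have "\<dots> \<le> (\<Sum>i<n. m - 1)" by (rule sum_mono) (use le in simp)
  finally show False using assms(2) by simp
qed

lemma inadd_trans_singleton:
  assumes "inadd G A {B}" "inadd G B \<B>" "finite (fst B)"
  shows "inadd G A \<B>"
  by (rule inadd_trans[OF assms(1)]) (use assms(2,3) in simp)

text \<open>Induction on the number of factors. Beyond n (2p - 2) factors, one of the n twists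
  occurs at least 2p - 1 times; \<open>erep_reduction\<close> replaces 2p - 1 such factors by p
  factors, one of them twisted once more, or by 2p - 3 factors. Up to the bound, only finitely many
  exponent functions modulo n remain.\<close>

theorem twisted_finite_cover:
  fixes t :: "'g \<Rightarrow> bool \<Rightarrow> bool \<Rightarrow> 'k::field"
  assumes t: "unimodular G t" and p: "prime p" "CHAR('k) = p" and n: "n \<ge> 1"
    and per: "\<And>g x y. g \<in> G \<Longrightarrow> t g x y ^ (p ^ n) = t g x y"
  defines "\<B> \<equiv> (\<lambda>q. twisted p t {..<fst q} (snd q)) ` (SIGMA m:{..n * (2 * p - 2)}. {..<m} \<rightarrow>\<^sub>E {..<n})"
  assumes "finite A"
  shows "inadd G (twisted p t A s) \<B>"
  using \<open>finite A\<close>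
proof (induction "card A" arbitrary: A s rule: less_induct)
  case less
  have n0: "n > 0" and p2: "p \<ge> 2" using n prime_ge_2_nat[OF p(1)] by auto
  have tm: "t g x y ^ (p ^ (s mod n)) = t g x y ^ (p ^ s)" if "g \<in> G" for g x y s
    by (rule twist_mod[OF per[OF that]])
  show ?case
  proof (cases "card A \<le> n * (2 * p - 2)")
    case True
    obtain f where f: "bij_betw f A {..<card A}"
      using ex_bij_betw_finite_nat[OF less.prems] by (auto simp: atLeast0LessThan)
    \<comment> \<open>Positions are renumbered to an initial segment and exponents reduced modulo n;
      \<open>restrict\<close> places the result in the finite extensional function space.\<close>
    define s' where "s' = restrict (\<lambda>j. s (inv_into A f j) mod n) {..<card A}"
    have "inadd G (twisted p t A s) {twisted p t {..<card A} s'}"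
      unfolding twisted_def
    proof (rule erep_reindex[OF f less.prems])
      fix j g x y assume j: "j \<in> A" and g: "g \<in> G"
      have "f j \<in> {..<card A}" using f j by (auto simp: bij_betw_def)
      moreover have "inv_into A f (f j) = j" using f j by (simp add: bij_betw_def inv_into_f_f)
      ultimately have "s' (f j) = s j mod n" unfolding s'_def by simp
      then show "t g x y ^ (p ^ s j) = t g x y ^ (p ^ s' (f j))" using tm[OF g] by simp
    qed
    moreover have "(card A, s') \<in> (SIGMA m:{..n * (2 * p - 2)}. {..<m} \<rightarrow>\<^sub>E {..<n})"
      using True n0 by (auto simp: s'_def)
    then have "{twisted p t {..<card A} s'} \<subseteq> \<B>" unfolding \<B>_def by force
    ultimately show ?thesis by (rule inadd_mono)
  next
    case False
    have "n * (2 * p - 1 - 1) < card A" using False by (simp add: numeral_2_eq_2)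
    then have "\<exists>i<n. 2 * p - 1 \<le> card {j \<in> A. s j mod n = i}"
      by (rule pigeonhole_fibre[OF less.prems]) (use p2 n0 in simp_all)
    then obtain i where i: "2 * p - 1 \<le> card {j \<in> A. s j mod n = i}" by blast
    then obtain P where P: "P \<subseteq> {j \<in> A. s j mod n = i}" "card P = 2 * p - 1" "finite P"
      using obtain_subset_with_card_n[OF i] by blast
    let ?C = "A - P"
    have PA: "P \<subseteq> A" using P(1) by blast
    have Pi: "s j mod n = i" if "j \<in> P" for j using P(1) that by blast
    have fC: "finite ?C" using less.prems by simp
    have PC: "P \<inter> ?C = {}" and APC: "A = P \<union> ?C" using PA by blast+
    have cA: "card A = 2 * p - 1 + card ?C"
      using card_Un_disjoint[OF P(3) fC PC] APC[symmetric] P(2) by simp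
    have "p \<le> card P" using P(2) p2 by simp
    then obtain Z where Z: "Z \<subseteq> P" "card Z = p" "finite Z" by (rule obtain_subset_with_card_n)
    obtain z where z: "z \<in> Z" using Z(2) p2 by (cases "Z = {}") auto
    let ?t = "\<lambda>g x y. t g x y ^ (p ^ i)"
    let ?D = "twisted p t ?C s"
    let ?R = "insert (erep (insert z (P - Z)) (frob_at p z ?t)) {erep (P - {a, b}) (\<lambda>_. ?t) | a b. a \<in> P \<and> b \<in> P \<and> a \<noteq> b}"
    have red: "inadd G (erep P (\<lambda>_. ?t)) ?R"
      by (rule erep_reduction[OF unimodular_power[OF t p] P(3) p P(2) Z(1) z Z(2)])
    have 1: "inadd G (twisted p t A s) {tens (twisted p t P s) ?D}"
      unfolding twisted_def by (subst APC) (rule inadd_erep_tens[OF P(3) fC PC])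
    have 2: "inadd G (tens (twisted p t P s) ?D) ((\<lambda>B. tens B ?D) ` {erep P (\<lambda>_. ?t)})"
    proof (rule inadd_tens_left)
      show "inadd G (twisted p t P s) {erep P (\<lambda>_. ?t)}"
        unfolding twisted_def
      proof (rule inadd_erep_cong[OF P(3)])
        fix j g x y assume "j \<in> P" "g \<in> G"
        then show "t g x y ^ p ^ s j = t g x y ^ p ^ i" using tm[of g x y "s j"] Pi[of j] by simp
      qed
    qed (simp add: fC)
    have 3: "inadd G (tens (erep P (\<lambda>_. ?t)) ?D) ((\<lambda>B. tens B ?D) ` ?R)"
      by (rule inadd_tens_left[OF _ red]) (simp add: fC)
    have 4: "inadd G (tens B ?D) \<B>" if B: "B \<in> ?R" for B
    proof -
      consider "B = erep (insert z (P - Z)) (frob_at p z ?t)"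
        | a b where "a \<in> P" "b \<in> P" "a \<noteq> b" "B = erep (P - {a, b}) (\<lambda>_. ?t)" using B by blast
      then show ?thesis
      proof cases
        case 1
        let ?A = "insert z (P - Z)"
        \<comment> \<open>The p positions of Z are merged into z, whose exponent rises to i + 1.
          This may reach n; exponents are reduced again when the induction arrives at few
          factors.\<close>
        define s' where "s' = (\<lambda>j. if j \<in> ?C then s j else if j = z then Suc i else i)"
        have zC: "z \<notin> ?C" using z Z(1) by blast
        have "inadd G (tens (erep ?A (frob_at p z ?t)) (twisted p t ?C s')) {twisted p t (?A \<union> ?C) s'}"
        proof (rule inadd_tens_twisted[OF _ fC])
          show "finite ?A" "?A \<inter> ?C = {}" using P(3) zC by auto
          fix j g x y assume "j \<in> ?A"
          then have "j \<notin> ?C" using zC by auto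
          then have "s' j = (if j = z then Suc i else i)" unfolding s'_def by (rule if_not_P)
          then show "frob_at p z ?t j g x y = t g x y ^ (p ^ s' j)"
            by (simp add: frob_at_def power_mult[symmetric] mult.commute)
        qed
        moreover have "twisted p t ?C s' = ?D"
          unfolding twisted_def erep_def s'_def by (auto simp: fun_eq_iff intro!: prod.cong)
        moreover have fin: "finite (fst (twisted p t (?A \<union> ?C) s'))" using P(3) fC by simp
        moreover have "inadd G (twisted p t (?A \<union> ?C) s') \<B>"
        proof (rule less.hyps)
          have "card ?A \<le> Suc (card (P - Z))" by (rule card_insert_le_m1) auto
          also have "card (P - Z) = p - 1" using card_Diff_subset[OF Z(3,1)] P(2) Z(2) by simp
          finally have "card ?A < 2 * p - 1" using p2 by linarith
          then show "card (?A \<union> ?C) < card A" using card_Un_le[of ?A ?C] cA by linarith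
        qed (use P(3) fC in simp)
        ultimately show ?thesis
          unfolding 1 by (metis inadd_trans_singleton[of G _ "twisted p t (?A \<union> ?C) s'" \<B>] fin)
      next
        case (2 a b)
        define s' where "s' = (\<lambda>j. if j \<in> ?C then s j else i)"
        have "inadd G (tens (erep (P - {a, b}) (\<lambda>_. ?t)) (twisted p t ?C s')) {twisted p t ((P - {a, b}) \<union> ?C) s'}"
        proof (rule inadd_tens_twisted[OF _ fC])
          show "finite (P - {a, b})" "(P - {a, b}) \<inter> ?C = {}" using P(3) by auto
          fix j g x y assume "j \<in> P - {a, b}"
          then have "j \<notin> ?C" by blast
          then have "s' j = i" unfolding s'_def by (rule if_not_P)
          then show "t g x y ^ p ^ i = t g x y ^ (p ^ s' j)" by simp
        qed
        moreover have "twisted p t ?C s' = ?D"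
          unfolding twisted_def erep_def s'_def by (auto simp: fun_eq_iff intro!: prod.cong)
        moreover have fin: "finite (fst (twisted p t ((P - {a, b}) \<union> ?C) s'))" using P(3) fC by simp
        moreover have "inadd G (twisted p t ((P - {a, b}) \<union> ?C) s') \<B>"
        proof (rule less.hyps)
          have "P - {a, b} \<subset> P" using 2 by blast
          then have "card (P - {a, b}) < 2 * p - 1" using psubset_card_mono[OF P(3)] P(2) by metis
          then show "card ((P - {a, b}) \<union> ?C) < card A" using card_Un_le[of "P - {a, b}" ?C] cA by linarith
        qed (use P(3) fC in simp)
        ultimately show ?thesis
          unfolding 2(4) by (metis inadd_trans_singleton[of G _ "twisted p t ((P - {a, b}) \<union> ?C) s'" \<B>] fin)
      qed
    qed
    have fR: "finite (fst (tens B ?D))" if "B \<in> ?R" for B using that P(3) fC by auto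
    have 5: "inadd G (tens (erep P (\<lambda>_. ?t)) ?D) \<B>"
      by (rule inadd_trans[OF 3]) (use 4 fR in blast)
    have 6: "inadd G (tens (twisted p t P s) ?D) \<B>"
      by (rule inadd_trans[OF 2]) (use 5 P(3) fC in simp)
    show ?thesis
      by (rule inadd_trans[OF 1]) (use 6 P(3) fC in simp)
  qed
qed

lemma inadd_tens_closed:
  fixes t :: "'g \<Rightarrow> bool \<Rightarrow> bool \<Rightarrow> 'k::field" and p :: nat
  defines "\<E> \<equiv> {twisted p t A s | A s. finite A}"
  assumes "inadd G B \<E>" "inadd G C \<E>" "finite (fst B)" "finite (fst C)"
  shows "inadd G (tens B C) \<E>"
proof (rule inadd_trans[OF inadd_tens[OF assms(2-5)]])
  show fE: "finite (fst D)" if "D \<in> \<E>" for D using that by (auto simp: \<E>_def)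
  show "finite (fst D)" if "D \<in> \<E>" for D by (rule fE[OF that])
  fix D assume "D \<in> {tens B D |B D. B \<in> \<E> \<and> D \<in> \<E>}"
  then obtain A s A' s' where D: "D = tens (twisted p t A s) (twisted p t A' s')" and fin: "finite A" "finite A'"
    by (auto simp: \<E>_def)
  obtain m where m: "\<And>j. j \<in> A \<Longrightarrow> j < m" using fin(1) finite_nat_set_iff_bounded by auto
  \<comment> \<open>The positions of the second factor are moved beyond those of the first, so that
    the union is disjoint and one exponent function serves both.\<close>
  let ?A = "(\<lambda>j. j + m) ` A'"
  define u where "u = (\<lambda>j. if j < m then s j else s' (j - m))"
  have "inadd G (twisted p t A' s') {twisted p t ?A u}"
    unfolding twisted_def
    by (rule erep_reindex[where f = "\<lambda>j. j + m"]) (use fin in \<open>auto simp: bij_betw_def inj_on_def u_def\<close>)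
  then have 1: "inadd G D (tens (twisted p t A s) ` {twisted p t ?A u})"
    unfolding D by (intro inadd_tens_right) (use fin in simp_all)
  have "inadd G (tens (erep A (\<lambda>j g x y. t g x y ^ (p ^ s j))) (twisted p t ?A u)) {twisted p t (A \<union> ?A) u}"
    by (rule inadd_tens_twisted) (use fin m in \<open>auto simp: u_def dest: m\<close>)
  then have 2: "inadd G (tens (twisted p t A s) (twisted p t ?A u)) \<E>"
    unfolding twisted_def[of p t A s, symmetric] by (rule inadd_mono) (use fin in \<open>auto simp: \<E>_def\<close>)
  show "inadd G D \<E> \<and> finite (fst D)"
    using inadd_trans[OF 1, of \<E>] 2 fin by (auto simp: D)
qed

section \<open>Finite fields\<close>

text \<open>The cyclicity of the multiplicative group is a fact about structures with an explicit
  carrier; it is transferred to the type class here.\<close>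

lemma generator_exists: "\<exists>\<theta> :: 'q::{finite,field}. \<theta> \<noteq> 0 \<and> (\<forall>x. x \<noteq> 0 \<longrightarrow> (\<exists>i. x = \<theta> ^ i))"
proof -
  let ?R = "ring_of_type_algebra :: 'q ring"
  interpret R: field ?R by (rule field_from_type_algebra)
  have c: "carrier (mult_of ?R) = {x. x \<noteq> 0}"
    by (auto simp: carrier_mult_of ring_of_type_algebra_def)
  have pow: "a [^]\<^bsub>mult_of ?R\<^esub> i = a ^ i" for a :: 'q and i :: nat
    by (induction i) (simp_all add: mult_of_def ring_of_type_algebra_def nat_pow_def mult.commute)
  have "finite (carrier ?R)" by simp
  then have "\<exists>a\<in>carrier (mult_of ?R). carrier (mult_of ?R) = {a [^]\<^bsub>mult_of ?R\<^esub> i | i::nat. i \<in> UNIV}"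
    using R.finite_field_mult_group_has_gen by (simp add: nat_pow_mult_of)
  then obtain a where a: "a \<in> carrier (mult_of ?R)" and g: "carrier (mult_of ?R) = {a [^]\<^bsub>mult_of ?R\<^esub> i | i::nat. i \<in> UNIV}"
    by blast
  have "\<exists>i. x = a ^ i" if "x \<noteq> 0" for x
  proof -
    have "x \<in> {a [^]\<^bsub>mult_of ?R\<^esub> i | i::nat. i \<in> UNIV}" using that g c by simp
    then show ?thesis unfolding pow by blast
  qed
  then show ?thesis using a c by blast
qed

text \<open>Multiplication by a permutes the nonzero elements, so their product, which is not zero,
  is unchanged by the factor a^(q-1).\<close>

lemma finite_field_power_card_minus_1:
  fixes a :: "'q::{finite,field}"
  assumes "a \<noteq> 0"
  shows "a ^ (card (UNIV :: 'q set) - 1) = 1"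
proof -
  let ?N = "UNIV - {0 :: 'q}"
  have b: "bij_betw ((*) a) ?N ?N"
    by (rule bij_betw_byWitness[where f' = "\<lambda>x. x / a"]) (use assms in auto)
  have "(\<Prod>x\<in>?N. x) = (\<Prod>x\<in>?N. a * x)" by (rule prod.reindex_bij_betw[OF b, symmetric])
  also have "\<dots> = a ^ card ?N * (\<Prod>x\<in>?N. x)" by (simp add: prod.distrib)
  finally have "a ^ card ?N = 1" using prod_zero_iff[of ?N "\<lambda>x. x"] by simp
  then show ?thesis by (simp add: card_Diff_subset)
qed

lemma card_field_ge_2: "card (UNIV :: 'q::{finite,field} set) \<ge> 2"
proof -
  have "card {0, 1 :: 'q} \<le> card (UNIV :: 'q set)" by (rule card_mono) auto
  then show ?thesis by simp
qed

lemma finite_field_power_card: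
  fixes a :: "'q::{finite,field}"
  shows "a ^ card (UNIV :: 'q set) = a"
proof (cases "a = 0")
  case False
  have "a ^ Suc (card (UNIV :: 'q set) - 1) = a" using finite_field_power_card_minus_1[OF False] by simp
  then show ?thesis using card_field_ge_2[where 'q = 'q] by simp
qed (use card_field_ge_2[where 'q = 'q] in simp)

text \<open>Translation by 1 permutes the field and changes the sum of all elements by q times
  1.\<close>

lemma of_nat_card_field: "of_nat (card (UNIV :: 'q::{finite,field} set)) = (0 :: 'q)"
proof -
  have "bij (\<lambda>x :: 'q. x + 1)" by (rule bij_betw_byWitness[where f' = "\<lambda>x. x - 1"]) auto
  then have "(\<Sum>x\<in>UNIV. x) = (\<Sum>x\<in>UNIV. x + 1 :: 'q)" by (rule sum.reindex_bij_betw[symmetric])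
  then show ?thesis by (simp add: sum.distrib)
qed

text \<open>Multiplication by a generator \<theta> permutes the field and multiplies the sum by
  \<theta>^i, which differs from 1 for 0 < i < q - 1. For i = 0 the sum counts all q elements,
  because 0^0 = 1.\<close>

lemma power_sum_finite_field:
  assumes "i < card (UNIV :: 'q::{finite,field} set) - 1"
  shows "(\<Sum>s\<in>UNIV. s ^ i) = (0 :: 'q)"
proof (cases "i = 0")
  case True
  have "of_nat (card (UNIV :: 'q set)) = (0 :: 'q)" by (rule of_nat_card_field)
  then show ?thesis using True by simp
next
  case False
  obtain \<theta> :: 'q where \<theta>: "\<theta> \<noteq> 0" "\<forall>x. x \<noteq> 0 \<longrightarrow> (\<exists>i. x = \<theta> ^ i)"
    using generator_exists[where 'q = 'q] by (elim exE conjE)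
  have ne: "\<theta> ^ i \<noteq> 1"
  proof
    assume 1: "\<theta> ^ i = 1"
    have pm: "\<theta> ^ j = \<theta> ^ (j mod i)" for j
    proof -
      have "\<theta> ^ j = \<theta> ^ (i * (j div i) + j mod i)" by simp
      then show ?thesis using 1 by (simp only: power_add power_mult) simp
    qed
    have "UNIV - {0 :: 'q} \<subseteq> (\<lambda>j. \<theta> ^ j) ` {..<i}"
    proof
      fix x assume "x \<in> UNIV - {0 :: 'q}"
      then obtain j where "x = \<theta> ^ j" using \<theta>(2) by blast
      then have "x = \<theta> ^ (j mod i)" using pm[of j] by simp
      then show "x \<in> (\<lambda>j. \<theta> ^ j) ` {..<i}" using False by auto
    qed
    then have "card (UNIV - {0 :: 'q}) \<le> card {..<i}" by (rule surj_card_le[OF finite_lessThan])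
    then show False using assms by simp
  qed
  have b: "bij_betw ((*) \<theta>) UNIV UNIV"
    by (rule bij_betw_byWitness[where f' = "\<lambda>x. x / \<theta>"]) (use \<theta>(1) in auto)
  have "(\<Sum>s\<in>UNIV. s ^ i) = (\<Sum>s\<in>UNIV. (\<theta> * s) ^ i)" by (rule sum.reindex_bij_betw[OF b, symmetric])
  also have "\<dots> = \<theta> ^ i * (\<Sum>s\<in>UNIV. s ^ i)" by (simp add: power_mult_distrib sum_distrib_left)
  finally have "(\<theta> ^ i - 1) * (\<Sum>s\<in>UNIV. s ^ i) = 0" by (simp add: algebra_simps)
  then show ?thesis using ne by simp
qed

lemma finite_field_power_shift:
  fixes a :: "'q::{finite,field}"
  assumes "j > 0"
  shows "a ^ (card (UNIV :: 'q set) - 1 + j) = a ^ j"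
proof (cases "a = 0")
  case False
  then show ?thesis unfolding power_add finite_field_power_card_minus_1[OF False] by simp
qed (use assms in \<open>simp add: power_0_left\<close>)

text \<open>The range covers the exponents q - 1 - e + j with e, j < q, except 2 (q - 1), which
  arises for e = 0 and j = q - 1 and is treated apart where it occurs.\<close>

lemma power_sum_finite_field':
  defines "q \<equiv> card (UNIV :: 'q::{finite,field} set)"
  assumes i: "i < 2 * (q - 1)"
  shows "(\<Sum>s\<in>UNIV. s ^ i) = (if i = q - 1 then - 1 else 0 :: 'q)"
proof -
  have q: "q \<ge> 2" unfolding q_def by (rule card_field_ge_2)
  consider "i < q - 1" | "i = q - 1" | j where "i = q - 1 + j" "0 < j" "j < q - 1"
  proof -
    have "i = q - 1 + (i - (q - 1)) \<and> 0 < i - (q - 1) \<and> i - (q - 1) < q - 1" if "\<not> i < q - 1" "i \<noteq> q - 1"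
      using i that by linarith
    then show ?thesis using that by blast
  qed
  then show ?thesis
  proof cases
    case 1
    then show ?thesis using power_sum_finite_field[of i, where 'q = 'q] by (simp add: q_def)
  next
    case 2
    have "s ^ i = 1 - (if s = 0 then 1 else 0 :: 'q)" for s :: 'q
      using 2 q finite_field_power_card_minus_1[of s] by (cases "s = 0") (simp_all add: q_def)
    then have "(\<Sum>s\<in>UNIV. s ^ i) = (\<Sum>s\<in>(UNIV :: 'q set). 1 - (if s = 0 then 1 else 0 :: 'q))" by simp
    also have "\<dots> = of_nat q - 1" by (simp add: sum_subtractf q_def)
    also have "of_nat q = (0 :: 'q)" unfolding q_def by (rule of_nat_card_field)
    finally show ?thesis using 2 by simp
  next
    case (3 j)
    have "(\<Sum>s\<in>UNIV. s ^ i) = (\<Sum>s\<in>UNIV. s ^ j :: 'q)"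
      unfolding 3(1) q_def by (simp only: finite_field_power_shift[OF 3(2)])
    also have "\<dots> = 0" using 3 by (intro power_sum_finite_field) (simp add: q_def)
    finally show ?thesis using 3 by simp
  qed
qed

lemma hom_power_sum_finite_field:
  fixes \<sigma> :: "'q::{finite,field} \<Rightarrow> 'K::field"
  assumes "field_hom \<sigma>" "i < 2 * (card (UNIV :: 'q set) - 1)"
  shows "(\<Sum>s\<in>UNIV. \<sigma> s ^ i) = (if i = card (UNIV :: 'q set) - 1 then - 1 else 0)"
proof -
  interpret \<sigma>: field_hom \<sigma> by fact
  have "(\<Sum>s\<in>UNIV. \<sigma> s ^ i) = \<sigma> (\<Sum>s\<in>UNIV. s ^ i)" by (simp add: hom_distribs)
  also have "\<dots> = \<sigma> (if i = card (UNIV :: 'q set) - 1 then - 1 else 0)"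
    by (subst power_sum_finite_field'[OF assms(2)]) (rule refl)
  finally show ?thesis by (simp add: hom_distribs)
qed

text \<open>Weights of the functional that reads off the coefficient of x^e from a polynomial
  function of degree below q. The additional 1 for e = 0 cancels the contribution of x^(q-1), whose
  power sum against x^(q-1) is again -1.\<close>

definition kap :: "('q::{finite,field} \<Rightarrow> 'K::field) \<Rightarrow> nat \<Rightarrow> 'q \<Rightarrow> 'K" where
  "kap \<sigma> e s = (if e = 0 then 1 else 0) - \<sigma> s ^ (card (UNIV :: 'q set) - 1 - e)"

lemma sum_kap:
  fixes \<sigma> :: "'q::{finite,field} \<Rightarrow> 'K::field"
  assumes "field_hom \<sigma>" and e: "e < card (UNIV :: 'q set)" "j < card (UNIV :: 'q set)"
  shows "(\<Sum>s\<in>UNIV. kap \<sigma> e s * \<sigma> s ^ j) = (if e = j then 1 else 0)"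
proof -
  interpret \<sigma>: field_hom \<sigma> by fact
  define q where "q = card (UNIV :: 'q set)"
  have q: "q \<ge> 2" unfolding q_def by (rule card_field_ge_2)
  define ps where "ps i = (\<Sum>s\<in>UNIV. \<sigma> s ^ i)" for i
  have ps: "ps i = (if i = q - 1 then - 1 else 0)" if "i < 2 * (q - 1)" for i
    using hom_power_sum_finite_field[OF assms(1), of i] that by (simp add: ps_def q_def)
  have "(\<Sum>s\<in>UNIV. kap \<sigma> e s * \<sigma> s ^ j)
      = (\<Sum>s\<in>UNIV. (if e = 0 then 1 else 0) * \<sigma> s ^ j - \<sigma> s ^ (q - 1 - e + j))"
    by (simp add: kap_def q_def left_diff_distrib power_add)
  also have "\<dots> = (if e = 0 then 1 else 0) * ps j - ps (q - 1 - e + j)"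
    by (simp only: sum_subtractf ps_def sum_distrib_left)
  also have "\<dots> = (if e = j then 1 else 0)"
  proof (cases "e = 0")
    case True
    show ?thesis
    proof (cases "j = 0")
      case True
      then show ?thesis using \<open>e = 0\<close> ps[of 0] ps[of "q - 1"] q by simp
    next
      case False
      have "ps (q - 1 + j) = ps j" unfolding ps_def
      proof (rule sum.cong[OF refl])
        fix s :: 'q
        have "s ^ (q - 1 + j) = s ^ j"
          unfolding q_def by (rule finite_field_power_shift) (use False in simp)
        then have "\<sigma> (s ^ (q - 1 + j)) = \<sigma> (s ^ j)" by simp
        then show "\<sigma> s ^ (q - 1 + j) = \<sigma> s ^ j" by (simp only: \<sigma>.hom_power)
      qed
      then show ?thesis using True False by simp
    qed
  next
    case False
    have "q - 1 - e + j < 2 * (q - 1)" using e False by (simp add: q_def)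
    moreover have "q - 1 - e + j = q - 1 \<longleftrightarrow> e = j" using e by (auto simp: q_def)
    ultimately show ?thesis using ps[of "q - 1 - e + j"] False by simp
  qed
  finally show ?thesis .
qed

text \<open>Over nonzero elements only the exponent modulo q - 1 matters, so 0 and q - 1 are
  confused. This is the origin of the assumption \<open>not_both\<close> on kernels.\<close>

lemma sum_sigma_power:
  fixes \<sigma> :: "'q::{finite,field} \<Rightarrow> 'K::field"
  assumes "field_hom \<sigma>" and "j < card (UNIV :: 'q set)" "\<beta> < card (UNIV :: 'q set)"
  shows "(\<Sum>s\<in>UNIV - {0}. \<sigma> s ^ (card (UNIV :: 'q set) - 1 - \<beta>) * \<sigma> s ^ j)
    = - (if \<beta> = j \<or> (\<beta> = 0 \<and> j = card (UNIV :: 'q set) - 1) \<or> (j = 0 \<and> \<beta> = card (UNIV :: 'q set) - 1) then 1 else 0)"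
proof -
  interpret \<sigma>: field_hom \<sigma> by fact
  define q where "q = card (UNIV :: 'q set)"
  have q: "q \<ge> 2" unfolding q_def by (rule card_field_ge_2)
  have 0: "(\<Sum>s\<in>UNIV - {0}. \<sigma> s ^ i) = (\<Sum>s\<in>UNIV. \<sigma> s ^ i) - (if i = 0 then 1 else 0)" for i
    by (simp add: sum_diff1 hom_distribs power_0_left)
  have 1: "(\<Sum>s\<in>UNIV - {0}. \<sigma> s ^ i) = - (if i = 0 \<or> i = q - 1 then 1 else 0)" if "i < 2 * (q - 1)" for i
    unfolding 0 using hom_power_sum_finite_field[OF assms(1), of i] that q by (simp add: q_def)
  have 2: "(\<Sum>s\<in>UNIV - {0}. \<sigma> s ^ (q - 1 + (q - 1))) = - 1"
  proof -
    have "\<sigma> s ^ (q - 1) = 1" if "s \<noteq> 0" for s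
      using finite_field_power_card_minus_1[OF that] by (metis \<sigma>.hom_one \<sigma>.hom_power q_def)
    then have "(\<Sum>s\<in>UNIV - {0}. \<sigma> s ^ (q - 1 + (q - 1))) = (\<Sum>s\<in>UNIV - {0}. \<sigma> s ^ (q - 1))"
      by (intro sum.cong) (simp_all add: power_add)
    then show ?thesis using 1[of "q - 1"] q by simp
  qed
  have "(\<Sum>s\<in>UNIV - {0}. \<sigma> s ^ (q - 1 - \<beta>) * \<sigma> s ^ j) = (\<Sum>s\<in>UNIV - {0}. \<sigma> s ^ (q - 1 - \<beta> + j))"
    by (simp add: power_add)
  also have "\<dots> = - (if \<beta> = j \<or> (\<beta> = 0 \<and> j = q - 1) \<or> (j = 0 \<and> \<beta> = q - 1) then 1 else 0)"
  proof (cases "\<beta> = 0 \<and> j = q - 1")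
    case True
    then show ?thesis using 2 by simp
  next
    case False
    have b: "\<beta> < q" "j < q" using assms by (simp_all add: q_def)
    then have "q - 1 - \<beta> + j < 2 * (q - 1)" using False by (cases "\<beta> = 0") auto
    moreover have "(q - 1 - \<beta> + j = 0 \<or> q - 1 - \<beta> + j = q - 1) \<longleftrightarrow> \<beta> = j \<or> (j = 0 \<and> \<beta> = q - 1)"
      using b q by auto
    ultimately show ?thesis using 1[of "q - 1 - \<beta> + j"] False by simp
  qed
  finally show ?thesis unfolding q_def .
qed

text \<open>The two field types have no common subfield as a type. Integer polynomials can be
  evaluated in both, so they serve as the source through which a map between the fields is
  defined.\<close>

definition evi :: "int poly \<Rightarrow> 'a::comm_ring_1 \<Rightarrow> 'a" where
  "evi f x = poly (map_poly of_int f) x"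

lemma evi_simps [simp]:
  "evi 0 x = 0" "evi (f + g) x = evi f x + evi g x" "evi (f - g) x = evi f x - evi g x"
  "evi (f * g) x = evi f x * evi g x" "evi (monom c k) x = of_int c * x ^ k" "evi (smult c f) x = of_int c * evi f x"
proof -
  interpret h: map_poly_comm_ring_hom "of_int :: int \<Rightarrow> 'a" ..
  show "evi 0 x = 0" "evi (f + g) x = evi f x + evi g x" "evi (f - g) x = evi f x - evi g x"
    by (simp_all add: evi_def hom_distribs)
  show mult: "evi (f * g) x = evi f x * evi g x" for f g by (simp add: evi_def hom_distribs)
  show monom: "evi (monom c k) x = of_int c * x ^ k" for k by (simp add: evi_def map_poly_monom poly_monom)
  have "smult c f = monom c 0 * f" by (simp add: monom_0)
  then show "evi (smult c f) x = of_int c * evi f x" by (simp only: mult monom) simp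
qed

lemma of_int_eq_0_char_iff: "(of_int c :: 'a::ring_1) = 0 \<longleftrightarrow> int (CHAR('a)) dvd c"
proof (cases c)
  case (nonneg m)
  then show ?thesis by (simp add: of_nat_eq_0_iff_char_dvd)
next
  case (neg m)
  have "(of_int c :: 'a) = - of_nat (Suc m)" by (simp add: neg del: of_nat_Suc)
  then show ?thesis by (simp add: neg of_nat_eq_0_iff_char_dvd del: of_nat_Suc)
qed

lemma drop_leading_term:
  assumes "degree (g :: int poly) \<le> degree f" "coeff g (degree f) = lead_coeff f"
  shows "f - g = 0 \<or> degree (f - g) < degree f"
  using eq_zero_or_degree_less[of "f - g" "degree f"] assms degree_diff_le[of f "degree f" g] by auto

text \<open>A generator \<theta> goes to a root \<eta> of a monic integer polynomial m of least
  degree with m(\<theta>) = 0, which plays the part of the minimal polynomial over the prime field.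
  The map is well defined because every integer polynomial vanishing at \<theta> vanishes at
  \<eta>.\<close>

theorem finite_field_embedding:
  assumes p: "prime p" "CHAR('q::{finite,field}) = p" "CHAR('K::alg_closed_field) = p"
  shows "\<exists>\<sigma> :: 'q \<Rightarrow> 'K. field_hom \<sigma>"
proof -
  obtain \<theta> :: 'q where \<theta>: "\<theta> \<noteq> 0" "\<forall>x. x \<noteq> 0 \<longrightarrow> (\<exists>i. x = \<theta> ^ i)"
    using generator_exists[where 'q = 'q] by (elim exE conjE)
  define Q where "Q D \<longleftrightarrow> (\<exists>m. degree m = D \<and> lead_coeff m = 1 \<and> evi m \<theta> = 0)" for D
  have "\<not> inj_on (\<lambda>i. \<theta> ^ i) (UNIV :: nat set)"
    using finite_imageD[of "\<lambda>i. \<theta> ^ i" "UNIV :: nat set"] by auto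
  then obtain i j where ij: "\<theta> ^ i = \<theta> ^ j" "i < j"
    by (metis injI linorder_neqE_nat)
  let ?m0 = "monom 1 j - monom 1 i :: int poly"
  have "degree ?m0 = j"
  proof (rule antisym)
    show "degree ?m0 \<le> j" by (rule degree_diff_le) (use ij(2) degree_monom_le[of "1 :: int"] le_trans less_imp_le in blast)+
    show "j \<le> degree ?m0" by (rule le_degree) (use ij(2) in simp)
  qed
  moreover have "lead_coeff ?m0 = 1" unfolding calculation using ij(2) by simp
  moreover have "evi ?m0 \<theta> = 0" by (simp only: evi_simps ij(1)) simp
  ultimately have "\<exists>D. Q D" unfolding Q_def by blast
  define D where "D = (LEAST D. Q D)"
  have D: "Q D" unfolding D_def using \<open>\<exists>D. Q D\<close> by (rule LeastI_ex)
  have min: "\<not> Q D'" if "D' < D" for D' using that unfolding D_def by (rule not_less_Least)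
  obtain m where m: "degree m = D" "lead_coeff m = 1" "evi m \<theta> = 0" using D unfolding Q_def by (elim exE conjE)
  have "D > 0"
  proof (rule ccontr)
    assume "\<not> D > 0"
    then have "degree m = 0" using m(1) by simp
    then obtain c where "m = [:c:]" by (rule degree_eq_zeroE)
    then have "m = monom 1 0" using m(2) by (simp add: monom_0)
    then have "evi m \<theta> = 1" by (simp only: evi_simps) simp
    then show False using m(3) by simp
  qed
  moreover have "degree (map_poly of_int m :: 'K poly) = degree m"
    by (rule map_poly_degree_eq) (simp add: m(2))
  ultimately obtain \<eta> :: 'K where \<eta>: "evi m \<eta> = 0"
    using alg_closed_imp_poly_has_root[of "map_poly of_int m :: 'K poly"] m(1) by (auto simp: evi_def)
  \<comment> \<open>Division with remainder modulo p, one leading term at a time: a leading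
    coefficient divisible by p is dropped, a degree of at least D is lowered by a multiple of m, and
    the remaining case contradicts the minimality of D.\<close>
  have key: "f = 0 \<or> degree f < N \<Longrightarrow> evi f \<theta> = 0 \<Longrightarrow> evi f \<eta> = 0" for f N
  proof (induction N arbitrary: f)
    case (Suc N)
    show ?case
    proof (cases "f = 0")
      case False
      let ?c = "lead_coeff f" and ?k = "degree f"
      have step: "evi f \<eta> = 0" if g: "degree g \<le> ?k" "coeff g ?k = ?c" "evi g \<theta> = 0" "evi g \<eta> = 0" for g
      proof -
        have "f - g = 0 \<or> degree (f - g) < N" using drop_leading_term[OF g(1,2)] Suc.prems(1) False by auto
        then have "evi (f - g) \<eta> = 0" by (rule Suc.IH) (use Suc.prems(2) g(3) in simp)
        then show ?thesis using g(4) by simp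
      qed
      consider "int p dvd ?c" | "\<not> int p dvd ?c" "D \<le> ?k" | "\<not> int p dvd ?c" "?k < D" by linarith
      then show ?thesis
      proof cases
        case 1
        then have "(of_int ?c :: 'q) = 0" "(of_int ?c :: 'K) = 0" using p by (simp_all add: of_int_eq_0_char_iff)
        then show ?thesis by (intro step[of "monom ?c ?k"]) (simp_all add: degree_monom_le)
      next
        case 2
        have d: "degree (monom ?c (?k - D) * m) = ?k"
          using False 2 m(1,2) by (subst degree_mult_eq) (auto simp: degree_monom_eq)
        show ?thesis
        proof (rule step[of "monom ?c (?k - D) * m"])
          have "lead_coeff (monom ?c (?k - D) * m) = ?c" using False by (simp add: lead_coeff_mult m(2) degree_monom_eq)
          then show "coeff (monom ?c (?k - D) * m) ?k = ?c" unfolding d .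
        qed (use d m(3) \<eta> in simp_all)
      next
        case 3
        \<comment> \<open>The leading coefficient is invertible modulo p. Multiplying f by an
          inverse u and adding a multiple of p in the top degree gives a monic polynomial that
          vanishes at \<theta> and has degree below D.\<close>
        have "coprime ?c (int p)" using 3(1) p(1) prime_imp_coprime[of "int p" ?c] by (simp add: coprime_commute)
        then obtain u v where uv: "u * ?c + v * int p = 1" using bezout_int[of ?c "int p"] by auto
        let ?g = "smult u f + monom (v * int p) ?k"
        have "(of_int (v * int p) :: 'q) = 0" using p(2) of_nat_CHAR[where 'a = 'q] by simp
        then have "evi ?g \<theta> = 0" using Suc.prems(2) by (simp del: of_int_mult)
        moreover have cg: "coeff ?g ?k = 1" using uv by simp
        moreover have "degree ?g = ?k"
        proof (rule antisym)
          show "degree ?g \<le> ?k" by (rule degree_add_le[OF degree_smult_le degree_monom_le])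
          show "?k \<le> degree ?g" by (rule le_degree) (unfold cg, rule one_neq_zero)
        qed
        ultimately have "degree ?g = ?k \<and> coeff ?g (degree ?g) = 1 \<and> evi ?g \<theta> = 0" by (simp only: simp_thms)
        then have "Q ?k" unfolding Q_def by (rule exI)
        then show ?thesis using min 3(2) by blast
      qed
    qed simp
  qed simp
  have surj: "\<exists>f. evi f \<theta> = x" for x
  proof (cases "x = 0")
    case False
    then obtain i where "x = \<theta> ^ i" using \<theta>(2) by blast
    then have "evi (monom 1 i) \<theta> = x" by simp
    then show ?thesis by blast
  qed (use evi_simps(1) in blast)
  define \<sigma> where "\<sigma> x = evi (SOME f. evi f \<theta> = x) \<eta>" for x
  have \<sigma>: "\<sigma> (evi f \<theta>) = evi f \<eta>" for f
  proof -
    let ?g = "SOME g. evi g \<theta> = evi f \<theta>"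
    have "evi ?g \<theta> = evi f \<theta>" by (rule someI) (rule refl)
    then have "evi (?g - f) \<eta> = 0" by (intro key[of _ "Suc (degree (?g - f))"]) simp_all
    then show ?thesis by (simp add: \<sigma>_def)
  qed
  have "field_hom \<sigma>"
  proof
    show "\<sigma> 0 = 0" using \<sigma>[of 0] by simp
    show "\<sigma> 1 = 1" using \<sigma>[of "monom 1 0"] by (simp del: monom_eq_1)
    fix x y
    obtain f where x: "evi f \<theta> = x" using surj[of x] ..
    obtain g where y: "evi g \<theta> = y" using surj[of y] ..
    then show "\<sigma> (x + y) = \<sigma> x + \<sigma> y" "\<sigma> (x * y) = \<sigma> x * \<sigma> y"
      unfolding x[symmetric] y[symmetric] \<sigma> using \<sigma>[of "f + g"] \<sigma>[of "f * g"] by simp_all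
  qed
  then show ?thesis by blast
qed

section \<open>Binomial coefficients modulo p\<close>

lemma of_nat_prime_choose:
  assumes "prime p" "CHAR('a::field) = p"
  shows "of_nat (p choose j) = (if j = 0 then 1 else 0) + (if j = p then 1 else 0 :: 'a)"
proof -
  have "p \<noteq> 0" using assms(1) by auto
  moreover have "(of_nat (p choose j) :: 'a) = 0" if "0 < j" "j < p"
    using dvd_choose_prime[of j p] that assms by (simp add: of_nat_eq_0_iff_char_dvd)
  ultimately show ?thesis by (cases "j = 0"; cases "j < p"; cases "j = p") (auto simp: binomial_eq_0)
qed

text \<open>The coefficients of (1 + X)^(p b) = (1 + X^p)^b. In Vandermonde's identity only the
  terms j = 0 and j = p of the first factor survive, which gives the recursion in b.\<close>

lemma of_nat_choose_prime_mult:
  assumes "prime p" "CHAR('a::field) = p"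
  shows "(of_nat (p * b choose k) :: 'a) = (if p dvd k then of_nat (b choose (k div p)) else 0)"
proof (induction b arbitrary: k)
  case 0
  have "p > 0" using assms(1) by (rule prime_gt_0_nat)
  then show ?case by (cases "k = 0") (auto elim!: dvdE simp: binomial_eq_0)
next
  case (Suc b)
  have p0: "p > 0" using assms(1) by (rule prime_gt_0_nat)
  let ?f = "\<lambda>k. of_nat (p * b choose k) :: 'a"
  have "of_nat (p * Suc b choose k) = (\<Sum>j\<le>k. of_nat (p choose j) * ?f (k - j))"
    using vandermonde[of p "p * b" k] by (simp add: add.commute flip: of_nat_mult of_nat_sum)
  also have "\<dots> = (\<Sum>j\<le>k. (if j = 0 then ?f (k - j) else 0) + (if j = p then ?f (k - j) else 0))"
    by (rule sum.cong[OF refl]) (simp add: of_nat_prime_choose[OF assms] distrib_right)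
  also have "\<dots> = ?f k + (if p \<le> k then ?f (k - p) else 0)"
    by (simp add: sum.distrib)
  finally have *: "of_nat (p * Suc b choose k) = ?f k + (if p \<le> k then ?f (k - p) else 0)" .
  show ?case
  proof (cases "p dvd k")
    case False
    then have "\<not> p dvd k - p" if "p \<le> k" using that dvd_minus_self[of p k] by auto
    then show ?thesis unfolding * Suc.IH using False by simp
  next
    case True
    then obtain c where k: "k = p * c" ..
    show ?thesis
    proof (cases c)
      case 0
      then show ?thesis using k by simp
    next
      case (Suc c')
      then have "k - p = p * c'" "p \<le> k" using k by simp_all
      then show ?thesis unfolding * Suc.IH using k p0 Suc by simp
    qed
  qed
qed

text \<open>One step of Lucas's theorem, for lowest digits a \<le> b. In Vandermonde's sum k must be
  a multiple of p; a multiple below p a' leaves more than b elements to choose among b, and one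
  above p a' exceeds a + p a'.\<close>

lemma of_nat_choose_digit:
  assumes p: "prime p" "CHAR('a::field) = p" and a: "a \<le> b" "b < p"
  shows "(of_nat (b + p * b' choose (a + p * a')) :: 'a) = of_nat (b choose a) * of_nat (b' choose a')"
proof -
  have p0: "p > 0" using p(1) by (rule prime_gt_0_nat)
  let ?r = "a + p * a'"
  have "(of_nat (b + p * b' choose ?r) :: 'a) = (\<Sum>k\<le>?r. of_nat (p * b' choose k) * of_nat (b choose (?r - k)))"
    using vandermonde[of "p * b'" b ?r] by (simp add: add.commute flip: of_nat_mult of_nat_sum)
  also have "\<dots> = (\<Sum>k\<le>?r. if k = p * a' then of_nat (b' choose a') * of_nat (b choose a) else 0)"
  proof (rule sum.cong[OF refl])
    fix k assume k: "k \<in> {..?r}"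
    show "(of_nat (p * b' choose k) :: 'a) * of_nat (b choose (?r - k))
        = (if k = p * a' then of_nat (b' choose a') * of_nat (b choose a) else 0)"
    proof (cases "p dvd k")
      case True
      then obtain c where c: "k = p * c" ..
      show ?thesis
      proof (cases "c = a'")
        case True
        then show ?thesis using c p0 by (simp add: of_nat_choose_prime_mult[OF p])
      next
        case False
        have "c \<le> a'"
        proof (rule ccontr)
          assume "\<not> c \<le> a'"
          then have "p * Suc a' \<le> p * c" by (intro mult_le_mono) auto
          then show False using k c a by simp
        qed
        then have "Suc c \<le> a'" using False by simp
        then have "p * Suc c \<le> p * a'" by (rule mult_le_mono2)
        then have "b < ?r - k" using c a by simp
        then show ?thesis using False c p0 by (simp add: binomial_eq_0)
      qed
    next
      case False
      then show ?thesis by (auto simp: of_nat_choose_prime_mult[OF p])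
    qed
  qed
  also have "\<dots> = of_nat (b' choose a') * of_nat (b choose a)" by simp
  finally show ?thesis by simp
qed

text \<open>A digit b at place i contributes b copies of p^i. The digits of a subset sum are then
  bounded by those of \<beta>, so Lucas's theorem keeps the binomial coefficient nonzero;
  \<open>kernel_homs\<close> divides by these coefficients.\<close>

lemma digit_expansion:
  assumes p: "prime p" "CHAR('a::field) = p"
  shows "\<beta> < p ^ n \<Longrightarrow> \<exists>(A :: nat set) s. finite A \<and> (\<Sum>j\<in>A. p ^ s j) = \<beta> \<and>
    (\<forall>S. S \<subseteq> A \<longrightarrow> (of_nat (\<beta> choose (\<Sum>j\<in>S. p ^ s j)) :: 'a) \<noteq> 0)"
proof (induction n arbitrary: \<beta>)
  case 0
  then show ?case by (intro exI[of _ "{}"]) simp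
next
  case (Suc n)
  have p0: "p > 0" using p(1) by (rule prime_gt_0_nat)
  define b where "b = \<beta> mod p"
  define b' where "b' = \<beta> div p"
  have b: "b < p" "\<beta> = b + p * b'" using p0 by (simp_all add: b_def b'_def)
  have "b' < p ^ n" using Suc.prems p0 unfolding b'_def by (simp add: less_mult_imp_div_less mult.commute)
  from Suc.IH[OF this] obtain A' :: "nat set" and s' where *: "finite A' \<and> (\<Sum>j\<in>A'. p ^ s' j) = b' \<and>
      (\<forall>S. S \<subseteq> A' \<longrightarrow> (of_nat (b' choose (\<Sum>j\<in>S. p ^ s' j)) :: 'a) \<noteq> 0)"
    by (elim exE) (rule that)
  note A' = *[THEN conjunct1] *[THEN conjunct2, THEN conjunct1] and S' = *[THEN conjunct2, THEN conjunct2]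
  \<comment> \<open>The positions below b account for the lowest digit, with exponent 0. Those of
    the quotient follow, shifted by b and with exponents raised by one.\<close>
  define A where "A = {..<b} \<union> (+) b ` A'"
  define s where "s j = (if j < b then 0 else Suc (s' (j - b)))" for j
  have sum: "(\<Sum>j\<in>S0 \<union> (+) b ` S1. p ^ s j) = card S0 + p * (\<Sum>j\<in>S1. p ^ s' j)"
    if "S0 \<subseteq> {..<b}" "S1 \<subseteq> A'" for S0 S1
  proof -
    have fin: "finite S0" "finite S1" using that A'(1) finite_subset by auto
    have "(\<Sum>j\<in>S0. p ^ s j) = (\<Sum>j\<in>S0. 1)" by (rule sum.cong[OF refl]) (use that in \<open>auto simp: s_def\<close>)
    moreover have "(\<Sum>j\<in>(+) b ` S1. p ^ s j) = p * (\<Sum>j\<in>S1. p ^ s' j)"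
      by (subst sum.reindex) (simp_all add: s_def sum_distrib_left)
    moreover have "S0 \<inter> (+) b ` S1 = {}" using that by auto
    ultimately show ?thesis using fin by (simp add: sum.union_disjoint)
  qed
  show ?case
  proof (intro exI[of _ A] exI[of _ s] conjI allI impI)
    show "finite A" using A'(1) by (simp add: A_def)
    show "(\<Sum>j\<in>A. p ^ s j) = \<beta>" unfolding A_def by (subst sum) (simp_all add: A'(2) b(2))
    fix S assume S: "S \<subseteq> A"
    define S0 where "S0 = S \<inter> {..<b}"
    define S1 where "S1 = {j \<in> A'. b + j \<in> S}"
    have "S = S0 \<union> (+) b ` S1" using S by (auto simp: S0_def S1_def A_def)
    then have "(\<Sum>j\<in>S. p ^ s j) = card S0 + p * (\<Sum>j\<in>S1. p ^ s' j)"
      using sum[of S0 S1] by (simp add: S0_def S1_def)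
    moreover have c0: "card S0 \<le> b" using card_mono[of "{..<b}" S0] by (simp add: S0_def)
    moreover have "(of_nat (b choose card S0) :: 'a) \<noteq> 0"
    proof -
      have "b choose card S0 dvd fact b" using c0 by (simp add: binomial_fact_lemma[symmetric])
      then have "\<not> p dvd (b choose card S0)" using b(1) p(1) prime_dvd_fact_iff[of p b] dvd_trans by auto
      then show ?thesis using p(2) by (simp add: of_nat_eq_0_iff_char_dvd)
    qed
    moreover have "(of_nat (b' choose (\<Sum>j\<in>S1. p ^ s' j)) :: 'a) \<noteq> 0" by (rule S'[rule_format]) (auto simp: S1_def)
    ultimately show "(of_nat (\<beta> choose (\<Sum>j\<in>S. p ^ s j)) :: 'a) \<noteq> 0"
      unfolding b(2) by (simp only: of_nat_choose_digit[OF p _ b(1)] mult_eq_0_iff) simp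
  qed
qed

section \<open>Kernels on the special linear group\<close>

lemma sum_words_prod:
  fixes h :: "nat \<Rightarrow> bool \<Rightarrow> 'a::comm_semiring_1"
  assumes "finite A"
  shows "(\<Sum>v\<in>words A. \<Prod>j\<in>A. h j (v j)) = (\<Prod>j\<in>A. h j True + h j False)"
  using assms
proof (induction A rule: finite_induct)
  case empty
  have "words {} = {\<lambda>_. False}" by (auto simp: words_def)
  then show ?case by simp
next
  case (insert a A)
  have e: "(\<Prod>j\<in>insert a A. h j ((w(a := b)) j)) = h a b * (\<Prod>j\<in>A. h j (w j))" for w b
  proof -
    have "(\<Prod>j\<in>A. h j ((w(a := b)) j)) = (\<Prod>j\<in>A. h j (w j))"
      by (rule prod.cong[OF refl]) (use insert(2) in auto)
    then show ?thesis by (simp only: prod.insert[OF insert(1,2)] fun_upd_same)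
  qed
  have "(\<Sum>v\<in>words (insert a A). \<Prod>j\<in>insert a A. h j (v j))
      = (\<Sum>w\<in>words A. (h a True + h a False) * (\<Prod>j\<in>A. h j (w j)))"
    unfolding sum_words_insert[OF insert(2)] e by (simp add: distrib_right add.commute)
  also have "\<dots> = (h a True + h a False) * (\<Prod>j\<in>A. h j True + h j False)"
    unfolding sum_distrib_left[symmetric] insert.IH ..
  finally show ?case by (simp add: insert(1,2))
qed

lemma prod_digits:
  fixes a b :: "'a::comm_semiring_1"
  assumes "finite A" "(\<Sum>j\<in>A. p ^ s j) = \<beta>"
  shows "(\<Prod>j\<in>A. (if w j then a else b) ^ (p ^ s j))
    = a ^ (\<Sum>j\<in>A \<inter> {j. w j}. p ^ s j) * b ^ (\<beta> - (\<Sum>j\<in>A \<inter> {j. w j}. p ^ s j))"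
proof -
  have "(\<Prod>j\<in>A. (if w j then a else b) ^ (p ^ s j)) = (\<Prod>j\<in>A. if w j then a ^ (p ^ s j) else b ^ (p ^ s j))"
    by (rule prod.cong) auto
  also have "\<dots> = (\<Prod>j\<in>A \<inter> {j. w j}. a ^ (p ^ s j)) * (\<Prod>j\<in>A \<inter> - {j. w j}. b ^ (p ^ s j))"
    by (rule prod.If_cases[OF assms(1)])
  also have "\<dots> = a ^ (\<Sum>j\<in>A \<inter> {j. w j}. p ^ s j) * b ^ (\<Sum>j\<in>A \<inter> - {j. w j}. p ^ s j)"
    by (simp add: power_sum)
  also have "(\<Sum>j\<in>A \<inter> - {j. w j}. p ^ s j) = \<beta> - (\<Sum>j\<in>A \<inter> {j. w j}. p ^ s j)"
    using sum.Int_Diff[OF assms(1), of "\<lambda>j. p ^ s j" "{j. w j}"] assms(2) by (simp add: Diff_eq)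
  finally show ?thesis .
qed

lemma frobenius_add:
  assumes "prime p" "CHAR('a::field) = p"
  shows "(x + y :: 'a) ^ (p ^ k) = x ^ (p ^ k) + y ^ (p ^ k)"
  using freshmans_dream'[of "p ^ k" k x y] assms by simp

text \<open>The coefficient of x^\<beta> when H is written as a polynomial of degree below q, by
  \<open>kernel_expansion\<close>.\<close>

definition gam :: "('q::{finite,field} \<Rightarrow> 'K::field) \<Rightarrow> ('q \<Rightarrow> 'K) \<Rightarrow> nat \<Rightarrow> 'K" where
  "gam \<sigma> H \<beta> = (\<Sum>s\<in>UNIV. kap \<sigma> \<beta> s * H s)"

lemma hom_inj:
  fixes \<sigma> :: "'q::field \<Rightarrow> 'K::field"
  assumes "field_hom \<sigma>" "x \<noteq> y" shows "\<sigma> x \<noteq> \<sigma> y"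
proof
  interpret \<sigma>: field_hom \<sigma> by fact
  assume "\<sigma> x = \<sigma> y"
  then have "\<sigma> (x - y) = 0" by (simp add: hom_distribs)
  then have "\<sigma> ((x - y) * inverse (x - y)) = 0" by (simp only: \<sigma>.hom_mult mult_zero_left)
  then show False using assms(2) by simp
qed

text \<open>The converse half of the duality between monomials and \<open>kap\<close>, which is
  interpolation. For s \<noteq> x the geometric sum S is (x^q - s^q) / (x - s) = 1; for s = x it is
  a multiple of q.\<close>

lemma sum_kap_dual:
  fixes \<sigma> :: "'q::{finite,field} \<Rightarrow> 'K::field"
  assumes "field_hom \<sigma>"
  shows "(\<Sum>\<beta><card (UNIV :: 'q set). kap \<sigma> \<beta> s * \<sigma> x ^ \<beta>) = (if s = x then 1 else 0)"
proof -
  interpret \<sigma>: field_hom \<sigma> by fact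
  have q2: "card (UNIV :: 'q set) \<ge> 2" by (rule card_field_ge_2)
  then obtain n where q: "card (UNIV :: 'q set) = Suc n" by (cases "card (UNIV :: 'q set)") auto
  have per: "\<sigma> z ^ Suc n = \<sigma> z" for z using finite_field_power_card[of z] unfolding q by (metis \<sigma>.hom_power)
  define S where "S = (\<Sum>\<beta><Suc n. \<sigma> x ^ \<beta> * \<sigma> s ^ (n - \<beta>))"
  have "(\<Sum>\<beta><Suc n. kap \<sigma> \<beta> s * \<sigma> x ^ \<beta>) = (\<Sum>\<beta><Suc n. (if \<beta> = 0 then \<sigma> x ^ \<beta> else 0) - \<sigma> x ^ \<beta> * \<sigma> s ^ (n - \<beta>))"
    by (rule sum.cong[OF refl]) (simp add: kap_def q algebra_simps)
  also have "\<dots> = 1 - S" unfolding sum_subtractf S_def by (simp del: sum.lessThan_Suc)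
  finally have 1: "(\<Sum>\<beta><Suc n. kap \<sigma> \<beta> s * \<sigma> x ^ \<beta>) = 1 - S" .
  show ?thesis
  proof (cases "s = x")
    case True
    have "S = (\<Sum>\<beta><Suc n. \<sigma> x ^ n)" unfolding S_def True
      by (rule sum.cong[OF refl]) (simp flip: power_add)
    then have "S = of_nat (Suc n) * \<sigma> x ^ n" by simp
    moreover have "of_nat (Suc n) = (0 :: 'K)"
      using hom_power_sum_finite_field[OF assms, of 0] q2 by (simp add: q)
    ultimately show ?thesis using 1 True q by simp
  next
    case False
    have "\<sigma> x - \<sigma> s = (\<sigma> x - \<sigma> s) * S"
      using diff_power_eq_sum[of "\<sigma> x" n "\<sigma> s"] unfolding per S_def .
    then have "S = 1" using hom_inj[OF assms, of x s] False by simp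
    then show ?thesis using 1 False q by simp
  qed
qed

lemma kernel_expansion:
  fixes \<sigma> :: "'q::{finite,field} \<Rightarrow> 'K::field"
  assumes "field_hom \<sigma>"
  shows "H x = (\<Sum>\<beta><card (UNIV :: 'q set). gam \<sigma> H \<beta> * \<sigma> x ^ \<beta>)"
proof -
  have "(\<Sum>\<beta><card (UNIV :: 'q set). gam \<sigma> H \<beta> * \<sigma> x ^ \<beta>)
      = (\<Sum>\<beta><card (UNIV :: 'q set). \<Sum>s\<in>UNIV. H s * (kap \<sigma> \<beta> s * \<sigma> x ^ \<beta>))"
    by (simp add: gam_def sum_distrib_right sum_distrib_left mult_ac)
  also have "\<dots> = (\<Sum>s\<in>UNIV. \<Sum>\<beta><card (UNIV :: 'q set). H s * (kap \<sigma> \<beta> s * \<sigma> x ^ \<beta>))" by (rule sum.swap)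
  also have "\<dots> = (\<Sum>s\<in>UNIV. if s = x then H s else 0)"
    by (rule sum.cong[OF refl]) (simp only: sum_distrib_left[symmetric] sum_kap_dual[OF assms], simp)
  finally show ?thesis by simp
qed

text \<open>Averaging over the dilations by m against the character m^(-\<beta>) isolates the
  exponent \<beta>. The exponents 0 and q - 1 give the same character, and \<open>nb\<close> ensures
  that at most one of them occurs in H.\<close>

lemma kernel_extract:
  fixes \<sigma> :: "'q::{finite,field} \<Rightarrow> 'K::field"
  assumes hom: "field_hom \<sigma>" and nb: "gam \<sigma> H 0 = 0 \<or> gam \<sigma> H (card (UNIV :: 'q set) - 1) = 0"
    and \<beta>: "\<beta> < card (UNIV :: 'q set)" "gam \<sigma> H \<beta> \<noteq> 0"
  shows "(\<Sum>m\<in>UNIV - {0}. \<sigma> m ^ (card (UNIV :: 'q set) - 1 - \<beta>) * H (m * y)) = - (gam \<sigma> H \<beta> * \<sigma> y ^ \<beta>)"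
proof -
  interpret \<sigma>: field_hom \<sigma> by (rule hom)
  define q where "q = card (UNIV :: 'q set)"
  have "(\<Sum>m\<in>UNIV - {0}. \<sigma> m ^ (q - 1 - \<beta>) * H (m * y))
      = (\<Sum>m\<in>UNIV - {0}. \<Sum>j<q. gam \<sigma> H j * \<sigma> y ^ j * (\<sigma> m ^ (q - 1 - \<beta>) * \<sigma> m ^ j))"
  proof (rule sum.cong[OF refl])
    fix m
    show "\<sigma> m ^ (q - 1 - \<beta>) * H (m * y) = (\<Sum>j<q. gam \<sigma> H j * \<sigma> y ^ j * (\<sigma> m ^ (q - 1 - \<beta>) * \<sigma> m ^ j))"
      unfolding kernel_expansion[OF hom, of H "m * y"] q_def[symmetric]
      by (simp add: sum_distrib_left \<sigma>.hom_mult power_mult_distrib mult_ac)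
  qed
  also have "\<dots> = (\<Sum>j<q. \<Sum>m\<in>UNIV - {0}. gam \<sigma> H j * \<sigma> y ^ j * (\<sigma> m ^ (q - 1 - \<beta>) * \<sigma> m ^ j))" by (rule sum.swap)
  also have "\<dots> = (\<Sum>j<q. if j = \<beta> then - (gam \<sigma> H \<beta> * \<sigma> y ^ \<beta>) else 0)"
  proof (rule sum.cong[OF refl])
    fix j assume "j \<in> {..<q}"
    then have j: "j < card (UNIV :: 'q set)" by (simp add: q_def)
    show "(\<Sum>m\<in>UNIV - {0}. gam \<sigma> H j * \<sigma> y ^ j * (\<sigma> m ^ (q - 1 - \<beta>) * \<sigma> m ^ j))
        = (if j = \<beta> then - (gam \<sigma> H \<beta> * \<sigma> y ^ \<beta>) else 0)"
      unfolding sum_distrib_left[symmetric] q_def sum_sigma_power[OF hom j \<beta>(1)]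
      using nb \<beta>(2) by auto
  qed
  finally show ?thesis using \<beta>(1) by (simp add: q_def)
qed

text \<open>Averaging over m leaves a multiple of (c + t d)^\<beta>; the functional
  \<open>kap\<close> in the variable t then picks out the term of degree e of its binomial
  expansion.\<close>

lemma kernel_monomial:
  fixes \<sigma> :: "'q::{finite,field} \<Rightarrow> 'K::field"
  assumes hom: "field_hom \<sigma>" and nb: "gam \<sigma> H 0 = 0 \<or> gam \<sigma> H (card (UNIV :: 'q set) - 1) = 0"
    and \<beta>: "\<beta> < card (UNIV :: 'q set)" "gam \<sigma> H \<beta> \<noteq> 0" and e: "e \<le> \<beta>"
  shows "(\<Sum>t\<in>UNIV. kap \<sigma> e t * (\<Sum>m\<in>UNIV - {0}. \<sigma> m ^ (card (UNIV :: 'q set) - 1 - \<beta>) * H (m * (c + t * d))))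
    = - (gam \<sigma> H \<beta> * of_nat (\<beta> choose e) * (\<sigma> d ^ e * \<sigma> c ^ (\<beta> - e)))"
proof -
  interpret \<sigma>: field_hom \<sigma> by (rule hom)
  let ?D = "\<lambda>k. - (gam \<sigma> H \<beta> * of_nat (\<beta> choose k) * (\<sigma> d ^ k * \<sigma> c ^ (\<beta> - k)))"
  have "(\<Sum>t\<in>UNIV. kap \<sigma> e t * (\<Sum>m\<in>UNIV - {0}. \<sigma> m ^ (card (UNIV :: 'q set) - 1 - \<beta>) * H (m * (c + t * d))))
      = (\<Sum>t\<in>UNIV. \<Sum>k\<le>\<beta>. ?D k * (kap \<sigma> e t * \<sigma> t ^ k))"
  proof (rule sum.cong[OF refl])
    fix t
    have "\<sigma> (c + t * d) ^ \<beta> = (\<sigma> t * \<sigma> d + \<sigma> c) ^ \<beta>" by (simp add: hom_distribs add.commute)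
    also have "\<dots> = (\<Sum>k\<le>\<beta>. of_nat (\<beta> choose k) * (\<sigma> t * \<sigma> d) ^ k * \<sigma> c ^ (\<beta> - k))" by (rule binomial_ring)
    finally have e: "\<sigma> (c + t * d) ^ \<beta> = (\<Sum>k\<le>\<beta>. of_nat (\<beta> choose k) * (\<sigma> t * \<sigma> d) ^ k * \<sigma> c ^ (\<beta> - k))" .
    show "kap \<sigma> e t * (\<Sum>m\<in>UNIV - {0}. \<sigma> m ^ (card (UNIV :: 'q set) - 1 - \<beta>) * H (m * (c + t * d)))
        = (\<Sum>k\<le>\<beta>. ?D k * (kap \<sigma> e t * \<sigma> t ^ k))"
      unfolding kernel_extract[OF hom nb \<beta>] e
      by (simp add: sum_distrib_left power_mult_distrib mult_ac sum_negf)
  qed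
  also have "\<dots> = (\<Sum>k\<le>\<beta>. \<Sum>t\<in>UNIV. ?D k * (kap \<sigma> e t * \<sigma> t ^ k))" by (rule sum.swap)
  also have "\<dots> = (\<Sum>k\<le>\<beta>. if k = e then ?D k else 0)"
  proof (rule sum.cong[OF refl])
    fix k assume "k \<in> {..\<beta>}"
    then have k: "e < card (UNIV :: 'q set)" "k < card (UNIV :: 'q set)" using \<beta>(1) e by auto
    show "(\<Sum>t\<in>UNIV. ?D k * (kap \<sigma> e t * \<sigma> t ^ k)) = (if k = e then ?D k else 0)"
      unfolding sum_distrib_left[symmetric] sum_kap[OF hom k] by simp
  qed
  also have "\<dots> = ?D e" using e by simp
  finally show ?thesis .
qed

lemma sum_swap3:
  fixes a :: "'i \<Rightarrow> 'a::comm_semiring_0"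
  shows "(\<Sum>i\<in>I. a i * (\<Sum>t\<in>T. k t * (\<Sum>m\<in>M. e m * b i t m))) = (\<Sum>t\<in>T. k t * (\<Sum>m\<in>M. e m * (\<Sum>i\<in>I. a i * b i t m)))"
proof -
  have "(\<Sum>i\<in>I. a i * (\<Sum>t\<in>T. k t * (\<Sum>m\<in>M. e m * b i t m))) = (\<Sum>i\<in>I. \<Sum>t\<in>T. \<Sum>m\<in>M. k t * (e m * (a i * b i t m)))"
    by (simp add: sum_distrib_left mult_ac)
  also have "\<dots> = (\<Sum>t\<in>T. \<Sum>i\<in>I. \<Sum>m\<in>M. k t * (e m * (a i * b i t m)))" by (rule sum.swap)
  also have "\<dots> = (\<Sum>t\<in>T. \<Sum>m\<in>M. \<Sum>i\<in>I. k t * (e m * (a i * b i t m)))"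
    by (rule sum.cong[OF refl]) (rule sum.swap)
  finally show ?thesis by (simp add: sum_distrib_left)
qed

lemma sum_assoc:
  fixes a :: "'i \<Rightarrow> 'a::comm_semiring_0"
  shows "(\<Sum>i\<in>I. a i * (\<Sum>j\<in>J. b i j * c j)) = (\<Sum>j\<in>J. (\<Sum>i\<in>I. a i * b i j) * c j)"
proof -
  have "(\<Sum>i\<in>I. a i * (\<Sum>j\<in>J. b i j * c j)) = (\<Sum>i\<in>I. \<Sum>j\<in>J. a i * b i j * c j)"
    by (simp add: sum_distrib_left mult_ac)
  also have "\<dots> = (\<Sum>j\<in>J. \<Sum>i\<in>I. a i * b i j * c j)" by (rule sum.swap)
  finally show ?thesis by (simp add: sum_distrib_right)
qed

section \<open>The special linear group of degree two\<close>

definition sl :: "'q::field \<Rightarrow> 'q \<Rightarrow> 'q \<Rightarrow> 'q \<Rightarrow> 'q mat" where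
  "sl a b c d = mat 2 2 (\<lambda>(i, j). if i = 0 then if j = 0 then a else b else if j = 0 then c else d)"

lemma sl_index [simp]:
  "sl a b c d $$ (0, 0) = a" "sl a b c d $$ (0, Suc 0) = b" "sl a b c d $$ (Suc 0, 0) = c" "sl a b c d $$ (Suc 0, Suc 0) = d"
  "sl a b c d \<in> carrier_mat 2 2"
  by (simp_all add: sl_def)

lemma mult_index_2:
  assumes "A \<in> carrier_mat 2 2" "B \<in> carrier_mat 2 2" "i < 2" "j < 2"
  shows "(A * B) $$ (i, j) = A $$ (i, 0) * B $$ (0, j) + A $$ (i, Suc 0) * B $$ (Suc 0, j)"
  unfolding mat_mult_index[OF assms] by (simp add: numeral_2_eq_2)

lemma mat2_eqI:
  assumes "A \<in> carrier_mat 2 2" "B \<in> carrier_mat 2 2" "A $$ (0, 0) = B $$ (0, 0)" "A $$ (0, Suc 0) = B $$ (0, Suc 0)"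
    "A $$ (Suc 0, 0) = B $$ (Suc 0, 0)" "A $$ (Suc 0, Suc 0) = B $$ (Suc 0, Suc 0)"
  shows "A = B"
proof (rule eq_matI)
  fix i j assume "i < dim_row B" "j < dim_col B"
  then have "i = 0 \<or> i = Suc 0" "j = 0 \<or> j = Suc 0" using assms(2) by auto
  then show "A $$ (i, j) = B $$ (i, j)" using assms by auto
qed (use assms in auto)

lemma sl_mult: "sl a b c d * sl a' b' c' d' = sl (a * a' + b * c') (a * b' + b * d') (c * a' + d * c') (c * b' + d * d')"
  by (rule mat2_eqI[OF mult_carrier_mat[of _ 2 2]]) (simp_all add: mult_index_2 del: index_mult_mat)

lemma sl_eta: "A \<in> carrier_mat 2 2 \<Longrightarrow> sl (A $$ (0, 0)) (A $$ (0, Suc 0)) (A $$ (Suc 0, 0)) (A $$ (Suc 0, Suc 0)) = A"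
  by (rule mat2_eqI) simp_all

lemma det_mat2:
  assumes A: "A \<in> carrier_mat 2 2"
  shows "det A = A $$ (0, 0) * A $$ (Suc 0, Suc 0) - A $$ (0, Suc 0) * A $$ (Suc 0, 0)"
proof -
  have 1: "det (mat_delete A 0 j) = A $$ (Suc 0, 1 - j)" if "j < 2" for j
  proof -
    have "mat_delete A 0 j \<in> carrier_mat 1 1" using A that by (simp add: mat_delete_def)
    then have "det (mat_delete A 0 j) = mat_delete A 0 j $$ (0, 0)" by (rule det_single)
    also have "\<dots> = A $$ (Suc 0, 1 - j)" using A that by (cases j) (auto simp: mat_delete_def)
    finally show ?thesis .
  qed
  show ?thesis
    using laplace_expansion_row[OF A, of 0] by (simp add: numeral_2_eq_2 cofactor_def 1)
qed

lemma sl_in_SL2_iff [simp]: "sl a b c d \<in> SL2 \<longleftrightarrow> a * d - b * c = 1"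
  by (simp add: SL2_def det_mat2)

lemma SL2_carrier: "g \<in> SL2 \<Longrightarrow> g \<in> carrier_mat 2 2"
  by (simp add: SL2_def)

lemma SL2_mult: "g \<in> SL2 \<Longrightarrow> h \<in> SL2 \<Longrightarrow> g * h \<in> SL2"
  by (auto simp: SL2_def det_mult)

text \<open>The natural module carried over to the large field; the letter \<open>True\<close> is
  the first basis vector and \<open>False\<close> the second.\<close>

definition nat2 :: "('q::field \<Rightarrow> 'K::field) \<Rightarrow> 'q mat \<Rightarrow> bool \<Rightarrow> bool \<Rightarrow> 'K" where
  "nat2 \<sigma> g x y = \<sigma> (g $$ (if x then 0 else Suc 0, if y then 0 else Suc 0))"

lemma nat2_mult:
  assumes "field_hom \<sigma>" "g \<in> SL2" "h \<in> SL2"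
  shows "nat2 \<sigma> (g * h) x y = nat2 \<sigma> g x True * nat2 \<sigma> h True y + nat2 \<sigma> g x False * nat2 \<sigma> h False y"
proof -
  interpret \<sigma>: field_hom \<sigma> by fact
  show ?thesis using assms(2,3)
    by (simp add: nat2_def mult_index_2 SL2_carrier hom_distribs del: index_mult_mat)
qed

lemma unimodular_nat2:
  assumes "field_hom \<sigma>" shows "unimodular SL2 (nat2 \<sigma>)"
proof -
  interpret \<sigma>: field_hom \<sigma> by fact
  show ?thesis unfolding unimodular_def
  proof
    fix g :: "'a mat" assume g: "g \<in> SL2"
    then have "det g = 1" "g \<in> carrier_mat 2 2" by (simp_all add: SL2_def)
    then have "\<sigma> (g $$ (0, 0) * g $$ (Suc 0, Suc 0) - g $$ (0, Suc 0) * g $$ (Suc 0, 0)) = 1"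
      by (simp add: det_mat2)
    then show "nat2 \<sigma> g False False * nat2 \<sigma> g True True - nat2 \<sigma> g False True * nat2 \<sigma> g True False = 1"
      by (simp add: nat2_def hom_distribs mult.commute)
  qed
qed

text \<open>Taking p^(s j)-th powers is additive, so the twisted tensor product is multiplicative.
  The outer words a and b are arbitrary, which covers the entries of the action as well as the rows
  and columns cut out of it.\<close>

lemma word_mult:
  fixes \<sigma> :: "'q::{finite,field} \<Rightarrow> 'K::field"
  assumes "field_hom \<sigma>" "prime p" "CHAR('K) = p" "g \<in> SL2" "h \<in> SL2" "finite C"
  shows "(\<Sum>v\<in>words C. (\<Prod>j\<in>C. nat2 \<sigma> g (a j) (v j) ^ (p ^ s j)) * (\<Prod>j\<in>C. nat2 \<sigma> h (v j) (b j) ^ (p ^ s j)))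
    = (\<Prod>j\<in>C. nat2 \<sigma> (g * h) (a j) (b j) ^ (p ^ s j))"
  unfolding prod.distrib[symmetric]
    sum_words_prod[OF assms(6), where h = "\<lambda>j x. nat2 \<sigma> g (a j) x ^ (p ^ s j) * nat2 \<sigma> h x (b j) ^ (p ^ s j)"]
  by (simp add: nat2_mult[OF assms(1,4,5)] frobenius_add[OF assms(2,3)] power_mult_distrib)

text \<open>\<open>A y\<close> stands for the row \<phi> \<rho>(y) and \<open>B l x\<close> for the
  entries of the column \<rho>(x) m, so that their pairing is a matrix coefficient at y x. By
  \<open>indA\<close> and \<open>indB\<close> the rows separate vectors and the columns separate
  functionals, hence identities between maps may be checked after pairing.\<close>

locale sl2_kernel =
  fixes \<sigma> :: "'q::{finite,field} \<Rightarrow> 'K::field" and p n :: nat and I :: "nat set"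
    and R :: "'q mat \<Rightarrow> nat \<Rightarrow> nat \<Rightarrow> 'K" and A :: "'q mat \<Rightarrow> nat \<Rightarrow> 'K" and B :: "nat \<Rightarrow> 'q mat \<Rightarrow> 'K" and H :: "'q \<Rightarrow> 'K"
  assumes hom: "field_hom \<sigma>" and p: "prime p" "CHAR('K) = p" and q: "card (UNIV :: 'q set) = p ^ n"
    and finI: "finite I"
    and AR: "\<And>g h l. g \<in> SL2 \<Longrightarrow> h \<in> SL2 \<Longrightarrow> l \<in> I \<Longrightarrow> (\<Sum>j\<in>I. A g j * R h j l) = A (g * h) l"
    and RB: "\<And>h x i. h \<in> SL2 \<Longrightarrow> x \<in> SL2 \<Longrightarrow> i \<in> I \<Longrightarrow> (\<Sum>j\<in>I. R h i j * B j x) = B i (h * x)"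
    and AB: "\<And>g x. g \<in> SL2 \<Longrightarrow> x \<in> SL2 \<Longrightarrow> (\<Sum>l\<in>I. A g l * B l x) = H ((g * x) $$ (Suc 0, 0))"
    and indA: "\<And>v l. (\<And>g. g \<in> SL2 \<Longrightarrow> (\<Sum>l\<in>I. A g l * v l) = 0) \<Longrightarrow> l \<in> I \<Longrightarrow> v l = 0"
    and indB: "\<And>a l. (\<And>x. x \<in> SL2 \<Longrightarrow> (\<Sum>l\<in>I. a l * B l x) = 0) \<Longrightarrow> l \<in> I \<Longrightarrow> a l = 0"
    and not_both: "gam \<sigma> H 0 = 0 \<or> gam \<sigma> H (card (UNIV :: 'q set) - 1) = 0"
begin

text \<open>The power c^\<beta> of the lower left entry c of y x is the pairing of a row P(y) with a
  column Q(x) of a twisted tensor product, built from the digits of \<beta>. The maps f and g are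
  made so that A f = P and g B is a multiple of Q. As P and Q transform like A and B, separation
  makes f and g homomorphisms.\<close>

lemma kernel_homs:
  assumes \<beta>: "\<beta> < card (UNIV :: 'q set)" "gam \<sigma> H \<beta> \<noteq> 0"
  shows "\<exists>C s f g. finite C \<and> ihom SL2 (twisted p (nat2 \<sigma>) C s) (I, R) f \<and> ihom SL2 (I, R) (twisted p (nat2 \<sigma>) C s) g \<and>
    (\<forall>y\<in>SL2. \<forall>x\<in>SL2. (\<Sum>i\<in>I. A y i * (\<Sum>l\<in>I. mm (words C) f g i l * B l x)) = gam \<sigma> H \<beta> * \<sigma> ((y * x) $$ (Suc 0, 0)) ^ \<beta>)"
proof -
  interpret \<sigma>: field_hom \<sigma> by (rule hom)
  let ?q = "card (UNIV :: 'q set)" and ?\<gamma> = "gam \<sigma> H \<beta>"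
  obtain C :: "nat set" and s where *: "finite C \<and> (\<Sum>j\<in>C. p ^ s j) = \<beta> \<and>
      (\<forall>S. S \<subseteq> C \<longrightarrow> (of_nat (\<beta> choose (\<Sum>j\<in>S. p ^ s j)) :: 'K) \<noteq> 0)"
    using digit_expansion[OF p \<beta>(1)[unfolded q]] by (elim exE) (rule that)
  note C = *[THEN conjunct1] *[THEN conjunct2, THEN conjunct1] and nz = *[THEN conjunct2, THEN conjunct2, rule_format]
  define \<mu> where "\<mu> w = (\<Sum>j\<in>C \<inter> {j. w j}. p ^ s j)" for w
  have \<mu>le: "\<mu> w \<le> \<beta>" for w unfolding \<mu>_def C(2)[symmetric] by (rule sum_mono2[OF C(1)]) auto
  have \<mu>nz: "(of_nat (\<beta> choose \<mu> w) :: 'K) \<noteq> 0" for w unfolding \<mu>_def by (rule nz) auto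
  define P where "P y w = (\<Prod>j\<in>C. nat2 \<sigma> y False (w j) ^ (p ^ s j))" for y w
  define Q where "Q w x = (\<Prod>j\<in>C. nat2 \<sigma> x (w j) True ^ (p ^ s j))" for w x
  have Pm: "P y w = \<sigma> (y $$ (Suc 0, 0)) ^ \<mu> w * \<sigma> (y $$ (Suc 0, Suc 0)) ^ (\<beta> - \<mu> w)" for y w
    unfolding \<mu>_def prod_digits[OF C, symmetric] P_def by (rule prod.cong) (simp_all add: nat2_def)
  have Qm: "Q w x = \<sigma> (x $$ (0, 0)) ^ \<mu> w * \<sigma> (x $$ (Suc 0, 0)) ^ (\<beta> - \<mu> w)" for x w
    unfolding \<mu>_def prod_digits[OF C, symmetric] Q_def by (rule prod.cong) (simp_all add: nat2_def)
  have L: "snd (twisted p (nat2 \<sigma>) C s) h v w = (\<Prod>j\<in>C. nat2 \<sigma> h (v j) (w j) ^ (p ^ s j))" for h v w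
    by (simp add: twisted_def erep_def)
  have PL: "(\<Sum>v\<in>words C. P y v * snd (twisted p (nat2 \<sigma>) C s) h v w) = P (y * h) w" if "y \<in> SL2" "h \<in> SL2" for y h w
    unfolding P_def L by (rule word_mult[OF hom p that C(1)])
  have LQ: "(\<Sum>v\<in>words C. snd (twisted p (nat2 \<sigma>) C s) h w v * Q v x) = Q w (h * x)" if "h \<in> SL2" "x \<in> SL2" for h x w
    unfolding Q_def L by (rule word_mult[OF hom p that C(1)])
  have PQ: "(\<Sum>w\<in>words C. P y w * Q w x) = \<sigma> ((y * x) $$ (Suc 0, 0)) ^ \<beta>" if "y \<in> SL2" "x \<in> SL2" for y x
    unfolding P_def Q_def word_mult[OF hom p that C(1)] by (simp add: nat2_def C(2) flip: power_sum)
  \<comment> \<open>Pairing \<open>A y\<close> with the column at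
    \<open>sl m 0 (t * m) (1 / m)\<close> gives H(m (c + t d)), where (c, d) is the bottom row of y.
    The two sums extract the monomial P(y), and the last factor cancels the constant that
    \<open>kernel_monomial\<close> leaves.\<close>
  define f where "f i w = (if i \<in> I \<and> w \<in> words C then
      (\<Sum>t\<in>UNIV. kap \<sigma> (\<beta> - \<mu> w) t * (\<Sum>m\<in>UNIV - {0}. \<sigma> m ^ (?q - 1 - \<beta>) * B i (sl m 0 (t * m) (1 / m))))
        * (- 1 / (?\<gamma> * of_nat (\<beta> choose \<mu> w))) else 0)" for i w
  \<comment> \<open>The dual construction, from the first column of x. The factor
    \<open>gam \<sigma> H \<beta>\<close> is kept on this side, as it is the weight with which
    \<beta> enters the expansion of H.\<close>
  define g where "g w l = (if w \<in> words C \<and> l \<in> I then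
      (\<Sum>t\<in>UNIV. kap \<sigma> (\<mu> w) t * (\<Sum>m\<in>UNIV - {0}. \<sigma> m ^ (?q - 1 - \<beta>) * A (sl (1 / m) 0 (m * t) m) l))
        * (- 1 / of_nat (\<beta> choose \<mu> w)) else 0)" for w l
  have Af: "(\<Sum>i\<in>I. A y i * f i w) = P y w" if y: "y \<in> SL2" and w: "w \<in> words C" for y w
  proof -
    have "(\<Sum>i\<in>I. A y i * f i w) = (\<Sum>i\<in>I. A y i * (\<Sum>t\<in>UNIV. kap \<sigma> (\<beta> - \<mu> w) t *
        (\<Sum>m\<in>UNIV - {0}. \<sigma> m ^ (?q - 1 - \<beta>) * B i (sl m 0 (t * m) (1 / m))))) * (- 1 / (?\<gamma> * of_nat (\<beta> choose \<mu> w)))"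
      unfolding sum_distrib_right[of _ I]
    proof (rule sum.cong[OF refl])
      fix i assume "i \<in> I"
      then have c: "i \<in> I \<and> w \<in> words C" using w ..
      show "A y i * f i w = A y i * (\<Sum>t\<in>UNIV. kap \<sigma> (\<beta> - \<mu> w) t *
        (\<Sum>m\<in>UNIV - {0}. \<sigma> m ^ (?q - 1 - \<beta>) * B i (sl m 0 (t * m) (1 / m)))) * (- 1 / (?\<gamma> * of_nat (\<beta> choose \<mu> w)))"
        unfolding f_def if_P[OF c] mult.assoc ..
    qed
    also have "(\<Sum>i\<in>I. A y i * (\<Sum>t\<in>UNIV. kap \<sigma> (\<beta> - \<mu> w) t *
        (\<Sum>m\<in>UNIV - {0}. \<sigma> m ^ (?q - 1 - \<beta>) * B i (sl m 0 (t * m) (1 / m)))))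
      = (\<Sum>t\<in>UNIV. kap \<sigma> (\<beta> - \<mu> w) t * (\<Sum>m\<in>UNIV - {0}. \<sigma> m ^ (?q - 1 - \<beta>) *
          H (m * (y $$ (Suc 0, 0) + t * y $$ (Suc 0, Suc 0)))))"
      unfolding sum_swap3[where I = I]
    proof (rule sum.cong[OF refl], rule arg_cong[where f = "(*) _"], rule sum.cong[OF refl], rule arg_cong[where f = "(*) _"])
      fix t m :: 'q assume "m \<in> UNIV - {0}"
      then have sl: "sl m 0 (t * m) (1 / m) \<in> SL2" by simp
      show "(\<Sum>i\<in>I. A y i * B i (sl m 0 (t * m) (1 / m))) = H (m * (y $$ (Suc 0, 0) + t * y $$ (Suc 0, Suc 0)))"
        unfolding AB[OF y sl] using y
        by (simp add: mult_index_2 SL2_carrier algebra_simps del: index_mult_mat)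
    qed
    also have "\<dots> = - (?\<gamma> * of_nat (\<beta> choose \<mu> w) * P y w)"
      unfolding kernel_monomial[OF hom not_both \<beta> diff_le_self] Pm
      using \<mu>le[of w] binomial_symmetric[OF \<mu>le[of w]] by (simp add: mult_ac)
    finally show ?thesis using \<beta>(2) \<mu>nz[of w] by simp
  qed
  have gB: "(\<Sum>l\<in>I. g w l * B l x) = ?\<gamma> * Q w x" if x: "x \<in> SL2" and w: "w \<in> words C" for x w
  proof -
    have "(\<Sum>l\<in>I. g w l * B l x) = (\<Sum>l\<in>I. B l x * (\<Sum>t\<in>UNIV. kap \<sigma> (\<mu> w) t *
        (\<Sum>m\<in>UNIV - {0}. \<sigma> m ^ (?q - 1 - \<beta>) * A (sl (1 / m) 0 (m * t) m) l))) * (- 1 / of_nat (\<beta> choose \<mu> w))"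
      unfolding sum_distrib_right[of _ I]
    proof (rule sum.cong[OF refl])
      fix l assume "l \<in> I"
      with w have c: "w \<in> words C \<and> l \<in> I" ..
      have comm: "a * b * x = x * a * b" for a b x :: 'K by (simp add: mult_ac)
      show "g w l * B l x = B l x * (\<Sum>t\<in>UNIV. kap \<sigma> (\<mu> w) t *
        (\<Sum>m\<in>UNIV - {0}. \<sigma> m ^ (?q - 1 - \<beta>) * A (sl (1 / m) 0 (m * t) m) l)) * (- 1 / of_nat (\<beta> choose \<mu> w))"
        unfolding g_def if_P[OF c] by (rule comm)
    qed
    also have "(\<Sum>l\<in>I. B l x * (\<Sum>t\<in>UNIV. kap \<sigma> (\<mu> w) t *
        (\<Sum>m\<in>UNIV - {0}. \<sigma> m ^ (?q - 1 - \<beta>) * A (sl (1 / m) 0 (m * t) m) l)))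
      = (\<Sum>t\<in>UNIV. kap \<sigma> (\<mu> w) t * (\<Sum>m\<in>UNIV - {0}. \<sigma> m ^ (?q - 1 - \<beta>) *
          H (m * (x $$ (Suc 0, 0) + t * x $$ (0, 0)))))"
      unfolding sum_swap3[where I = I]
    proof (rule sum.cong[OF refl], rule arg_cong[where f = "(*) _"], rule sum.cong[OF refl], rule arg_cong[where f = "(*) _"])
      fix t m :: 'q assume "m \<in> UNIV - {0}"
      then have sl: "sl (1 / m) 0 (m * t) m \<in> SL2" by simp
      show "(\<Sum>i\<in>I. B i x * A (sl (1 / m) 0 (m * t) m) i) = H (m * (x $$ (Suc 0, 0) + t * x $$ (0, 0)))"
        unfolding AB[OF sl x, unfolded mult.commute[of "A _ _"]] using x
        by (simp add: mult_index_2 SL2_carrier algebra_simps del: index_mult_mat)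
    qed
    also have "\<dots> = - (?\<gamma> * of_nat (\<beta> choose \<mu> w) * Q w x)"
      unfolding kernel_monomial[OF hom not_both \<beta> \<mu>le] Qm by (rule refl)
    finally show ?thesis using \<mu>nz[of w] by simp
  qed
  have hf: "ihom SL2 (twisted p (nat2 \<sigma>) C s) (I, R) f"
    unfolding ihom_def
  proof (intro conjI ballI)
    show "supported (fst (I, R)) (fst (twisted p (nat2 \<sigma>) C s)) f" by (simp add: supported_def f_def)
    fix h :: "'q mat" and i w assume h: "h \<in> SL2" and "i \<in> fst (I, R)" and "w \<in> fst (twisted p (nat2 \<sigma>) C s)"
    then have i: "i \<in> I" and w: "w \<in> words C" by simp_all
    let ?L = "snd (twisted p (nat2 \<sigma>) C s)"
    have "(\<Sum>v\<in>words C. f i v * ?L h v w) - (\<Sum>j\<in>I. R h i j * f j w) = 0"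
    proof (rule indA[OF _ i])
      fix y :: "'q mat" assume y: "y \<in> SL2"
      have "(\<Sum>i\<in>I. A y i * (\<Sum>v\<in>words C. f i v * ?L h v w)) = (\<Sum>v\<in>words C. P y v * ?L h v w)"
        unfolding sum_assoc by (rule sum.cong[OF refl]) (simp only: Af[OF y])
      also have "\<dots> = P (y * h) w" by (rule PL[OF y h])
      finally have 1: "(\<Sum>i\<in>I. A y i * (\<Sum>v\<in>words C. f i v * ?L h v w)) = P (y * h) w" .
      have "(\<Sum>i\<in>I. A y i * (\<Sum>j\<in>I. R h i j * f j w)) = (\<Sum>j\<in>I. A (y * h) j * f j w)"
        unfolding sum_assoc by (rule sum.cong[OF refl]) (simp only: AR[OF y h])
      also have "\<dots> = P (y * h) w" by (rule Af[OF SL2_mult[OF y h] w])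
      finally show "(\<Sum>i\<in>I. A y i * ((\<Sum>v\<in>words C. f i v * ?L h v w) - (\<Sum>j\<in>I. R h i j * f j w))) = 0"
        using 1 by (simp add: right_diff_distrib sum_subtractf)
    qed
    then show "mm (fst (twisted p (nat2 \<sigma>) C s)) f (?L h) i w = mm (fst (I, R)) (snd (I, R) h) f i w"
      by (simp add: mm_def)
  qed
  have hg: "ihom SL2 (I, R) (twisted p (nat2 \<sigma>) C s) g"
    unfolding ihom_def
  proof (intro conjI ballI)
    show "supported (fst (twisted p (nat2 \<sigma>) C s)) (fst (I, R)) g" by (simp add: supported_def g_def)
    fix h :: "'q mat" and w l assume h: "h \<in> SL2" and "w \<in> fst (twisted p (nat2 \<sigma>) C s)" and "l \<in> fst (I, R)"
    then have l: "l \<in> I" and w: "w \<in> words C" by simp_all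
    let ?L = "snd (twisted p (nat2 \<sigma>) C s)"
    have "(\<Sum>j\<in>I. g w j * R h j l) - (\<Sum>v\<in>words C. ?L h w v * g v l) = 0"
    proof (rule indB[OF _ l])
      fix x :: "'q mat" assume x: "x \<in> SL2"
      have "(\<Sum>l\<in>I. (\<Sum>j\<in>I. g w j * R h j l) * B l x) = (\<Sum>j\<in>I. g w j * B j (h * x))"
        unfolding sum_assoc[symmetric] by (rule sum.cong[OF refl]) (simp only: RB[OF h x])
      also have "\<dots> = ?\<gamma> * Q w (h * x)" by (rule gB[OF SL2_mult[OF h x] w])
      finally have 1: "(\<Sum>l\<in>I. (\<Sum>j\<in>I. g w j * R h j l) * B l x) = ?\<gamma> * Q w (h * x)" .
      have "(\<Sum>l\<in>I. (\<Sum>v\<in>words C. ?L h w v * g v l) * B l x) = (\<Sum>v\<in>words C. ?L h w v * (?\<gamma> * Q v x))"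
        unfolding sum_assoc[symmetric] by (rule sum.cong[OF refl]) (simp only: gB[OF x])
      also have "\<dots> = ?\<gamma> * Q w (h * x)" unfolding LQ[OF h x, symmetric] by (simp add: sum_distrib_left mult_ac)
      finally show "(\<Sum>l\<in>I. ((\<Sum>j\<in>I. g w j * R h j l) - (\<Sum>v\<in>words C. ?L h w v * g v l)) * B l x) = 0"
        using 1 by (simp add: left_diff_distrib sum_subtractf)
    qed
    then show "mm (fst (I, R)) g (snd (I, R) h) w l = mm (fst (twisted p (nat2 \<sigma>) C s)) (?L h) g w l"
      by (simp add: mm_def)
  qed
  have "(\<Sum>i\<in>I. A y i * (\<Sum>l\<in>I. mm (words C) f g i l * B l x)) = ?\<gamma> * \<sigma> ((y * x) $$ (Suc 0, 0)) ^ \<beta>"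
    if y: "y \<in> SL2" and x: "x \<in> SL2" for y x
  proof -
    have "(\<Sum>l\<in>I. mm (words C) f g i l * B l x) = (\<Sum>w\<in>words C. f i w * (?\<gamma> * Q w x))" for i
      unfolding mm_def sum_assoc[symmetric] by (rule sum.cong[OF refl]) (simp only: gB[OF x])
    then have "(\<Sum>i\<in>I. A y i * (\<Sum>l\<in>I. mm (words C) f g i l * B l x)) = (\<Sum>i\<in>I. A y i * (\<Sum>w\<in>words C. f i w * (?\<gamma> * Q w x)))"
      by (simp only:)
    also have "\<dots> = (\<Sum>w\<in>words C. P y w * (?\<gamma> * Q w x))"
      unfolding sum_assoc by (rule sum.cong[OF refl]) (simp only: Af[OF y])
    also have "\<dots> = ?\<gamma> * \<sigma> ((y * x) $$ (Suc 0, 0)) ^ \<beta>"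
      unfolding PQ[OF y x, symmetric] by (simp add: sum_distrib_left mult_ac)
    finally show ?thesis .
  qed
  then show ?thesis by (intro exI[of _ C] exI[of _ s] exI[of _ f] exI[of _ g] conjI ballI C(1) hf hg)
qed

lemma kernel_fac:
  assumes "finite J" "J \<subseteq> {\<beta>. \<beta> < card (UNIV :: 'q set) \<and> gam \<sigma> H \<beta> \<noteq> 0}"
  shows "\<exists>\<phi>. fac SL2 (I, R) {twisted p (nat2 \<sigma>) C s | C s. finite C} \<phi> \<and>
    (\<forall>y\<in>SL2. \<forall>x\<in>SL2. (\<Sum>i\<in>I. A y i * (\<Sum>l\<in>I. \<phi> i l * B l x)) = (\<Sum>\<beta>\<in>J. gam \<sigma> H \<beta> * \<sigma> ((y * x) $$ (Suc 0, 0)) ^ \<beta>))"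
  using assms
proof (induction J rule: finite_induct)
  case empty
  show ?case by (intro exI[of _ "\<lambda>i j. 0"] conjI fac_zero) simp
next
  case (insert \<beta> J)
  have J: "J \<subseteq> {\<beta>. \<beta> < card (UNIV :: 'q set) \<and> gam \<sigma> H \<beta> \<noteq> 0}" using insert.prems by blast
  obtain \<phi> where \<phi>: "fac SL2 (I, R) {twisted p (nat2 \<sigma>) C s | C s. finite C} \<phi>"
    "\<forall>y\<in>SL2. \<forall>x\<in>SL2. (\<Sum>i\<in>I. A y i * (\<Sum>l\<in>I. \<phi> i l * B l x)) = (\<Sum>\<beta>\<in>J. gam \<sigma> H \<beta> * \<sigma> ((y * x) $$ (Suc 0, 0)) ^ \<beta>)"
    using insert.IH[OF J] by (elim exE conjE) (rule that)
  have \<beta>: "\<beta> < card (UNIV :: 'q set)" "gam \<sigma> H \<beta> \<noteq> 0" using insert.prems by auto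
  obtain C s f g where h: "finite C" "ihom SL2 (twisted p (nat2 \<sigma>) C s) (I, R) f" "ihom SL2 (I, R) (twisted p (nat2 \<sigma>) C s) g"
    "\<forall>y\<in>SL2. \<forall>x\<in>SL2. (\<Sum>i\<in>I. A y i * (\<Sum>l\<in>I. mm (words C) f g i l * B l x)) = gam \<sigma> H \<beta> * \<sigma> ((y * x) $$ (Suc 0, 0)) ^ \<beta>"
    using kernel_homs[OF \<beta>] by (elim exE conjE) (rule that)
  have "twisted p (nat2 \<sigma>) C s \<in> {twisted p (nat2 \<sigma>) C s | C s. finite C}" using h(1) by blast
  from fac_step[OF this h(2,3) \<phi>(1)]
  have "fac SL2 (I, R) {twisted p (nat2 \<sigma>) C s | C s. finite C} (\<lambda>i j. \<phi> i j + mm (words C) f g i j)" by simp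
  moreover have "(\<Sum>i\<in>I. A y i * (\<Sum>l\<in>I. (\<phi> i l + mm (words C) f g i l) * B l x))
      = (\<Sum>\<beta>\<in>insert \<beta> J. gam \<sigma> H \<beta> * \<sigma> ((y * x) $$ (Suc 0, 0)) ^ \<beta>)" if "y \<in> SL2" "x \<in> SL2" for y x
    using bspec[OF bspec[OF \<phi>(2) that(1)] that(2)] bspec[OF bspec[OF h(4) that(1)] that(2)] insert(1,2)
    by (simp add: distrib_right distrib_left sum.distrib)
  ultimately show ?case by (intro exI[of _ "\<lambda>i j. \<phi> i j + mm (words C) f g i j"] conjI ballI)
qed

text \<open>Summed over all exponents with nonzero coefficient, the composites pair to H, exactly as
  the identity does. Separation on both sides then forces them to add up to the identity.\<close>

theorem kernel_inadd: "inadd SL2 (I, R) {twisted p (nat2 \<sigma>) C s | C s. finite C}"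
proof -
  let ?J = "{\<beta>. \<beta> < card (UNIV :: 'q set) \<and> gam \<sigma> H \<beta> \<noteq> 0}"
  have finJ: "finite ?J" by simp
  obtain \<phi> where \<phi>: "fac SL2 (I, R) {twisted p (nat2 \<sigma>) C s | C s. finite C} \<phi>"
    "\<forall>y\<in>SL2. \<forall>x\<in>SL2. (\<Sum>i\<in>I. A y i * (\<Sum>l\<in>I. \<phi> i l * B l x)) = (\<Sum>\<beta>\<in>?J. gam \<sigma> H \<beta> * \<sigma> ((y * x) $$ (Suc 0, 0)) ^ \<beta>)"
    using kernel_fac[OF finJ subset_refl] by (elim exE conjE) (rule that)
  have "(\<Sum>\<beta>\<in>?J. gam \<sigma> H \<beta> * \<sigma> z ^ \<beta>) = H z" for z
    unfolding kernel_expansion[OF hom, of H z] by (rule sum.mono_neutral_left) auto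
  then have \<phi>H: "(\<Sum>i\<in>I. A y i * (\<Sum>l\<in>I. \<phi> i l * B l x)) = H ((y * x) $$ (Suc 0, 0))" if "y \<in> SL2" "x \<in> SL2" for y x
    using bspec[OF bspec[OF \<phi>(2) that(1)] that(2)] by simp
  have "\<phi> = idm I"
  proof (rule supported_eqI)
    show "supported I I \<phi>" using ihom_supported[OF fac_ihom[OF \<phi>(1)]] by simp
    fix i l assume i: "i \<in> I" and l: "l \<in> I"
    have "\<phi> i l - idm I i l = 0"
    proof (rule indB[OF _ l])
      fix x :: "'q mat" assume x: "x \<in> SL2"
      have "(\<Sum>l\<in>I. \<phi> i l * B l x) - B i x = 0"
      proof (rule indA[OF _ i])
        fix y :: "'q mat" assume y: "y \<in> SL2"
        show "(\<Sum>i\<in>I. A y i * ((\<Sum>l\<in>I. \<phi> i l * B l x) - B i x)) = 0"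
          using \<phi>H[OF y x] AB[OF y x] by (simp add: right_diff_distrib sum_subtractf)
      qed
      moreover have "(\<Sum>l\<in>I. idm I i l * B l x) = B i x"
        using i finI by (simp add: idm_def if_distrib[of "\<lambda>z. z * _"] cong: if_cong)
      ultimately show "(\<Sum>l\<in>I. (\<phi> i l - idm I i l) * B l x) = 0"
        by (simp add: left_diff_distrib sum_subtractf)
    qed
    then show "\<phi> i l = idm I i l" by simp
  qed simp
  then show ?thesis using \<phi>(1) by (simp add: inadd_def)
qed

end

section \<open>Simple modules\<close>

lemma (in field_hom) exists_lin_functional:
  assumes "x \<noteq> 0" shows "\<exists>u. lin_functional u \<and> u x \<noteq> 0"
proof -
  obtain coord where coord: "\<forall>v. lin_functional (coord v)" "\<forall>x. finite {v. coord v x \<noteq> 0}"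
    "\<forall>x S. finite S \<longrightarrow> {v. coord v x \<noteq> 0} \<subseteq> S \<longrightarrow> x = (\<Sum>v\<in>S. hom (coord v x) * v)" "coord 1 1 = 1"
    using basis_expansion by (elim exE conjE) (rule that)
  have "{v. coord v x \<noteq> 0} \<noteq> {}"
    using coord(3)[rule_format, of "{}" x] assms by auto
  then show ?thesis using coord(1) by blast
qed

text \<open>A unipotent group of order a power of the characteristic fixes a vector: over a field
  containing the parameters, the first nonvanishing moment of an orbit is fixed.\<close>

lemma unipotent_fixed_vector:
  fixes N :: "'q::{finite,field} \<Rightarrow> nat \<Rightarrow> nat \<Rightarrow> 'k::field" and \<sigma> :: "'q \<Rightarrow> 'K::field" and \<iota> :: "'k \<Rightarrow> 'K"
  assumes hom: "field_hom \<sigma>" "field_hom \<iota>" and d: "d > 0"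
    and add: "\<And>s t i j. i < d \<Longrightarrow> j < d \<Longrightarrow> N (s + t) i j = (\<Sum>l<d. N s i l * N t l j)"
    and zero: "\<And>i j. i < d \<Longrightarrow> j < d \<Longrightarrow> N 0 i j = (if i = j then 1 else 0)"
  shows "\<exists>v. (\<exists>i<d. v i \<noteq> 0) \<and> (\<forall>t. \<forall>i<d. (\<Sum>j<d. N t i j * v j) = v i)"
proof -
  interpret \<sigma>: field_hom \<sigma> by (rule hom(1))
  interpret \<iota>: field_hom \<iota> by (rule hom(2))
  define S where "S j i = (\<Sum>t\<in>UNIV. \<sigma> t ^ j * \<iota> (N t i 0))" for j i
  \<comment> \<open>The indicator function of 0 is 1 - t^(q-1), so the value 1 of
    \<open>N 0 0 0\<close> is a difference of two moments.\<close>
  have ex: "\<exists>j. \<exists>i<d. S j i \<noteq> 0"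
  proof (rule ccontr)
    assume no: "\<not> ?thesis"
    have q: "card (UNIV :: 'q set) \<ge> 2" by (rule card_field_ge_2)
    have k: "kap \<sigma> 0 t = (if t = 0 then 1 else 0)" for t
      using sum_kap_dual[OF hom(1), of t 0] q
      by (simp add: power_0_left if_distrib[of "\<lambda>z. _ * z"] cong: if_cong)
    have "1 = (\<Sum>t\<in>UNIV. kap \<sigma> 0 t * \<iota> (N t 0 0))"
      unfolding k using zero[of 0 0] d by (simp add: if_distrib[of "\<lambda>z. z * _"] cong: if_cong)
    also have "\<dots> = S 0 0 - S (card (UNIV :: 'q set) - 1) 0"
      by (simp add: kap_def S_def left_diff_distrib sum_subtractf)
    also have "\<dots> = 0" using no d by auto
    finally show False by simp
  qed
  define j where "j = (LEAST j. \<exists>i<d. S j i \<noteq> 0)"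
  have j: "\<exists>i<d. S j i \<noteq> 0" unfolding j_def using ex by (rule LeastI_ex)
  have below: "S k i = 0" if "k < j" "i < d" for k i
    using not_less_Least[of k "\<lambda>j. \<exists>i<d. S j i \<noteq> 0"] that unfolding j_def by auto
  \<comment> \<open>Acting by r translates the orbit and turns t^j into (t - r)^j. All but the top
    term of its expansion are lower moments, which vanish by the choice of j.\<close>
  have fixed: "(\<Sum>l<d. \<iota> (N r i l) * S j l) = S j i" if i: "i < d" for r i
  proof -
    have "(\<Sum>l<d. \<iota> (N r i l) * S j l) = (\<Sum>l<d. \<Sum>t\<in>UNIV. \<sigma> t ^ j * (\<iota> (N r i l) * \<iota> (N t l 0)))"
      by (simp add: S_def sum_distrib_left mult_ac)
    also have "\<dots> = (\<Sum>t\<in>UNIV. \<Sum>l<d. \<sigma> t ^ j * (\<iota> (N r i l) * \<iota> (N t l 0)))" by (rule sum.swap)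
    also have "\<dots> = (\<Sum>t\<in>UNIV. \<sigma> t ^ j * \<iota> (N (r + t) i 0))"
      by (rule sum.cong[OF refl]) (simp add: add[OF i d] sum_distrib_left hom_distribs)
    also have "\<dots> = (\<Sum>t\<in>UNIV. \<sigma> (t - r) ^ j * \<iota> (N (r + (t - r)) i 0))"
      by (rule sum.reindex_bij_betw[symmetric], rule bij_betw_byWitness[where f' = "\<lambda>t. t + r"]) auto
    also have "\<dots> = (\<Sum>t\<in>UNIV. \<Sum>k\<le>j. of_nat (j choose k) * (\<sigma> (- r)) ^ (j - k) * (\<sigma> t ^ k * \<iota> (N t i 0)))"
    proof (rule sum.cong[OF refl])
      fix t :: 'q
      have "\<sigma> (t - r) ^ j = (\<sigma> t + \<sigma> (- r)) ^ j" by (simp add: hom_distribs)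
      also have "\<dots> = (\<Sum>k\<le>j. of_nat (j choose k) * \<sigma> t ^ k * \<sigma> (- r) ^ (j - k))" by (rule binomial_ring)
      finally have e: "\<sigma> (t - r) ^ j = (\<Sum>k\<le>j. of_nat (j choose k) * \<sigma> t ^ k * \<sigma> (- r) ^ (j - k))" .
      have rt: "r + (t - r) = t" by (simp add: algebra_simps)
      show "\<sigma> (t - r) ^ j * \<iota> (N (r + (t - r)) i 0)
          = (\<Sum>k\<le>j. of_nat (j choose k) * (\<sigma> (- r)) ^ (j - k) * (\<sigma> t ^ k * \<iota> (N t i 0)))"
        unfolding e rt sum_distrib_right by (rule sum.cong[OF refl]) (simp only: mult_ac)
    qed
    also have "\<dots> = (\<Sum>k\<le>j. of_nat (j choose k) * (\<sigma> (- r)) ^ (j - k) * S k i)"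
      unfolding S_def sum_distrib_left by (rule sum.swap)
    also have "\<dots> = (\<Sum>k\<le>j. if k = j then S j i else 0)"
      by (rule sum.cong[OF refl]) (use below[OF _ i] in auto)
    finally show ?thesis by simp
  qed
  from j obtain i0 where i0: "i0 < d" "S j i0 \<noteq> 0" by blast
  \<comment> \<open>The moment has entries in the extension. A functional that is nonzero at one of
    them carries the vector back to the small field, where N is defined.\<close>
  obtain u where u: "\<iota>.lin_functional u" "u (S j i0) \<noteq> 0" using \<iota>.exists_lin_functional[OF i0(2)] by blast
  have "(\<Sum>l<d. N r i l * u (S j l)) = u (S j i)" if "i < d" for r i
  proof -
    have "u (\<Sum>l<d. \<iota> (N r i l) * S j l) = u (S j i)" using fixed[OF that] by simp
    then show ?thesis by (simp only: \<iota>.lin_functional_sum[OF u(1)] \<iota>.lin_functional_scale[OF u(1)])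
  qed
  then show ?thesis using i0(1) u(2) by (intro exI[of _ "\<lambda>i. u (S j i)"]) auto
qed

definition app :: "nat \<Rightarrow> 'k::field mat \<Rightarrow> (nat \<Rightarrow> 'k) \<Rightarrow> nat \<Rightarrow> 'k" where
  "app d M v i = (\<Sum>j<d. M $$ (i, j) * v j)"

lemma app_mult:
  assumes "M \<in> carrier_mat d d" "N \<in> carrier_mat d d" "i < d"
  shows "app d (M * N) v i = app d M (app d N v) i"
proof -
  have "app d (M * N) v i = (\<Sum>j<d. (\<Sum>l<d. M $$ (i, l) * N $$ (l, j)) * v j)"
    unfolding app_def by (rule sum.cong[OF refl]) (use mat_mult_index[OF assms(1,2,3)] in simp)
  then show ?thesis by (simp only: app_def sum_assoc)
qed

lemma app_cong: "(\<And>j. j < d \<Longrightarrow> v j = w j) \<Longrightarrow> app d M v i = app d M w i"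
  unfolding app_def by (rule sum.cong) auto

lemma app_sum: "app d M (\<lambda>j. \<Sum>t\<in>T. f t j) i = (\<Sum>t\<in>T. app d M (f t) i)"
  unfolding app_def by (simp add: sum_distrib_left) (rule sum.swap)

text \<open>The vectors annihilated by all functionals a \<rho>(g) form a submodule containing v. If
  it is zero, v vanishes; if it is everything, the functional a, obtained at the unit of the group,
  vanishes.\<close>

lemma simple_separates:
  fixes \<rho> :: "'g \<Rightarrow> 'k::field mat"
  assumes simple: "simple_module G mul e d \<rho>" and e: "e \<in> G" and mul: "\<And>g h. g \<in> G \<Longrightarrow> h \<in> G \<Longrightarrow> mul g h \<in> G"
    and zero: "\<And>g. g \<in> G \<Longrightarrow> (\<Sum>i<d. a i * app d (\<rho> g) v i) = 0"
  shows "(\<forall>i<d. a i = 0) \<or> (\<forall>i<d. v i = 0)"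
proof -
  have rep: "is_rep G mul e d \<rho>" and sub: "\<And>W. submodule G d \<rho> W \<Longrightarrow> W = {0\<^sub>v d} \<or> W = carrier_vec d"
    using simple by (auto simp: simple_module_def)
  have car: "\<rho> g \<in> carrier_mat d d" if "g \<in> G" for g using rep that by (simp add: is_rep_def)
  define W where "W = {w \<in> carrier_vec d. \<forall>g\<in>G. (\<Sum>i<d. a i * app d (\<rho> g) (($) w) i) = 0}"
  have "submodule G d \<rho> W"
    unfolding submodule_def
  proof (intro conjI ballI allI)
    show "W \<subseteq> carrier_vec d" by (auto simp: W_def)
    show "0\<^sub>v d \<in> W" by (simp add: W_def app_def)
  next
    fix x y assume xy: "x \<in> W" "y \<in> W"
    have "app d (\<rho> g) (($) (x + y)) i = app d (\<rho> g) (($) x) i + app d (\<rho> g) (($) y) i" for g i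
    proof -
      have "app d (\<rho> g) (($) (x + y)) i = app d (\<rho> g) (\<lambda>j. x $ j + y $ j) i"
        by (rule app_cong) (use xy in \<open>auto simp: W_def\<close>)
      then show ?thesis by (simp add: app_def distrib_left sum.distrib)
    qed
    then show "x + y \<in> W" using xy by (simp add: W_def distrib_left sum.distrib)
  next
    fix c x assume x: "x \<in> W"
    have "app d (\<rho> g) (($) (c \<cdot>\<^sub>v x)) i = c * app d (\<rho> g) (($) x) i" for g i
    proof -
      have "app d (\<rho> g) (($) (c \<cdot>\<^sub>v x)) i = app d (\<rho> g) (\<lambda>j. c * x $ j) i"
        by (rule app_cong) (use x in \<open>auto simp: W_def\<close>)
      then show ?thesis by (simp add: app_def sum_distrib_left mult_ac)
    qed
    then have "(\<Sum>i<d. a i * app d (\<rho> g) (($) (c \<cdot>\<^sub>v x)) i) = c * (\<Sum>i<d. a i * app d (\<rho> g) (($) x) i)" for g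
      by (simp add: sum_distrib_left mult_ac)
    then show "c \<cdot>\<^sub>v x \<in> W" using x by (simp add: W_def)
  next
    fix g x assume g: "g \<in> G" and x: "x \<in> W"
    have xc: "x \<in> carrier_vec d" using x by (simp add: W_def)
    have "(\<Sum>i<d. a i * app d (\<rho> h) (($) (\<rho> g *\<^sub>v x)) i) = 0" if h: "h \<in> G" for h
    proof -
      have "(\<rho> g *\<^sub>v x) $ j = app d (\<rho> g) (($) x) j" if "j < d" for j
        using that car[OF g] xc by (simp add: app_def scalar_prod_def atLeast0LessThan)
      then have "app d (\<rho> h) (($) (\<rho> g *\<^sub>v x)) i = app d (\<rho> h) (app d (\<rho> g) (($) x)) i" for i
        by (rule app_cong)
      then have "(\<Sum>i<d. a i * app d (\<rho> h) (($) (\<rho> g *\<^sub>v x)) i) = (\<Sum>i<d. a i * app d (\<rho> h * \<rho> g) (($) x) i)"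
        using app_mult[OF car[OF h] car[OF g]] by simp
      also have "\<rho> h * \<rho> g = \<rho> (mul h g)" using rep h g by (simp add: is_rep_def)
      also have "(\<Sum>i<d. a i * app d (\<rho> (mul h g)) (($) x) i) = 0" using x mul[OF h g] by (simp add: W_def)
      finally show ?thesis .
    qed
    then show "\<rho> g *\<^sub>v x \<in> W" using car[OF g] xc by (simp add: W_def)
  qed
  from sub[OF this] show ?thesis
  proof
    assume W: "W = {0\<^sub>v d}"
    have "app d (\<rho> g) (($) (vec d v)) i = app d (\<rho> g) v i" for g i by (rule app_cong) simp
    then have "(\<Sum>i<d. a i * app d (\<rho> g) (($) (vec d v)) i) = 0" if "g \<in> G" for g
      using zero[OF that] by (simp only:)
    then have "vec d v \<in> W" unfolding W_def by simp
    then have "vec d v = 0\<^sub>v d" using W by simp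
    have "v i = 0" if "i < d" for i
    proof -
      have "vec_index (vec d v) i = vec_index (0\<^sub>v d) i" by (simp only: \<open>vec d v = 0\<^sub>v d\<close>)
      then show ?thesis using that by simp
    qed
    then show ?thesis by simp
  next
    assume W: "W = carrier_vec d"
    have "a i = 0" if i: "i < d" for i
    proof -
      have "unit_vec d i \<in> W" unfolding W by simp
      then have 0: "(\<Sum>j<d. a j * app d (\<rho> e) (($) (unit_vec d i)) j) = 0" using e by (simp add: W_def)
      have "\<rho> e = 1\<^sub>m d" using rep by (simp add: is_rep_def)
      then have "app d (\<rho> e) (($) (unit_vec d i)) j = (if j = i then 1 else 0)" if "j < d" for j
        using that i by (simp add: app_def unit_vec_def if_distrib[of "\<lambda>z. _ * z"] cong: if_cong)
      then have "(\<Sum>j<d. a j * app d (\<rho> e) (($) (unit_vec d i)) j) = (\<Sum>j<d. if j = i then a i else 0)"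
        by (intro sum.cong) auto
      then show ?thesis using 0 i by simp
    qed
    then show ?thesis by simp
  qed
qed

locale sl2_simple =
  fixes \<rho> :: "'q::{finite,field} mat \<Rightarrow> 'k::field mat" and d p n :: nat and \<sigma> :: "'q \<Rightarrow> 'K::field" and \<iota> :: "'k \<Rightarrow> 'K"
  assumes simple: "simple_module SL2 (*) (1\<^sub>m 2) d \<rho>" and sigma: "field_hom \<sigma>" and iota: "field_hom \<iota>"
    and p: "prime p" "CHAR('K) = p" and q: "card (UNIV :: 'q set) = p ^ n" and n: "n \<ge> 1"
    and charq: "(of_nat (card (UNIV :: 'q set)) :: 'k) = 0"
begin

lemma rep: "is_rep SL2 (*) (1\<^sub>m 2) d \<rho>" and d: "d > 0"
  using simple by (simp_all add: simple_module_def)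

lemma car: "g \<in> SL2 \<Longrightarrow> \<rho> g \<in> carrier_mat d d" using rep by (simp add: is_rep_def)

lemma rho_mult: "g \<in> SL2 \<Longrightarrow> h \<in> SL2 \<Longrightarrow> \<rho> (g * h) = \<rho> g * \<rho> h" using rep by (simp add: is_rep_def)

lemma one_SL2: "1\<^sub>m 2 \<in> (SL2 :: 'q mat set)" by (simp add: SL2_def)

lemma one_eq_sl: "1\<^sub>m 2 = (sl 1 0 0 1 :: 'q mat)" by (rule mat2_eqI) simp_all

lemma separates:
  assumes "\<And>g. g \<in> SL2 \<Longrightarrow> (\<Sum>i<d. a i * app d (\<rho> g) v i) = 0"
  shows "(\<forall>i<d. a i = 0) \<or> (\<forall>i<d. v i = 0)"
  by (rule simple_separates[OF simple one_SL2 SL2_mult assms])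

text \<open>The second claim is the first for transposed matrices, which satisfy the same additivity
  because the unitriangular group is commutative.\<close>

lemma fixed_vectors:
  shows "\<exists>m. (\<exists>i<d. m i \<noteq> 0) \<and> (\<forall>t. \<forall>i<d. app d (\<rho> (sl 1 t 0 1)) m i = m i)"
    and "\<exists>\<phi>. (\<exists>i<d. \<phi> i \<noteq> 0) \<and> (\<forall>t. \<forall>j<d. (\<Sum>i<d. \<phi> i * \<rho> (sl 1 t 0 1) $$ (i, j)) = \<phi> j)"
proof -
  have u: "sl 1 t 0 1 \<in> (SL2 :: 'q mat set)" for t by simp
  have add: "\<rho> (sl 1 (s + t) 0 1) = \<rho> (sl 1 s 0 1) * \<rho> (sl 1 t 0 1)" for s t
    using rho_mult[OF u[of s] u[of t]] by (simp add: sl_mult add.commute)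
  have 0: "\<rho> (sl 1 0 0 1) = 1\<^sub>m d" using rep by (simp add: is_rep_def flip: one_eq_sl)
  have e: "\<rho> (sl 1 (s + t) 0 1) $$ (i, j) = (\<Sum>l<d. \<rho> (sl 1 s 0 1) $$ (i, l) * \<rho> (sl 1 t 0 1) $$ (l, j))"
    if "i < d" "j < d" for s t i j
    unfolding add by (rule mat_mult_index[OF car[OF u] car[OF u] that])
  show "\<exists>m. (\<exists>i<d. m i \<noteq> 0) \<and> (\<forall>t. \<forall>i<d. app d (\<rho> (sl 1 t 0 1)) m i = m i)"
    unfolding app_def
    by (rule unipotent_fixed_vector[OF sigma iota d, of "\<lambda>t i j. \<rho> (sl 1 t 0 1) $$ (i, j)"]) (simp_all add: e 0)
  have "\<exists>\<phi>. (\<exists>i<d. \<phi> i \<noteq> 0) \<and> (\<forall>t. \<forall>i<d. (\<Sum>j<d. \<rho> (sl 1 t 0 1) $$ (j, i) * \<phi> j) = \<phi> i)"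
  proof (rule unipotent_fixed_vector[OF sigma iota d, of "\<lambda>t i j. \<rho> (sl 1 t 0 1) $$ (j, i)"])
    fix s t i j assume ij: "i < d" "j < d"
    show "\<rho> (sl 1 (s + t) 0 1) $$ (j, i) = (\<Sum>l<d. \<rho> (sl 1 s 0 1) $$ (l, i) * \<rho> (sl 1 t 0 1) $$ (j, l))"
      unfolding add.commute[of s] e[OF ij(2,1)] by (simp add: mult.commute)
  qed (simp add: 0 eq_commute)
  then show "\<exists>\<phi>. (\<exists>i<d. \<phi> i \<noteq> 0) \<and> (\<forall>t. \<forall>j<d. (\<Sum>i<d. \<phi> i * \<rho> (sl 1 t 0 1) $$ (i, j)) = \<phi> j)"
    by (simp only: mult.commute)
qed

definition ev :: "(nat \<Rightarrow> 'k) \<Rightarrow> 'q mat \<Rightarrow> (nat \<Rightarrow> 'k) \<Rightarrow> 'k" where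
  "ev \<phi> h v = (\<Sum>i<d. \<phi> i * app d (\<rho> h) v i)"

lemma ev_mult: "g \<in> SL2 \<Longrightarrow> h \<in> SL2 \<Longrightarrow> ev \<phi> (g * h) v = ev \<phi> g (app d (\<rho> h) v)"
  unfolding ev_def by (rule sum.cong[OF refl]) (simp add: rho_mult app_mult[OF car car])

lemma ev_cong: "(\<And>i. i < d \<Longrightarrow> v i = w i) \<Longrightarrow> ev \<phi> h v = ev \<phi> h w"
  unfolding ev_def using app_cong[of d v w] by simp

lemma ev_sum: "ev \<phi> h (\<lambda>i. \<Sum>t\<in>T. f t i) = (\<Sum>t\<in>T. ev \<phi> h (f t))"
  unfolding ev_def app_sum by (simp add: sum_distrib_left) (rule sum.swap)

text \<open>Either the unipotent fixed vector m or its transform by the sum over the big cell works: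
  the matrix coefficient of the latter vanishes at 0, and if the latter is zero then the matrix
  coefficient of m sums to 0.\<close>

lemma kernel_exists:
  "\<exists>\<phi> m H. (\<exists>i<d. \<phi> i \<noteq> 0) \<and> (\<exists>i<d. m i \<noteq> 0) \<and>
     (\<forall>h\<in>SL2. ev \<phi> h m = H (h $$ (Suc 0, 0))) \<and> (H 0 = 0 \<or> (\<Sum>z\<in>UNIV. H z) = 0)"
proof -
  obtain m where *: "(\<exists>i<d. m i \<noteq> 0) \<and> (\<forall>t. \<forall>i<d. app d (\<rho> (sl 1 t 0 1)) m i = m i)"
    using fixed_vectors(1) by (elim exE) (rule that)
  note m = *[THEN conjunct1] *[THEN conjunct2]
  obtain \<phi> where *: "(\<exists>i<d. \<phi> i \<noteq> 0) \<and> (\<forall>t. \<forall>j<d. (\<Sum>i<d. \<phi> i * \<rho> (sl 1 t 0 1) $$ (i, j)) = \<phi> j)"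
    using fixed_vectors(2) by (elim exE) (rule that)
  note \<phi> = *[THEN conjunct1] *[THEN conjunct2]
  have u: "sl 1 t 0 1 \<in> (SL2 :: 'q mat set)" for t by simp
  have left: "ev \<phi> (sl 1 t 0 1 * h) v = ev \<phi> h v" if "h \<in> SL2" for t h v
  proof -
    have "ev \<phi> (sl 1 t 0 1 * h) v = (\<Sum>i<d. \<phi> i * (\<Sum>j<d. \<rho> (sl 1 t 0 1) $$ (i, j) * app d (\<rho> h) v j))"
      unfolding ev_mult[OF u that] unfolding ev_def app_def ..
    also have "\<dots> = ev \<phi> h v"
      unfolding sum_assoc ev_def by (rule sum.cong[OF refl]) (use \<phi>(2) in simp)
    finally show ?thesis .
  qed
  have right: "ev \<phi> (h * sl 1 t 0 1) m = ev \<phi> h m" if "h \<in> SL2" for t h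
    unfolding ev_mult[OF that u] by (rule ev_cong) (use m(2) in simp)
  define E where "E z = ev \<phi> (sl 0 (- 1 / z) z 0) m" for z
  define D where "D z = ev \<phi> (sl z 0 0 (1 / z)) m" for z
  \<comment> \<open>Bruhat decomposition: off the upper triangular matrices, an element is a product
    of two unitriangular factors around one that depends only on c, and the coefficient does not see
    the outer factors.\<close>
  have evE: "ev \<phi> (sl a b c e) m = E c" if "a * e - b * c = 1" "c \<noteq> 0" for a b c e
  proof -
    have eq: "sl a b c e = sl 1 (a / c) 0 1 * (sl 0 (- 1 / c) c 0 * sl 1 (e / c) 0 1)"
      using that by (simp add: sl_mult field_simps)
    have w: "sl 0 (- 1 / c) c 0 \<in> SL2" using that by simp
    show ?thesis unfolding eq left[OF SL2_mult[OF w u]] right[OF w] E_def ..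
  qed
  have evD: "ev \<phi> (sl a b 0 e) m = D a" if "a * e = 1" for a b e
  proof -
    have a0: "a \<noteq> 0" using that by auto
    then have "e = 1 / a" using that by (simp add: eq_divide_eq mult.commute)
    note a = a0 this
    have eq: "sl a b 0 e = sl a 0 0 (1 / a) * sl 1 (b / a) 0 1" using a by (simp add: sl_mult)
    have w: "sl a 0 0 (1 / a) \<in> SL2" using a by simp
    show ?thesis unfolding eq right[OF w] D_def ..
  qed
  \<comment> \<open>The sum over t of u(t) w m, with u(t) unitriangular and w a representative of
    the Weyl element. In \<open>f\<close>, the value D stands for the one t at which the translate
    leaves the big cell.\<close>
  define m2 where "m2 i = (\<Sum>t\<in>UNIV. app d (\<rho> (sl (- t) 1 (- 1) 0)) m i)" for i
  define f where "f c z = (if z \<noteq> 0 then E z else D (1 / c))" for c z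
  have w: "sl (- t) 1 (- 1) 0 \<in> (SL2 :: 'q mat set)" for t by simp
  have ev2: "ev \<phi> (sl a b c e) m2 = (if c = 0 then 0 else \<Sum>z\<in>UNIV. f c z)" if det: "a * e - b * c = 1" for a b c e
  proof -
    have s: "sl a b c e \<in> SL2" using det by simp
    have cofactor_eq: "- (a * t + b) * c = 1" if "- (c * t + e) = 0" for t
    proof -
      have "c * t + e = 0" using that by (simp only: neg_equal_0_iff_equal)
      then have e: "- (c * t) = e" by (rule minus_unique)
      have "- (a * t + b) * c = a * e - b * c" unfolding e[symmetric] by (simp add: algebra_simps)
      then show ?thesis by (simp only: det)
    qed
    have t1: "ev \<phi> (sl a b c e * sl (- t) 1 (- 1) 0) m = (if - (c * t + e) \<noteq> 0 then E (- (c * t + e)) else D (- (a * t + b)))" for t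
    proof -
      have eq: "sl a b c e * sl (- t) 1 (- 1) 0 = sl (- (a * t + b)) a (- (c * t + e)) c" by (simp add: sl_mult)
      show ?thesis
      proof (cases "- (c * t + e) = 0")
        case True
        have "- (a * t + b) * c = 1" by (rule cofactor_eq[OF True])
        from evD[OF this, of a] show ?thesis unfolding eq True by simp
      next
        case False
        have "- (a * t + b) * c - a * - (c * t + e) = 1" using det by (simp add: algebra_simps)
        from evE[OF this False] show ?thesis unfolding eq using False by simp
      qed
    qed
    have "ev \<phi> (sl a b c e) m2 = (\<Sum>t\<in>UNIV. ev \<phi> (sl a b c e * sl (- t) 1 (- 1) 0) m)"
      unfolding m2_def ev_sum by (rule sum.cong[OF refl]) (simp only: ev_mult[OF s w])
    \<comment> \<open>For c = 0 the q summands agree, and q is zero in characteristic p. Otherwise t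
      runs through the field exactly once as z = - (c t + e).\<close>
    also have "\<dots> = (if c = 0 then 0 else \<Sum>z\<in>UNIV. f c z)"
    proof (cases "c = 0")
      case True
      then have "e \<noteq> 0" using det by auto
      then show ?thesis unfolding t1 using True charq by simp
    next
      case False
      have "(\<Sum>t\<in>UNIV. ev \<phi> (sl a b c e * sl (- t) 1 (- 1) 0) m) = (\<Sum>t\<in>UNIV. f c (- (c * t + e)))"
      proof (rule sum.cong[OF refl])
        fix t
        show "ev \<phi> (sl a b c e * sl (- t) 1 (- 1) 0) m = f c (- (c * t + e))"
        proof (cases "- (c * t + e) = 0")
          case True
          have "- (a * t + b) * c = 1" by (rule cofactor_eq[OF True])
          then have "- (a * t + b) = 1 / c" using False by (simp add: field_simps)
          then show ?thesis unfolding t1 f_def using True by simp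
        qed (simp add: t1 f_def)
      qed
      also have "\<dots> = (\<Sum>z\<in>UNIV. f c z)"
        by (rule sum.reindex_bij_betw, rule bij_betw_byWitness[where f' = "\<lambda>z. (- z - e) / c"]) (use False in \<open>auto simp: field_simps\<close>)
      finally show ?thesis using False by simp
    qed
    finally show ?thesis .
  qed
  show ?thesis
  proof (cases "\<exists>i<d. m2 i \<noteq> 0")
    case True
    define H where "H c = (if c = 0 then 0 else \<Sum>z\<in>UNIV. f c z)" for c
    have "ev \<phi> h m2 = H (h $$ (Suc 0, 0))" if h: "h \<in> SL2" for h
    proof -
      have "h $$ (0, 0) * h $$ (Suc 0, Suc 0) - h $$ (0, Suc 0) * h $$ (Suc 0, 0) = 1"
        using h by (simp add: SL2_def flip: det_mat2)
      from ev2[OF this] show ?thesis unfolding sl_eta[OF SL2_carrier[OF h]] H_def .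
    qed
    moreover have "H 0 = 0" by (simp add: H_def)
    ultimately show ?thesis using True \<phi>(1)
      by (intro exI[of _ \<phi>] exI[of _ m2] exI[of _ H] conjI ballI disjI1)
  next
    case False
    then have z: "app d (\<rho> h) m2 i = 0" for h i unfolding app_def by (intro sum.neutral) auto
    have f0: "(\<Sum>z\<in>UNIV. f c z) = 0" if "c \<noteq> 0" for c
      using ev2[of 0 0 "- 1 / c" c] that z by (simp add: ev_def)
    define H where "H c = f 1 c" for c
    \<comment> \<open>The sums of f over z vanish for all c \<noteq> 0 and differ only in the term
      D(1 / c). So D is constant, and the coefficient of m itself depends on the lower left entry
      alone.\<close>
    have D: "D a = D 1" if "a \<noteq> 0" for a
    proof -
      have s: "(\<Sum>z\<in>UNIV. f c z) = D (1 / c) + (\<Sum>z\<in>UNIV - {0}. E z)" for c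
        by (subst sum.remove[of UNIV 0]) (auto simp: f_def)
      have "D a + (\<Sum>z\<in>UNIV - {0}. E z) = 0" using f0[of "1 / a"] that s[of "1 / a"] by simp
      moreover have "D 1 + (\<Sum>z\<in>UNIV - {0}. E z) = 0" using f0[of 1] s[of 1] by simp
      ultimately show ?thesis by (metis add_right_imp_eq)
    qed
    have "ev \<phi> h m = H (h $$ (Suc 0, 0))" if h: "h \<in> SL2" for h
    proof -
      have det: "h $$ (0, 0) * h $$ (Suc 0, Suc 0) - h $$ (0, Suc 0) * h $$ (Suc 0, 0) = 1"
        using h by (simp add: SL2_def flip: det_mat2)
      show ?thesis
      proof (cases "h $$ (Suc 0, 0) = 0")
        case True
        then have 1: "h $$ (0, 0) * h $$ (Suc 0, Suc 0) = 1" using det by simp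
        then have "h $$ (0, 0) \<noteq> 0" by auto
        then have "D (h $$ (0, 0)) = D 1" by (rule D)
        moreover have "sl (h $$ (0, 0)) (h $$ (0, Suc 0)) 0 (h $$ (Suc 0, Suc 0)) = h"
          using sl_eta[OF SL2_carrier[OF h]] unfolding True .
        moreover have "H (h $$ (Suc 0, 0)) = D 1" unfolding True by (simp add: H_def f_def)
        ultimately show ?thesis using evD[OF 1, of "h $$ (0, Suc 0)"] by (simp only:)
      next
        case False
        have "H (h $$ (Suc 0, 0)) = E (h $$ (Suc 0, 0))" using False by (simp add: H_def f_def)
        then show ?thesis using evE[OF det False] unfolding sl_eta[OF SL2_carrier[OF h]] by (simp only:)
      qed
    qed
    moreover have "(\<Sum>z\<in>UNIV. H z) = 0" unfolding H_def using f0[of 1] by simp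
    ultimately show ?thesis using m(1) \<phi>(1)
      by (intro exI[of _ \<phi>] exI[of _ m] exI[of _ H] conjI ballI disjI2)
  qed
qed

theorem simple_inadd:
  "inadd SL2 (base_change \<iota> (jrep d \<rho>)) {twisted p (nat2 \<sigma>) C s | C s. finite C}"
proof -
  interpret \<sigma>: field_hom \<sigma> by (rule sigma)
  interpret \<iota>: field_hom \<iota> by (rule iota)
  obtain \<phi> m H where *: "(\<exists>i<d. \<phi> i \<noteq> 0) \<and> (\<exists>i<d. m i \<noteq> 0) \<and>
     (\<forall>h\<in>SL2. ev \<phi> h m = H (h $$ (Suc 0, 0))) \<and> (H 0 = 0 \<or> (\<Sum>z\<in>UNIV. H z) = 0)"
    using kernel_exists by (elim exE) (rule that)
  note \<phi> = *[THEN conjunct1] and m = *[THEN conjunct2, THEN conjunct1]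
    and H = *[THEN conjunct2, THEN conjunct2, THEN conjunct1] and H0 = *[THEN conjunct2, THEN conjunct2, THEN conjunct2]
  define A where "A y l = (\<Sum>i<d. \<phi> i * \<rho> y $$ (i, l))" for y l
  define B where "B l x = app d (\<rho> x) m l" for l x
  have q2: "card (UNIV :: 'q set) \<ge> 2" by (rule card_field_ge_2)
  have evA: "(\<Sum>l<d. A y l * v l) = ev \<phi> y v" for y v
    unfolding A_def ev_def app_def by (rule sum_assoc[symmetric])
  interpret K: sl2_kernel \<sigma> p n "{..<d}" "\<lambda>g i j. \<iota> (\<rho> g $$ (i, j))" "\<lambda>y l. \<iota> (A y l)" "\<lambda>l x. \<iota> (B l x)" "\<lambda>z. \<iota> (H z)"
  proof
    show "prime p" "CHAR('K) = p" by (rule p)+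
    show "card (UNIV :: 'q set) = p ^ n" by (rule q)
    show "finite {..<d}" by simp
  next
    fix g h :: "'q mat" and l assume g: "g \<in> SL2" and h: "h \<in> SL2" and l: "l \<in> {..<d}"
    have "(\<Sum>j<d. A g j * \<rho> h $$ (j, l)) = A (g * h) l"
      unfolding A_def sum_assoc[symmetric] rho_mult[OF g h]
      by (rule sum.cong[OF refl]) (use l mat_mult_index[OF car[OF g] car[OF h]] in simp)
    then show "(\<Sum>j<d. \<iota> (A g j) * \<iota> (\<rho> h $$ (j, l))) = \<iota> (A (g * h) l)"
      by (simp only: \<iota>.hom_mult[symmetric] \<iota>.hom_sum[symmetric])
  next
    fix h x :: "'q mat" and i assume h: "h \<in> SL2" and x: "x \<in> SL2" and i: "i \<in> {..<d}"
    have "(\<Sum>j<d. \<rho> h $$ (i, j) * B j x) = B i (h * x)"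
      unfolding B_def rho_mult[OF h x] using i by (simp add: app_mult[OF car[OF h] car[OF x]]) (simp add: app_def)
    then show "(\<Sum>j<d. \<iota> (\<rho> h $$ (i, j)) * \<iota> (B j x)) = \<iota> (B i (h * x))"
      by (simp only: \<iota>.hom_mult[symmetric] \<iota>.hom_sum[symmetric])
  next
    fix g x :: "'q mat" assume g: "g \<in> SL2" and x: "x \<in> SL2"
    have "(\<Sum>l<d. A g l * B l x) = H ((g * x) $$ (Suc 0, 0))"
      unfolding evA using bspec[OF H SL2_mult[OF g x]] ev_mult[OF g x, of \<phi> m] by (simp add: B_def ev_def app_def)
    then show "(\<Sum>l<d. \<iota> (A g l) * \<iota> (B l x)) = \<iota> (H ((g * x) $$ (Suc 0, 0)))"
      by (simp only: \<iota>.hom_mult[symmetric] \<iota>.hom_sum[symmetric])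
  next
    fix v :: "nat \<Rightarrow> 'K" and l
    assume v: "\<And>g. g \<in> SL2 \<Longrightarrow> (\<Sum>l<d. \<iota> (A g l) * v l) = 0" and l: "l \<in> {..<d}"
    \<comment> \<open>Simplicity, and with it separation, is given over the small field. A
      functional that does not vanish at v l transfers the relation to it.\<close>
    show "v l = 0"
    proof (rule ccontr)
      assume "v l \<noteq> 0"
      then obtain u where u: "\<iota>.lin_functional u" "u (v l) \<noteq> 0" using \<iota>.exists_lin_functional by blast
      have "(\<Sum>i<d. \<phi> i * app d (\<rho> g) (\<lambda>l. u (v l)) i) = 0" if g: "g \<in> SL2" for g
      proof -
        have "u (\<Sum>l<d. \<iota> (A g l) * v l) = 0" using v[OF g] \<iota>.lin_functional_zero[OF u(1)] by simp
        then have "(\<Sum>l<d. A g l * u (v l)) = 0"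
          by (simp only: \<iota>.lin_functional_sum[OF u(1)] \<iota>.lin_functional_scale[OF u(1)])
        then show ?thesis unfolding evA by (simp add: ev_def)
      qed
      from separates[OF this] show False using \<phi> u(2) l by auto
    qed
  next
    fix a :: "nat \<Rightarrow> 'K" and l
    assume a: "\<And>x. x \<in> SL2 \<Longrightarrow> (\<Sum>l<d. a l * \<iota> (B l x)) = 0" and l: "l \<in> {..<d}"
    show "a l = 0"
    proof (rule ccontr)
      assume "a l \<noteq> 0"
      then obtain u where u: "\<iota>.lin_functional u" "u (a l) \<noteq> 0" using \<iota>.exists_lin_functional by blast
      have "(\<Sum>i<d. u (a i) * app d (\<rho> x) m i) = 0" if x: "x \<in> SL2" for x
      proof -
        have "u (\<Sum>l<d. a l * \<iota> (B l x)) = 0" using a[OF x] \<iota>.lin_functional_zero[OF u(1)] by simp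
        then show ?thesis
          by (simp only: \<iota>.lin_functional_sum[OF u(1)] \<iota>.lin_functional_scale'[OF u(1)] B_def)
      qed
      from separates[OF this] show False using m u(2) l by auto
    qed
  next
    \<comment> \<open>The coefficients of 1 and of x^(q-1) are H(0) and minus the sum of all values
      of H, the two quantities of which \<open>kernel_exists\<close> makes one vanish.\<close>
    have k: "kap \<sigma> 0 t = (if t = 0 then 1 else 0)" for t
      using sum_kap_dual[OF sigma, of t 0] q2
      by (simp add: power_0_left if_distrib[of "\<lambda>z. _ * z"] cong: if_cong)
    have "gam \<sigma> (\<lambda>z. \<iota> (H z)) 0 = \<iota> (H 0)"
      unfolding gam_def k by (simp add: if_distrib[of "\<lambda>z. z * _"] cong: if_cong)
    moreover have "gam \<sigma> (\<lambda>z. \<iota> (H z)) (card (UNIV :: 'q set) - 1) = - \<iota> (\<Sum>z\<in>UNIV. H z)"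
      using q2 by (simp add: gam_def kap_def hom_distribs sum_negf)
    ultimately show "gam \<sigma> (\<lambda>z. \<iota> (H z)) 0 = 0 \<or> gam \<sigma> (\<lambda>z. \<iota> (H z)) (card (UNIV :: 'q set) - 1) = 0"
      using H0 by auto
  qed
  have "base_change \<iota> (jrep d \<rho>) = ({..<d}, \<lambda>g i j. \<iota> (\<rho> g $$ (i, j)))"
    by (simp add: base_change_def jrep_def)
  then show ?thesis using K.kernel_inadd by simp
qed

theorem tensor_pow_inadd:
  "m \<ge> 1 \<Longrightarrow> inadd SL2 (base_change \<iota> (jrep (d ^ m) (tensor_pow \<rho> m))) {twisted p (nat2 \<sigma>) C s | C s. finite C}"
proof (induction m rule: nat_induct_at_least)
  case base
  show ?case using simple_inadd by simp
next
  case (Suc m)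
  interpret \<iota>: field_hom \<iota> by (rule iota)
  let ?T = "jrep (d ^ m) (tensor_pow \<rho> m)"
  have 1: "inadd SL2 (jrep (d ^ Suc m) (tensor_pow \<rho> (Suc m))) {tens ?T (jrep d \<rho>)}"
    by (rule tensor_pow_inadd_tens[OF car Suc.hyps d])
  have eq: "base_change \<iota> (tens ?T (jrep d \<rho>)) = tens (base_change \<iota> ?T) (base_change \<iota> (jrep d \<rho>))"
    by (simp add: base_change_def tens_def hom_distribs)
  have "inadd SL2 (base_change \<iota> (jrep (d ^ Suc m) (tensor_pow \<rho> (Suc m)))) {tens (base_change \<iota> ?T) (base_change \<iota> (jrep d \<rho>))}"
    using \<iota>.inadd_base_change[OF 1] by (simp only: image_insert image_empty eq)
  then show ?case
    by (rule inadd_trans_singleton[OF _ inadd_tens_closed[OF Suc.IH simple_inadd]]) simp_all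
qed

end

theorem mainTheorem2:
  fixes p n :: nat and d :: nat and \<rho> :: "'q::{finite,field} mat \<Rightarrow> 'k::field mat"
  assumes "prime p" and "n \<ge> 1"
    and "card (UNIV :: 'q set) = p ^ n"
    and "CHAR('k) = p"
    and "simple_module (SL2 :: 'q mat set) (*) (1\<^sub>m 2) d \<rho>"
  shows "algebraic (SL2 :: 'q mat set) (*) (1\<^sub>m 2) d \<rho>"
proof -
  have iota: "field_hom (to_ac :: 'k \<Rightarrow> 'k alg_closure)" by unfold_locales simp_all
  have charK: "CHAR('k alg_closure) = p" using assms(4) by simp
  \<comment> \<open>The order p^n of the field vanishes in it, so its characteristic, a prime,
    divides p^n.\<close>
  have charq: "CHAR('q) = p"
  proof -
    have "of_nat (p ^ n) = (0 :: 'q)" using of_nat_card_field[where 'q = 'q] unfolding assms(3) .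
    then have "CHAR('q) dvd p ^ n" by (simp only: of_nat_eq_0_iff_char_dvd)
    moreover have "CHAR('q) > 0" by (rule finite_imp_CHAR_pos) (rule finite_UNIV)
    then have "prime CHAR('q)" by (rule prime_CHAR_semidom)
    ultimately show ?thesis using prime_dvd_power_nat primes_dvd_imp_eq[OF _ assms(1)] by blast
  qed
  obtain \<sigma> :: "'q \<Rightarrow> 'k alg_closure" where sigma: "field_hom \<sigma>"
    using finite_field_embedding[OF assms(1) charq charK] by blast
  interpret \<sigma>: field_hom \<sigma> by (rule sigma)
  have "p dvd p ^ n" using assms(2) by simp
  then have charq0: "of_nat (card (UNIV :: 'q set)) = (0 :: 'k)"
    unfolding assms(3) of_nat_eq_0_iff_char_dvd assms(4) .
  interpret M: sl2_simple \<rho> d p n \<sigma> "to_ac :: 'k \<Rightarrow> 'k alg_closure"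
    by (rule sl2_simple.intro[OF assms(5) sigma iota assms(1) charK assms(3,2) charq0])
  let ?\<B> = "(\<lambda>q. twisted p (nat2 \<sigma>) {..<fst q} (snd q)) ` (SIGMA m:{..n * (2 * p - 2)}. {..<m} \<rightarrow>\<^sub>E {..<n})"
  have per: "nat2 \<sigma> g x y ^ (p ^ n) = nat2 \<sigma> g x y" for g x y
    unfolding nat2_def \<sigma>.hom_power[symmetric] assms(3)[symmetric] finite_field_power_card ..
  show ?thesis
  proof (rule algebraic_of_finite_cover[OF iota M.rep])
    show "finite ?\<B>" 
      by (rule finite_imageI, rule finite_SigmaI, rule finite_atMost, rule finite_PiE, rule finite_lessThan, rule finite_lessThan)
    show "finite (fst D)" if "D \<in> ?\<B>" for D using that by (elim imageE) simp
    fix m :: nat assume m: "m \<ge> 1"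
    show "inadd SL2 (base_change to_ac (jrep (d ^ m) (tensor_pow \<rho> m))) ?\<B>"
    proof (rule inadd_trans[OF M.tensor_pow_inadd[OF m]])
      fix D assume "D \<in> {twisted p (nat2 \<sigma>) C s | C s. finite C}"
      then obtain C s where D: "D = twisted p (nat2 \<sigma>) C s" and C: "finite C" by blast
      have "inadd SL2 D ?\<B>"
        unfolding D by (rule twisted_finite_cover[OF unimodular_nat2[OF sigma] assms(1) charK assms(2) per C])
      then show "inadd SL2 D ?\<B> \<and> finite (fst D)" using C by (simp add: D)
    qed
  qed
qed

end
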